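(* Let $M$ be an $m$-dimensional globally hyperbolic spacetime admitting a compact spacelike Cauchy surface, let $0\le k\le m$ and $\varepsilon=(-1)^{k(m-k)+1}$. Let $(\mathscr H^k_{\rm free},\pi^k_{\rm free})$ and $(\mathscr H^{m-k}_{\rm free},\pi^{m-k}_{\rm free})$ be the GNS representations of the states $\omega_{\rm free}$ on $\mathcal W(\mathsf{Top}^k_{\rm free}(M))$ and $\mathcal W(\mathsf{Top}^{m-k}_{\rm free}(M))$ (see context). Then $$U^k_{\rm free}:\mathscr H^k_{\rm free}\to\mathscr H^{m-k}_{\rm free},\qquad|z,\tilde z\rangle\mapsto|\tilde z,\varepsilon z\rangle$$ is an isomorphism of Hilbert spaces which implements duality: $$U^k_{\rm free}\,\pi^k_{\rm free}(a)\,(U^k_{\rm free})^{-1}=\pi^{m-k}_{\rm free}\big(\mathcal W(\zeta_{\rm free})(a)\big)\qquad\text{for all }a\in\mathcal W(\mathsf{Top}^k_{\rm free}(M)).$$ It intertwines the phase, shift and flux operators in degrees $k$ and $m-k$; in particular, for $m=2k$, $U^k_{\rm free}$ is a unitary operator on $\mathscr H^k_{\rm free}$ with $$P^k(\tilde r,(-1)^{k^2+1}r)\,U^k_{\rm free}=U^k_{\rm free}\,P^k(r,\tilde r)\qquad\text{for all }(r,\tilde r)\in H^{k-1}(M;\mathbb R)\times H^{k-1}(M;\mathbb R).$$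
   Context: A spacetime is an oriented and time-oriented (connected, finite type) Lorentzian manifold. $\mathbb T=\mathbb R/\mathbb Z$; $A^{p,q}=A^p\times A^q$ for a graded group $A$, groups in negative degree being $0$. $i_\Sigma:\Sigma\to M$ is the embedding of a compact spacelike Cauchy surface, oriented by the orientation and time-orientation of $M$. $H^p_{\rm free}(\cdot;\mathbb Z)$ is $H^p(\cdot;\mathbb Z)$ modulo torsion, $q$ the quotient map, viewed as a lattice in $H^p(\cdot;\mathbb R)$; $\mu:H^p(\cdot;\mathbb R)/H^p_{\rm free}(\cdot;\mathbb Z)\to H^p(\cdot;\mathbb T)$ is induced by $\mathbb R\to\mathbb T$. $\mathsf{Top}^k_{\rm free}(M)=\frac{H^{k-1,m-k-1}(M;\mathbb R)}{H^{k-1,m-k-1}_{\rm free}(M;\mathbb Z)}\oplus H^{k,m-k}_{\rm free}(M;\mathbb Z)$ with $\sigma_{\rm free}((u,\tilde u,z,\tilde z),(u',\tilde u',z',\tilde z'))=\langle\tilde u,z'\rangle-(-1)^{k(m-k)}\langle u,\tilde z'\rangle-\langle\tilde u',z\rangle+(-1)^{k(m-k)}\langle u',\tilde z\rangle\in\mathbb T$, where $\langle v,w\rangle=(\mu\,i_\Sigma^*v\smile i_\Sigma^*y)[\Sigma]$ for any integral class $y$ with $qy=w$. Duality: $\zeta_{\rm free}(u,\tilde u,z,\tilde z)=(\tilde u,\varepsilon u,\tilde z,\varepsilon z)\in\mathsf{Top}^{m-k}_{\rm free}(M)$; it preserves $\sigma_{\rm free}$. Weyl algebra: for an abelian group $G$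 with antisymmetric bihomomorphism $\sigma:G\times G\to\mathbb T$, $\mathcal W(G)$ is the enveloping $C^*$-algebra of the Banach $*$-algebra obtained by completing, in the norm $\|\sum_j\alpha_jW(g_j)\|_1=\sum_j|\alpha_j|$ (distinct $g_j$), the unital $*$-algebra spanned by linearly independent symbols $W(g)$ with $W(g)^*=W(-g)$, $W(g)W(g')=e^{2\pi i\sigma(g,g')}W(g+g')$. $\mathcal W(\zeta_{\rm free})$ is the $C^*$-isomorphism $W(x)\mapsto W(\zeta_{\rm free}(x))$. State and GNS: $\omega_{\rm free}(W(u,\tilde u,z,\tilde z))=1$ if $z=0=\tilde z$, and $0$ otherwise. Its GNS Hilbert space $\mathscr H^k_{\rm free}$ is the completion of $\mathscr D^k_{\rm free}=\mathrm{span}_{\mathbb C}\{|z,\tilde z\rangle:(z,\tilde z)\in H^{k,m-k}_{\rm free}(M;\mathbb Z)\}$, where $|z,\tilde z\rangle$ is the class of $W(0,0,z,\tilde z)$ (these vectors are orthonormal), and $\pi^k_{\rm free}(W(u,\tilde u,z,\tilde z))|z',\tilde z'\rangle=e^{2\pi i\sigma_{\rm free}((u,\tilde u,0,0),(0,0,z+2z',\tilde z+2\tilde z'))}|z+z',\tilde z+\tilde z'\rangle$. Operators: phase operators $\Phi^k(u,\tilde u)=\pi^k_{\rm free}(W(u,\tilde u,0,0))$; shift operators $\Sigma^k(z,\tilde z)=\pi^k_{\rm free}(W(0,0,z,\tilde z))$; for $(r,\tilde r)\in H^{k-1,m-k-1}(M;\mathbb R)$ the flux operator $P^k(r,\tilde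 r):\mathscr D^k_{\rm free}\to\mathscr H^k_{\rm free}$, $|z,\tilde z\rangle\mapsto2\big((i_\Sigma^*\tilde r\smile i_\Sigma^*z)[\Sigma]-(-1)^{k(m-k)}(i_\Sigma^*r\smile i_\Sigma^*\tilde z)[\Sigma]\big)|z,\tilde z\rangle$. "Intertwines" means $U^k_{\rm free}\Phi^k(u,\tilde u)=\Phi^{m-k}(\tilde u,\varepsilon u)U^k_{\rm free}$, $U^k_{\rm free}\Sigma^k(z,\tilde z)=\Sigma^{m-k}(\tilde z,\varepsilon z)U^k_{\rm free}$, $U^k_{\rm free}P^k(r,\tilde r)=P^{m-k}(\tilde r,\varepsilon r)U^k_{\rm free}$ (the last on $\mathscr D^k_{\rm free}$). *)

theory Defs
  imports "HOL-Analysis.Analysis" "HOL-Homology.Homology" "HOL-Algebra.Module"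
begin

section \<open>The circle group\<close>

quotient_type circle = real / "\<lambda>x y :: real. x - y \<in> \<int>"
  morphisms circle_rep to_circle
proof (intro equivpI reflpI sympI transpI)
  fix x y z :: real
  show "x - x \<in> \<int>" by simp
  show "y - x \<in> \<int>" if "x - y \<in> \<int>"
    using Ints_minus[OF that] by simp
  show "x - z \<in> \<int>" if "x - y \<in> \<int>" "y - z \<in> \<int>"
    using Ints_add[OF that] by simp
qed

instantiation circle :: ab_group_add
begin

lift_definition zero_circle :: circle is 0 .

lift_definition plus_circle :: "circle \<Rightarrow> circle \<Rightarrow> circle" is "(+)"
proof -
  fix a b c d :: real
  assume "a - b \<in> \<int>" "c - d \<in> \<int>"
  from Ints_add[OF this] show "a + c - (b + d) \<in> \<int>" by (simp add: algebra_simps)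
qed

lift_definition minus_circle :: "circle \<Rightarrow> circle \<Rightarrow> circle" is "(-)"
proof -
  fix a b c d :: real
  assume "a - b \<in> \<int>" "c - d \<in> \<int>"
  from Ints_diff[OF this] show "a - c - (b - d) \<in> \<int>" by (simp add: algebra_simps)
qed

lift_definition uminus_circle :: "circle \<Rightarrow> circle" is uminus
proof -
  fix a b :: real
  assume "a - b \<in> \<int>"
  from Ints_minus[OF this] show "- a - - b \<in> \<int>" by (simp add: algebra_simps)
qed

instance
  by standard (transfer; simp add: algebra_simps)+

end

text \<open>The character $t \mapsto e^{2\pi i t}$ of $\mathbb R/\mathbb Z$.\<close>

lift_definition circle_exp :: "circle \<Rightarrow> complex" is "\<lambda>x. cis (2 * pi * x)"
proof -
  fix x y :: real
  assume "x - y \<in> \<int>"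
  then obtain n where "x = y + of_int n"
    by (metis Ints_cases add.commute diff_add_cancel)
  then have "cis (2 * pi * x) = cis (2 * pi * y) * cis (2 * pi * of_int n)"
    by (simp only: cis_mult distrib_left)
  moreover have "cis (2 * pi * of_int n) = 1"
    by (rule cis_multiple_2pi) simp
  ultimately show "cis (2 * pi * x) = cis (2 * pi * y)"
    by (simp only: mult_1_right)
qed

definition zact :: "int \<Rightarrow> 'c::ab_group_add \<Rightarrow> 'c" where
  "zact n a = (\<Sum>i<nat n. a) - (\<Sum>i<nat (- n). a)"


section \<open>Spacetimes\<close>

subsection \<open>Smooth maps\<close>

primrec C_diff :: "nat \<Rightarrow> 'b::real_normed_vector set \<Rightarrow> ('b \<Rightarrow> 'c::real_normed_vector) \<Rightarrow> bool" where
  "C_diff 0 S f = continuous_on S f"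
| "C_diff (Suc r) S f =
    ((\<forall>x\<in>S. f differentiable (at x)) \<and> (\<forall>v. C_diff r S (\<lambda>x. frechet_derivative f (at x) v)))"

text \<open>Only meant for open \<open>S\<close>.\<close>

definition smooth_on :: "'b::real_normed_vector set \<Rightarrow> ('b \<Rightarrow> 'c::real_normed_vector) \<Rightarrow> bool" where
  "smooth_on S f \<longleftrightarrow> (\<forall>r. C_diff r S f)"

subsection \<open>Oriented and time-oriented Lorentzian manifolds\<close>

type_synonym ('a, 'n) chart = "'a set \<times> ('a \<Rightarrow> real ^ 'n)"

text \<open>The dimension is \<open>CARD('n)\<close>. The orientation is the one for which all charts of the given
  atlas are positive. Tensors are given by their components: \<open>met M c p\<close> is the Gram matrix of the
  metric at \<open>p\<close> in the coordinates of \<open>c\<close>, and \<open>future M c p\<close> the component vector of a timelike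
  vector field defining the time-orientation.\<close>

record ('a, 'n) spacetime =
  points :: "'a topology"
  atlas :: "('a, 'n) chart set"
  met :: "('a, 'n) chart \<Rightarrow> 'a \<Rightarrow> real ^ 'n ^ 'n"
  future :: "('a, 'n) chart \<Rightarrow> 'a \<Rightarrow> real ^ 'n"

definition chart_on :: "'a topology \<Rightarrow> ('a, 'n::finite) chart \<Rightarrow> bool" where
  "chart_on X c \<longleftrightarrow>
     openin X (fst c) \<and> open (snd c ` fst c) \<and>
     homeomorphic_map (subtopology X (fst c)) (top_of_set (snd c ` fst c)) (snd c)"

definition transition :: "('a, 'n::finite) chart \<Rightarrow> ('a, 'n) chart \<Rightarrow> real ^ 'n \<Rightarrow> real ^ 'n" where
  "transition c d x = snd d (inv_into (fst c) (snd c) x)"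

definition jacobian :: "('a, 'n::finite) chart \<Rightarrow> ('a, 'n) chart \<Rightarrow> 'a \<Rightarrow> real ^ 'n ^ 'n" where
  "jacobian c d p = matrix (frechet_derivative (transition c d) (at (snd c p)))"

text \<open>Signature $(-,+,\dots,+)$.\<close>

definition lorentzian :: "real ^ 'n ^ 'n::finite \<Rightarrow> bool" where
  "lorentzian G \<longleftrightarrow> (\<exists>(A :: real ^ 'n ^ 'n) i. invertible A \<and>
     transpose A ** G ** A = (\<chi> a b. if a \<noteq> b then 0 else if a = i then -1 else 1))"

definition lorentzian_manifold :: "('a, 'n::finite) spacetime \<Rightarrow> bool" where
  "lorentzian_manifold M \<longleftrightarrow>
     Hausdorff_space (points M) \<and> second_countable (points M) \<and>
     (\<forall>c\<in>atlas M. chart_on (points M) c) \<and>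
     (\<Union>c\<in>atlas M. fst c) = topspace (points M) \<and>
     (\<forall>c\<in>atlas M. \<forall>d\<in>atlas M. smooth_on (snd c ` (fst c \<inter> fst d)) (transition c d)) \<and>
     (\<forall>c\<in>atlas M. smooth_on (snd c ` fst c) (\<lambda>x. met M c (inv_into (fst c) (snd c) x))) \<and>
     (\<forall>c\<in>atlas M. \<forall>p\<in>fst c. lorentzian (met M c p)) \<and>
     (\<forall>c\<in>atlas M. \<forall>d\<in>atlas M. \<forall>p\<in>fst c \<inter> fst d.
        met M c p = transpose (jacobian c d p) ** met M d p ** jacobian c d p)"

definition oriented_atlas :: "('a, 'n::finite) spacetime \<Rightarrow> bool" where
  "oriented_atlas M \<longleftrightarrow>
     (\<forall>c\<in>atlas M. \<forall>d\<in>atlas M. \<forall>p\<in>fst c \<inter> fst d. 0 < det (jacobian c d p))"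

definition time_oriented :: "('a, 'n::finite) spacetime \<Rightarrow> bool" where
  "time_oriented M \<longleftrightarrow>
     (\<forall>c\<in>atlas M. smooth_on (snd c ` fst c) (\<lambda>x. future M c (inv_into (fst c) (snd c) x))) \<and>
     (\<forall>c\<in>atlas M. \<forall>p\<in>fst c. future M c p \<bullet> (met M c p *v future M c p) < 0) \<and>
     (\<forall>c\<in>atlas M. \<forall>d\<in>atlas M. \<forall>p\<in>fst c \<inter> fst d. future M d p = jacobian c d p *v future M c p)"

definition diffeomorphic_to_Rm :: "('a, 'n::finite) spacetime \<Rightarrow> 'a set \<Rightarrow> bool" where
  "diffeomorphic_to_Rm M W \<longleftrightarrow> (\<exists>f.
     chart_on (points M) (W, f) \<and> f ` W = UNIV \<and>
     (\<forall>c\<in>atlas M. smooth_on (snd c ` (fst c \<inter> W)) (transition c (W, f)) \<and>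
                   smooth_on (f ` (W \<inter> fst c)) (transition (W, f) c)))"

text \<open>Existence of a finite good cover.\<close>

definition finite_type :: "('a, 'n::finite) spacetime \<Rightarrow> bool" where
  "finite_type M \<longleftrightarrow> (\<exists>\<U>.
     finite \<U> \<and> (\<forall>W\<in>\<U>. openin (points M) W) \<and> \<Union>\<U> = topspace (points M) \<and>
     (\<forall>\<V>\<subseteq>\<U>. \<V> \<noteq> {} \<longrightarrow> \<Inter>\<V> \<noteq> {} \<longrightarrow> diffeomorphic_to_Rm M (\<Inter>\<V>)))"

definition is_spacetime :: "('a, 'n::finite) spacetime \<Rightarrow> bool" where
  "is_spacetime M \<longleftrightarrow>
     lorentzian_manifold M \<and> oriented_atlas M \<and> time_oriented M \<and>
     connected_space (points M) \<and> topspace (points M) \<noteq> {} \<and> finite_type M"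

subsection \<open>Cauchy surfaces\<close>

text \<open>A timelike curve on an open interval can be reparametrised smoothly by the whole real line.\<close>

definition timelike_curve :: "('a, 'n::finite) spacetime \<Rightarrow> (real \<Rightarrow> 'a) \<Rightarrow> bool" where
  "timelike_curve M \<gamma> \<longleftrightarrow>
     continuous_map euclideanreal (points M) \<gamma> \<and>
     (\<forall>c\<in>atlas M. smooth_on {t. \<gamma> t \<in> fst c} (snd c \<circ> \<gamma>)) \<and>
     (\<forall>c\<in>atlas M. \<forall>t. \<gamma> t \<in> fst c \<longrightarrow>
        (let v = vector_derivative (snd c \<circ> \<gamma>) (at t) in v \<bullet> (met M c (\<gamma> t) *v v) < 0))"

definition inextendible :: "('a, 'n::finite) spacetime \<Rightarrow> (real \<Rightarrow> 'a) \<Rightarrow> bool" where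
  "inextendible M \<gamma> \<longleftrightarrow>
     \<not> (\<exists>p. limitin (points M) \<gamma> p at_top) \<and> \<not> (\<exists>p. limitin (points M) \<gamma> p at_bot)"

definition cauchy_surface :: "('a, 'n::finite) spacetime \<Rightarrow> 'a set \<Rightarrow> bool" where
  "cauchy_surface M S \<longleftrightarrow> S \<subseteq> topspace (points M) \<and>
     (\<forall>\<gamma>. timelike_curve M \<gamma> \<and> inextendible M \<gamma> \<longrightarrow> (\<exists>!t. \<gamma> t \<in> S))"

definition globally_hyperbolic :: "('a, 'n::finite) spacetime \<Rightarrow> bool" where
  "globally_hyperbolic M \<longleftrightarrow> (\<exists>S. cauchy_surface M S)"

text \<open>A smooth embedded hypersurface, i.e. locally a regular level set, whose tangent spaces
  (the kernels of the differentials of the defining functions) are spacelike.\<close>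

definition spacelike_hypersurface :: "('a, 'n::finite) spacetime \<Rightarrow> 'a set \<Rightarrow> bool" where
  "spacelike_hypersurface M S \<longleftrightarrow> S \<subseteq> topspace (points M) \<and>
     (\<forall>p\<in>S. \<exists>c\<in>atlas M. \<exists>V (h :: real ^ 'n \<Rightarrow> real).
        p \<in> V \<and> V \<subseteq> fst c \<and> openin (points M) V \<and> smooth_on (snd c ` V) h \<and>
        S \<inter> V = {x \<in> V. h (snd c x) = 0} \<and>
        (\<forall>x\<in>S \<inter> V. let dh = frechet_derivative h (at (snd c x)) in
           dh \<noteq> (\<lambda>v. 0) \<and> (\<forall>v. v \<noteq> 0 \<and> dh v = 0 \<longrightarrow> 0 < v \<bullet> (met M c x *v v))))"

definition compact_spacelike_cauchy_surface :: "('a, 'n::finite) spacetime \<Rightarrow> 'a set \<Rightarrow> bool" where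
  "compact_spacelike_cauchy_surface M S \<longleftrightarrow>
     cauchy_surface M S \<and> spacelike_hypersurface M S \<and> compactin (points M) S"

subsection \<open>The fundamental class of an oriented hypersurface\<close>

text \<open>\<open>positive_simplex M S x f\<close>: \<open>f\<close> is an injective singular simplex of top dimension $m-1$ in \<open>S\<close>,
  with \<open>x\<close> the image of an interior point \<open>b\<close> at which \<open>f\<close> is differentiable; \<open>d i\<close> is the derivative
  of \<open>f\<close> at \<open>b\<close> along the edge from vertex $0$ to vertex \<open>i\<close>, in the coordinates of a positive
  chart, and the frame $(T, d_1, \dots, d_{m-1})$ is positive, where $T$ is the future-pointing vector
  field. Thus a frame of the hypersurface is positive iff it becomes a positive frame of \<open>M\<close> on
  putting the future-pointing normal vector in front. The linear order of the index type fixes the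
  order of the coordinates.\<close>

definition positive_simplex ::
  "('a, 'n::{finite,linorder}) spacetime \<Rightarrow> 'a set \<Rightarrow> 'a \<Rightarrow> ((nat \<Rightarrow> real) \<Rightarrow> 'a) \<Rightarrow> bool" where
  "positive_simplex M S x f \<longleftrightarrow>
     (let n = CARD('n) - 1 in
      singular_simplex n (subtopology (points M) S) f \<and> inj_on f (standard_simplex n) \<and>
      (\<exists>b\<in>standard_simplex n. (\<forall>i\<le>n. 0 < b i) \<and> f b = x \<and>
        (\<exists>c\<in>atlas M. x \<in> fst c \<and> (\<exists>d :: nat \<Rightarrow> (real, 'n) vec.
          (\<forall>e>0. \<exists>\<delta>>0. \<forall>y\<in>standard_simplex n. (\<Sum>i\<le>n. \<bar>y i - b i\<bar>) < \<delta> \<longrightarrow>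
             norm (snd c (f y) - snd c x - (\<Sum>i=1..n. (y i - b i) *\<^sub>R d i))
               \<le> e * (\<Sum>i\<le>n. \<bar>y i - b i\<bar>)) \<and>
          0 < det (\<chi> a j. let r = card {i. i < j} in
                     (if r = 0 then future M c x else d r) $ a)))))"

text \<open>The fundamental class is the unique class restricting to the local orientation at each point.\<close>

definition fundamental_class ::
  "('a, 'n::{finite,linorder}) spacetime \<Rightarrow> 'a set \<Rightarrow> 'a chain set \<Rightarrow> bool" where
  "fundamental_class M S \<sigma> \<longleftrightarrow>
     (let n = CARD('n) - 1; Y = subtopology (points M) S in
      \<sigma> \<in> carrier (homology_group (int n) Y) \<and>
      (\<forall>x\<in>S. \<forall>f. positive_simplex M S x f \<longrightarrow>
         hom_induced (int n) Y {} Y (S - {x}) id \<sigma> = homologous_rel_set n Y (S - {x}) (frag_of f)))"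


section \<open>Singular cohomology\<close>

text \<open>Values of a map on a class, for maps that are constant on the class.\<close>

definition descend :: "('a \<Rightarrow> 'b) \<Rightarrow> 'a set \<Rightarrow> 'b" where
  "descend f C = the_elem (f ` C)"

definition descend2 :: "('a \<Rightarrow> 'b \<Rightarrow> 'c) \<Rightarrow> 'a set \<Rightarrow> 'b set \<Rightarrow> 'c" where
  "descend2 f C D = the_elem ((\<lambda>(x, y). f x y) ` (C \<times> D))"

text \<open>Degrees are integers; there are no simplices of negative degree. Cochains vanish off the
  singular simplices of their degree.\<close>

type_synonym ('a, 'c) cochain = "((nat \<Rightarrow> real) \<Rightarrow> 'a) \<Rightarrow> 'c"

definition sing :: "int \<Rightarrow> 'a topology \<Rightarrow> ((nat \<Rightarrow> real) \<Rightarrow> 'a) set" where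
  "sing p X = {f. 0 \<le> p \<and> singular_simplex (nat p) X f}"

definition cochains :: "int \<Rightarrow> 'a topology \<Rightarrow> ('a, 'c::ab_group_add) cochain set" where
  "cochains p X = {\<phi>. \<forall>f. f \<notin> sing p X \<longrightarrow> \<phi> f = 0}"

text \<open>From degree \<open>p\<close> to degree \<open>p + 1\<close>.\<close>

definition coboundary :: "int \<Rightarrow> 'a topology \<Rightarrow> ('a, 'c::ab_group_add) cochain \<Rightarrow> ('a, 'c) cochain" where
  "coboundary p X \<phi> = (\<lambda>f. if f \<in> sing (p + 1) X
     then \<Sum>i\<le>nat (p + 1). zact ((-1) ^ i) (\<phi> (singular_face (nat (p + 1)) i f)) else 0)"

definition cocycles :: "int \<Rightarrow> 'a topology \<Rightarrow> ('a, 'c::ab_group_add) cochain set" where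
  "cocycles p X = {\<phi> \<in> cochains p X. coboundary p X \<phi> = (\<lambda>f. 0)}"

definition coboundaries :: "int \<Rightarrow> 'a topology \<Rightarrow> ('a, 'c::ab_group_add) cochain set" where
  "coboundaries p X = coboundary (p - 1) X ` cochains (p - 1) X"

definition cocycle_group :: "int \<Rightarrow> 'a topology \<Rightarrow> ('a, 'c::ab_group_add) cochain monoid" where
  "cocycle_group p X = \<lparr>carrier = cocycles p X, monoid.mult = (\<lambda>\<phi> \<psi> f. \<phi> f + \<psi> f), one = (\<lambda>f. 0)\<rparr>"

definition cohomology_group :: "int \<Rightarrow> 'a topology \<Rightarrow> ('a, 'c::ab_group_add) cochain set monoid" where
  "cohomology_group p X = cocycle_group p X Mod coboundaries p X"

definition coh_class :: "int \<Rightarrow> 'a topology \<Rightarrow> ('a, 'c::ab_group_add) cochain \<Rightarrow> ('a, 'c) cochain set" where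
  "coh_class p X \<phi> = coboundaries p X #>\<^bsub>cocycle_group p X\<^esub> \<phi>"

definition coh_pullback ::
  "int \<Rightarrow> 'b topology \<Rightarrow> ('b \<Rightarrow> 'a) \<Rightarrow> ('a, 'c::ab_group_add) cochain set \<Rightarrow> ('b, 'c) cochain set" where
  "coh_pullback p Y h =
     descend (\<lambda>\<phi>. coh_class p Y (\<lambda>f. if f \<in> sing p Y then \<phi> (simplex_map (nat p) h f) else 0))"

definition coh_coeff ::
  "int \<Rightarrow> 'a topology \<Rightarrow> ('c \<Rightarrow> 'd) \<Rightarrow> ('a, 'c::ab_group_add) cochain set
     \<Rightarrow> ('a, 'd::ab_group_add) cochain set" where
  "coh_coeff p X h = descend (\<lambda>\<phi>. coh_class p X (h \<circ> \<phi>))"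

definition front_face :: "nat \<Rightarrow> ((nat \<Rightarrow> real) \<Rightarrow> 'a) \<Rightarrow> (nat \<Rightarrow> real) \<Rightarrow> 'a" where
  "front_face p f = restrict f (standard_simplex p)"

text \<open>The face of a $(p+q)$-simplex spanned by its last \<open>q + 1\<close> vertices.\<close>

definition back_face :: "nat \<Rightarrow> nat \<Rightarrow> ((nat \<Rightarrow> real) \<Rightarrow> 'a) \<Rightarrow> (nat \<Rightarrow> real) \<Rightarrow> 'a" where
  "back_face p q f = restrict (\<lambda>x. f (\<lambda>i. if i < p then 0 else x (i - p))) (standard_simplex q)"

text \<open>Cup product with respect to a pairing \<open>\<beta>\<close> of coefficients.\<close>

definition coh_cup ::
  "('c \<Rightarrow> 'd \<Rightarrow> 'e) \<Rightarrow> int \<Rightarrow> int \<Rightarrow> 'a topology \<Rightarrow> ('a, 'c::ab_group_add) cochain set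
     \<Rightarrow> ('a, 'd::ab_group_add) cochain set \<Rightarrow> ('a, 'e::ab_group_add) cochain set" where
  "coh_cup \<beta> p q X = descend2 (\<lambda>\<phi> \<psi>. coh_class (p + q) X (\<lambda>f. if f \<in> sing (p + q) X
     then \<beta> (\<phi> (front_face (nat p) f)) (\<psi> (back_face (nat p) (nat q) f)) else 0))"

definition coh_eval :: "('a, 'c::ab_group_add) cochain set \<Rightarrow> 'a chain set \<Rightarrow> 'c" where
  "coh_eval = descend2 (\<lambda>\<phi> z. \<Sum>f\<in>Poly_Mapping.keys z. zact (Poly_Mapping.lookup z f) (\<phi> f))"

subsection \<open>Free cohomology and the lattice in real cohomology\<close>

definition torsion_part :: "('g, 'm) monoid_scheme \<Rightarrow> 'g set" where
  "torsion_part G = {x \<in> carrier G. \<exists>n::nat. 0 < n \<and> x [^]\<^bsub>G\<^esub> n = \<one>\<^bsub>G\<^esub>}"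

type_synonym 'a int_class = "('a, int) cochain set"
type_synonym 'a real_class = "('a, real) cochain set"
type_synonym 'a free_class = "'a int_class set"
type_synonym 'a rquot_class = "'a real_class set"

definition coh_Z :: "int \<Rightarrow> 'a topology \<Rightarrow> 'a int_class monoid" where
  "coh_Z p X = cohomology_group p X"

definition coh_R :: "int \<Rightarrow> 'a topology \<Rightarrow> 'a real_class monoid" where
  "coh_R p X = cohomology_group p X"

definition coh_free :: "int \<Rightarrow> 'a topology \<Rightarrow> 'a free_class monoid" where
  "coh_free p X = coh_Z p X Mod torsion_part (coh_Z p X)"

definition free_to_real :: "int \<Rightarrow> 'a topology \<Rightarrow> 'a free_class \<Rightarrow> 'a real_class" where
  "free_to_real p X = descend (coh_coeff p X of_int)"

definition lattice :: "int \<Rightarrow> 'a topology \<Rightarrow> 'a real_class set" where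
  "lattice p X = free_to_real p X ` carrier (coh_free p X)"

definition coh_Rquot :: "int \<Rightarrow> 'a topology \<Rightarrow> 'a rquot_class monoid" where
  "coh_Rquot p X = coh_R p X Mod lattice p X"

text \<open>The map $\mu$ into cohomology with coefficients in $\mathbb R/\mathbb Z$.\<close>

definition mu :: "int \<Rightarrow> 'a topology \<Rightarrow> 'a rquot_class \<Rightarrow> ('a, circle) cochain set" where
  "mu p X = descend (coh_coeff p X to_circle)"

definition rquot_pullback :: "int \<Rightarrow> 'b topology \<Rightarrow> ('b \<Rightarrow> 'a) \<Rightarrow> 'a rquot_class \<Rightarrow> 'b rquot_class" where
  "rquot_pullback p Y h = descend (\<lambda>\<rho>. lattice p Y #>\<^bsub>coh_R p Y\<^esub> coh_pullback p Y h \<rho>)"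


section \<open>The topological sector\<close>

text \<open>The embedding of \<open>S\<close> is the identity map from the subspace \<open>S\<close>. The parameter \<open>\<sigma>\<close> is the
  fundamental class of \<open>S\<close>, and \<open>p\<close>, \<open>q\<close> are the degrees of \<open>v\<close>, \<open>w\<close>.\<close>

definition pairing ::
  "'a topology \<Rightarrow> 'a set \<Rightarrow> 'a chain set \<Rightarrow> int \<Rightarrow> int \<Rightarrow> 'a rquot_class \<Rightarrow> 'a free_class \<Rightarrow> circle" where
  "pairing X S \<sigma> p q v w = (let Y = subtopology X S in
     descend (\<lambda>y. coh_eval (coh_cup (\<lambda>t n. zact n t) p q Y
       (mu p Y (rquot_pullback p Y id v)) (coh_pullback q Y id y)) \<sigma>) w)"

definition real_pairing ::
  "'a topology \<Rightarrow> 'a set \<Rightarrow> 'a chain set \<Rightarrow> int \<Rightarrow> int \<Rightarrow> 'a real_class \<Rightarrow> 'a free_class \<Rightarrow> real" where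
  "real_pairing X S \<sigma> p q r w = (let Y = subtopology X S in
     coh_eval (coh_cup (*) p q Y (coh_pullback p Y id r) (coh_pullback q Y id (free_to_real q X w))) \<sigma>)"

type_synonym 'a top_elem = "'a rquot_class \<times> 'a rquot_class \<times> 'a free_class \<times> 'a free_class"

definition rquot_pair :: "('a, 'n::finite) spacetime \<Rightarrow> nat \<Rightarrow> ('a rquot_class \<times> 'a rquot_class) monoid" where
  "rquot_pair M k = coh_Rquot (int k - 1) (points M) \<times>\<times> coh_Rquot (int CARD('n) - int k - 1) (points M)"

definition real_pair :: "('a, 'n::finite) spacetime \<Rightarrow> nat \<Rightarrow> ('a real_class \<times> 'a real_class) monoid" where
  "real_pair M k = coh_R (int k - 1) (points M) \<times>\<times> coh_R (int CARD('n) - int k - 1) (points M)"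

definition free_pair :: "('a, 'n::finite) spacetime \<Rightarrow> nat \<Rightarrow> ('a free_class \<times> 'a free_class) monoid" where
  "free_pair M k = coh_free (int k) (points M) \<times>\<times> coh_free (int CARD('n) - int k) (points M)"

definition top_free :: "('a, 'n::finite) spacetime \<Rightarrow> nat \<Rightarrow> 'a top_elem monoid" where
  "top_free M k =
     coh_Rquot (int k - 1) (points M) \<times>\<times> coh_Rquot (int CARD('n) - int k - 1) (points M) \<times>\<times> free_pair M k"

definition sigma_free ::
  "('a, 'n::finite) spacetime \<Rightarrow> 'a set \<Rightarrow> 'a chain set \<Rightarrow> nat \<Rightarrow> 'a top_elem \<Rightarrow> 'a top_elem \<Rightarrow> circle" where
  "sigma_free M S \<sigma> k = (\<lambda>(u, u\<^sub>1, z, z\<^sub>1) (u', u\<^sub>1', z', z\<^sub>1').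
     let m = CARD('n); s = (-1) ^ (k * (m - k));
         A = pairing (points M) S \<sigma> (int m - int k - 1) (int k);
         B = pairing (points M) S \<sigma> (int k - 1) (int m - int k)
     in A u\<^sub>1 z' - zact s (B u z\<^sub>1') - A u\<^sub>1' z + zact s (B u' z\<^sub>1))"

definition duality_sign :: "('a, 'n::finite) spacetime \<Rightarrow> nat \<Rightarrow> int" where
  "duality_sign M k = (-1) ^ (k * (CARD('n) - k) + 1)"

definition zeta_free :: "('a, 'n::finite) spacetime \<Rightarrow> nat \<Rightarrow> 'a top_elem \<Rightarrow> 'a top_elem" where
  "zeta_free M k = (\<lambda>(u, u\<^sub>1, z, z\<^sub>1).
     (u\<^sub>1, u [^]\<^bsub>coh_Rquot (int k - 1) (points M)\<^esub> duality_sign M k,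
      z\<^sub>1, z [^]\<^bsub>coh_free (int k) (points M)\<^esub> duality_sign M k))"


section \<open>Completions, enveloping C*-algebras and the GNS construction\<close>

subsection \<open>Completion by Cauchy sequences\<close>

text \<open>With respect to a pseudometric \<open>d\<close>; points at distance 0 are identified.\<close>

definition cauchy_seqs :: "'a set \<Rightarrow> ('a \<Rightarrow> 'a \<Rightarrow> real) \<Rightarrow> (nat \<Rightarrow> 'a) set" where
  "cauchy_seqs A d =
     {s. (\<forall>n. s n \<in> A) \<and> (\<forall>e>0. \<exists>N. \<forall>i\<ge>N. \<forall>j\<ge>N. d (s i) (s j) < e)}"

definition cauchy_class :: "'a set \<Rightarrow> ('a \<Rightarrow> 'a \<Rightarrow> real) \<Rightarrow> (nat \<Rightarrow> 'a) \<Rightarrow> (nat \<Rightarrow> 'a) set" where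
  "cauchy_class A d s = {t \<in> cauchy_seqs A d. (\<lambda>n. d (s n) (t n)) \<longlonglongrightarrow> 0}"

definition completion_set :: "'a set \<Rightarrow> ('a \<Rightarrow> 'a \<Rightarrow> real) \<Rightarrow> (nat \<Rightarrow> 'a) set set" where
  "completion_set A d = cauchy_class A d ` cauchy_seqs A d"

text \<open>Continuous extension of a scalar function to the completion.\<close>

definition extend_fun :: "('a \<Rightarrow> complex) \<Rightarrow> (nat \<Rightarrow> 'a) set \<Rightarrow> complex" where
  "extend_fun F = descend (\<lambda>s. lim (\<lambda>n. F (s n)))"

subsection \<open>Normed *-algebras\<close>

record 'a star_algebra = "(complex, 'a) module" +
  adj :: "'a \<Rightarrow> 'a"
  nrm :: "'a \<Rightarrow> real"

definition alg_dist :: "('a, 'm) star_algebra_scheme \<Rightarrow> 'a \<Rightarrow> 'a \<Rightarrow> real" where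
  "alg_dist A x y = nrm A (x \<ominus>\<^bsub>A\<^esub> y)"

definition alg_class :: "('a, 'm) star_algebra_scheme \<Rightarrow> (nat \<Rightarrow> 'a) \<Rightarrow> (nat \<Rightarrow> 'a) set" where
  "alg_class A = cauchy_class (carrier A) (alg_dist A)"

definition alg_completion :: "'a star_algebra \<Rightarrow> (nat \<Rightarrow> 'a) set star_algebra" where
  "alg_completion A = \<lparr>
     carrier = completion_set (carrier A) (alg_dist A),
     monoid.mult = descend2 (\<lambda>s t. alg_class A (\<lambda>n. s n \<otimes>\<^bsub>A\<^esub> t n)),
     one = alg_class A (\<lambda>n. \<one>\<^bsub>A\<^esub>),
     zero = alg_class A (\<lambda>n. \<zero>\<^bsub>A\<^esub>),
     add = descend2 (\<lambda>s t. alg_class A (\<lambda>n. s n \<oplus>\<^bsub>A\<^esub> t n)),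
     smult = (\<lambda>\<alpha>. descend (\<lambda>s. alg_class A (\<lambda>n. \<alpha> \<odot>\<^bsub>A\<^esub> s n))),
     adj = descend (\<lambda>s. alg_class A (\<lambda>n. adj A (s n))),
     nrm = descend (\<lambda>s. lim (\<lambda>n. nrm A (s n)))\<rparr>"

definition alg_embed :: "'a star_algebra \<Rightarrow> 'a \<Rightarrow> (nat \<Rightarrow> 'a) set" where
  "alg_embed A x = alg_class A (\<lambda>n. x)"

text \<open>Continuous extension to the completions of a map into \<open>B\<close>.\<close>

definition extend_map :: "'b star_algebra \<Rightarrow> ('a \<Rightarrow> 'b) \<Rightarrow> (nat \<Rightarrow> 'a) set \<Rightarrow> (nat \<Rightarrow> 'b) set" where
  "extend_map B F = descend (\<lambda>s. alg_class B (\<lambda>n. F (s n)))"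

text \<open>The C*-seminorms on a Banach *-algebra are the functions $x \mapsto \|\rho(x)\|$ for *-homomorphisms
  $\rho$ into C*-algebras, equivalently for *-representations $\rho$ on Hilbert spaces. The last
  condition (contractivity) is then automatic. The enveloping C*-algebra is the completion in the
  largest one (with its null ideal divided out).\<close>

definition cstar_seminorm :: "'a star_algebra \<Rightarrow> ('a \<Rightarrow> real) \<Rightarrow> bool" where
  "cstar_seminorm A p \<longleftrightarrow>
     (\<forall>x\<in>carrier A. 0 \<le> p x) \<and>
     (\<forall>x\<in>carrier A. \<forall>y\<in>carrier A. p (x \<oplus>\<^bsub>A\<^esub> y) \<le> p x + p y) \<and>
     (\<forall>\<alpha>. \<forall>x\<in>carrier A. p (\<alpha> \<odot>\<^bsub>A\<^esub> x) = norm \<alpha> * p x) \<and>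
     (\<forall>x\<in>carrier A. \<forall>y\<in>carrier A. p (x \<otimes>\<^bsub>A\<^esub> y) \<le> p x * p y) \<and>
     (\<forall>x\<in>carrier A. p (adj A x \<otimes>\<^bsub>A\<^esub> x) = (p x)\<^sup>2) \<and>
     (\<forall>x\<in>carrier A. p x \<le> nrm A x)"

definition cstar_normed :: "'a star_algebra \<Rightarrow> 'a star_algebra" where
  "cstar_normed A = A\<lparr>nrm := (\<lambda>x. SUP p\<in>{p. cstar_seminorm A p}. p x)\<rparr>"

definition enveloping_cstar :: "'a star_algebra \<Rightarrow> (nat \<Rightarrow> 'a) set star_algebra" where
  "enveloping_cstar A = alg_completion (cstar_normed A)"

subsection \<open>Hilbert spaces and the GNS construction\<close>

text \<open>The ring multiplication inherited from \<open>module\<close> is not used.\<close>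

record 'v inner_space = "(complex, 'v) module" +
  ip :: "'v \<Rightarrow> 'v \<Rightarrow> complex"

definition gns_dist :: "'a star_algebra \<Rightarrow> ('a \<Rightarrow> complex) \<Rightarrow> 'a \<Rightarrow> 'a \<Rightarrow> real" where
  "gns_dist A \<omega> x y = sqrt (Re (\<omega> (adj A (x \<ominus>\<^bsub>A\<^esub> y) \<otimes>\<^bsub>A\<^esub> (x \<ominus>\<^bsub>A\<^esub> y))))"

definition gns_class :: "'a star_algebra \<Rightarrow> ('a \<Rightarrow> complex) \<Rightarrow> (nat \<Rightarrow> 'a) \<Rightarrow> (nat \<Rightarrow> 'a) set" where
  "gns_class A \<omega> = cauchy_class (carrier A) (gns_dist A \<omega>)"

definition gns_space :: "'a star_algebra \<Rightarrow> ('a \<Rightarrow> complex) \<Rightarrow> (nat \<Rightarrow> 'a) set inner_space" where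
  "gns_space A \<omega> = \<lparr>
     carrier = completion_set (carrier A) (gns_dist A \<omega>),
     monoid.mult = undefined,
     one = undefined,
     zero = gns_class A \<omega> (\<lambda>n. \<zero>\<^bsub>A\<^esub>),
     add = descend2 (\<lambda>s t. gns_class A \<omega> (\<lambda>n. s n \<oplus>\<^bsub>A\<^esub> t n)),
     smult = (\<lambda>\<alpha>. descend (\<lambda>s. gns_class A \<omega> (\<lambda>n. \<alpha> \<odot>\<^bsub>A\<^esub> s n))),
     ip = descend2 (\<lambda>s t. lim (\<lambda>n. \<omega> (adj A (s n) \<otimes>\<^bsub>A\<^esub> t n)))\<rparr>"

definition gns_vector :: "'a star_algebra \<Rightarrow> ('a \<Rightarrow> complex) \<Rightarrow> 'a \<Rightarrow> (nat \<Rightarrow> 'a) set" where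
  "gns_vector A \<omega> x = gns_class A \<omega> (\<lambda>n. x)"

definition gns_rep :: "'a star_algebra \<Rightarrow> ('a \<Rightarrow> complex) \<Rightarrow> 'a \<Rightarrow> (nat \<Rightarrow> 'a) set \<Rightarrow> (nat \<Rightarrow> 'a) set" where
  "gns_rep A \<omega> a = descend (\<lambda>s. gns_class A \<omega> (\<lambda>n. a \<otimes>\<^bsub>A\<^esub> s n))"

definition hnorm :: "'v inner_space \<Rightarrow> 'v \<Rightarrow> real" where
  "hnorm H x = sqrt (Re (ip H x x))"

definition bounded_operator :: "'v inner_space \<Rightarrow> 'w inner_space \<Rightarrow> ('v \<Rightarrow> 'w) \<Rightarrow> bool" where
  "bounded_operator H K T \<longleftrightarrow>
     T \<in> carrier H \<rightarrow> carrier K \<and>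
     (\<forall>x\<in>carrier H. \<forall>y\<in>carrier H. T (x \<oplus>\<^bsub>H\<^esub> y) = T x \<oplus>\<^bsub>K\<^esub> T y) \<and>
     (\<forall>\<alpha>. \<forall>x\<in>carrier H. T (\<alpha> \<odot>\<^bsub>H\<^esub> x) = \<alpha> \<odot>\<^bsub>K\<^esub> T x) \<and>
     (\<exists>C. \<forall>x\<in>carrier H. hnorm K (T x) \<le> C * hnorm H x)"

text \<open>For \<open>H = K\<close> these are the unitary operators on \<open>H\<close>.\<close>

definition hilbert_iso :: "'v inner_space \<Rightarrow> 'w inner_space \<Rightarrow> ('v \<Rightarrow> 'w) \<Rightarrow> bool" where
  "hilbert_iso H K T \<longleftrightarrow>
     bounded_operator H K T \<and> bij_betw T (carrier H) (carrier K) \<and>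
     (\<forall>x\<in>carrier H. \<forall>y\<in>carrier H. ip K (T x) (T y) = ip H x y)"

definition lincomb :: "'v inner_space \<Rightarrow> ('j \<Rightarrow> 'v) \<Rightarrow> ('j \<Rightarrow> complex) \<Rightarrow> 'j set \<Rightarrow> 'v" where
  "lincomb H e \<alpha> F = (\<Oplus>\<^bsub>H\<^esub>j\<in>F. \<alpha> j \<odot>\<^bsub>H\<^esub> e j)"

definition lin_span :: "'v inner_space \<Rightarrow> ('j \<Rightarrow> 'v) \<Rightarrow> 'j set \<Rightarrow> 'v set" where
  "lin_span H e J = {lincomb H e \<alpha> F | \<alpha> F. finite F \<and> F \<subseteq> J}"

text \<open>The linear operator on the span of the linearly independent family \<open>e\<close> with
  \<open>e j\<close> an eigenvector of eigenvalue \<open>ev j\<close>.\<close>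

definition diag_operator ::
  "'v inner_space \<Rightarrow> ('j \<Rightarrow> 'v) \<Rightarrow> 'j set \<Rightarrow> ('j \<Rightarrow> complex) \<Rightarrow> 'v \<Rightarrow> 'v" where
  "diag_operator H e J ev x = (THE y. \<exists>\<alpha> F. finite F \<and> F \<subseteq> J \<and>
     x = lincomb H e \<alpha> F \<and> y = lincomb H e (\<lambda>j. \<alpha> j * ev j) F)"


section \<open>The Weyl algebra\<close>

text \<open>The *-algebra spanned by the symbols $W(g)$ is realised on finitely supported functions,
  \<open>Poly_Mapping.single g \<alpha>\<close> being $\alpha W(g)$.\<close>

definition symbol_algebra ::
  "('g, 'm) monoid_scheme \<Rightarrow> ('g \<Rightarrow> 'g \<Rightarrow> circle) \<Rightarrow> ('g \<Rightarrow>\<^sub>0 complex) star_algebra" where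
  "symbol_algebra G \<sigma> = \<lparr>
     carrier = {a. Poly_Mapping.keys a \<subseteq> carrier G},
     monoid.mult = (\<lambda>a b. \<Sum>g\<in>Poly_Mapping.keys a. \<Sum>h\<in>Poly_Mapping.keys b.
       Poly_Mapping.single (g \<otimes>\<^bsub>G\<^esub> h)
         (Poly_Mapping.lookup a g * Poly_Mapping.lookup b h * circle_exp (\<sigma> g h))),
     one = Poly_Mapping.single \<one>\<^bsub>G\<^esub> 1,
     zero = 0,
     add = (+),
     smult = (\<lambda>\<alpha>. Poly_Mapping.map ((*) \<alpha>)),
     adj = (\<lambda>a. \<Sum>g\<in>Poly_Mapping.keys a.
       Poly_Mapping.single (inv\<^bsub>G\<^esub> g) (cnj (Poly_Mapping.lookup a g))),
     nrm = (\<lambda>a. \<Sum>g\<in>Poly_Mapping.keys a. norm (Poly_Mapping.lookup a g))\<rparr>"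

type_synonym 'g weyl_elem = "(nat \<Rightarrow> (nat \<Rightarrow> 'g \<Rightarrow>\<^sub>0 complex) set) set"

definition weyl_banach ::
  "('g, 'm) monoid_scheme \<Rightarrow> ('g \<Rightarrow> 'g \<Rightarrow> circle) \<Rightarrow> (nat \<Rightarrow> 'g \<Rightarrow>\<^sub>0 complex) set star_algebra" where
  "weyl_banach G \<sigma> = alg_completion (symbol_algebra G \<sigma>)"

definition weyl_algebra ::
  "('g, 'm) monoid_scheme \<Rightarrow> ('g \<Rightarrow> 'g \<Rightarrow> circle) \<Rightarrow> 'g weyl_elem star_algebra" where
  "weyl_algebra G \<sigma> = enveloping_cstar (weyl_banach G \<sigma>)"

definition weyl_gen :: "('g, 'm) monoid_scheme \<Rightarrow> ('g \<Rightarrow> 'g \<Rightarrow> circle) \<Rightarrow> 'g \<Rightarrow> 'g weyl_elem" where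
  "weyl_gen G \<sigma> g = alg_embed (cstar_normed (weyl_banach G \<sigma>))
     (alg_embed (symbol_algebra G \<sigma>) (Poly_Mapping.single g 1))"

text \<open>The continuous linear functional with prescribed values on the generators $W(g)$.\<close>

definition weyl_functional :: "('g \<Rightarrow> complex) \<Rightarrow> 'g weyl_elem \<Rightarrow> complex" where
  "weyl_functional w = extend_fun (extend_fun
     (\<lambda>a. \<Sum>g\<in>Poly_Mapping.keys a. Poly_Mapping.lookup a g * w g))"

text \<open>The morphism $W(g) \mapsto W(\zeta g)$ into the Weyl algebra of \<open>(G, \<sigma>)\<close>.\<close>

definition weyl_map ::
  "('h, 'm) monoid_scheme \<Rightarrow> ('h \<Rightarrow> 'h \<Rightarrow> circle) \<Rightarrow> ('g \<Rightarrow> 'h) \<Rightarrow> 'g weyl_elem \<Rightarrow> 'h weyl_elem" where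
  "weyl_map G \<sigma> \<zeta> = extend_map (cstar_normed (weyl_banach G \<sigma>)) (extend_map (symbol_algebra G \<sigma>)
     (\<lambda>a. \<Sum>g\<in>Poly_Mapping.keys a. Poly_Mapping.single (\<zeta> g) (Poly_Mapping.lookup a g)))"


section \<open>The representation of the topological sector\<close>

type_synonym 'a hilb = "(nat \<Rightarrow> 'a top_elem weyl_elem) set"

context
  fixes M :: "('a, 'n::finite) spacetime" and S :: "'a set" and \<sigma> :: "'a chain set" and k :: nat
begin

definition weyl_free :: "'a top_elem weyl_elem star_algebra" where
  "weyl_free = weyl_algebra (top_free M k) (sigma_free M S \<sigma> k)"

definition W_free :: "'a top_elem \<Rightarrow> 'a top_elem weyl_elem" where
  "W_free = weyl_gen (top_free M k) (sigma_free M S \<sigma> k)"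

definition omega_free :: "'a top_elem weyl_elem \<Rightarrow> complex" where
  "omega_free = weyl_functional (\<lambda>(u, u\<^sub>1, z, z\<^sub>1). if (z, z\<^sub>1) = \<one>\<^bsub>free_pair M k\<^esub> then 1 else 0)"

definition H_free :: "'a hilb inner_space" where
  "H_free = gns_space weyl_free omega_free"

definition pi_free :: "'a top_elem weyl_elem \<Rightarrow> 'a hilb \<Rightarrow> 'a hilb" where
  "pi_free = gns_rep weyl_free omega_free"

definition ket :: "'a free_class \<times> 'a free_class \<Rightarrow> 'a hilb" where
  "ket = (\<lambda>(z, z\<^sub>1). gns_vector weyl_free omega_free
     (W_free (fst \<one>\<^bsub>rquot_pair M k\<^esub>, snd \<one>\<^bsub>rquot_pair M k\<^esub>, z, z\<^sub>1)))"

definition D_free :: "'a hilb set" where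
  "D_free = lin_span H_free ket (carrier (free_pair M k))"

definition phase_op :: "'a rquot_class \<times> 'a rquot_class \<Rightarrow> 'a hilb \<Rightarrow> 'a hilb" where
  "phase_op = (\<lambda>(u, u\<^sub>1). pi_free
     (W_free (u, u\<^sub>1, fst \<one>\<^bsub>free_pair M k\<^esub>, snd \<one>\<^bsub>free_pair M k\<^esub>)))"

definition shift_op :: "'a free_class \<times> 'a free_class \<Rightarrow> 'a hilb \<Rightarrow> 'a hilb" where
  "shift_op = (\<lambda>(z, z\<^sub>1). pi_free
     (W_free (fst \<one>\<^bsub>rquot_pair M k\<^esub>, snd \<one>\<^bsub>rquot_pair M k\<^esub>, z, z\<^sub>1)))"

text \<open>An operator with domain \<open>D_free\<close>.\<close>

definition flux_op :: "'a real_class \<times> 'a real_class \<Rightarrow> 'a hilb \<Rightarrow> 'a hilb" where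
  "flux_op = (\<lambda>(r, r\<^sub>1). diag_operator H_free ket (carrier (free_pair M k))
     (\<lambda>(z, z\<^sub>1). let m = CARD('n) in complex_of_real
        (2 * (real_pairing (points M) S \<sigma> (int m - int k - 1) (int k) r\<^sub>1 z
              - (-1) ^ (k * (m - k)) * real_pairing (points M) S \<sigma> (int k - 1) (int m - int k) r z\<^sub>1))))"

end

end

theory Submission
  imports Defs
begin

text \<open>
  The vectors $|z,\tilde z\rangle$ are orthonormal, so the GNS space is realised inside $\ell^2$ of the
  lattice $H^{k,m-k}_{\rm free}(M;\mathbb Z)$. There $W(u,\tilde u,y)$ acts as the operator
  $R : e_{y'} \mapsto e^{2\pi i\,\tau(y + 2y')} e_{y + y'}$, where $\tau$ is the character of the
  lattice given by $(u,\tilde u)$, and $\omega_{\rm free}$ is the vector state of $e_0$. Biadditivity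
  of $\tau$ makes $R$ a projective representation with cocycle $e^{2\pi i\sigma_{\rm free}}$. It
  extends first to the $\ell^1$ completion and then to the Weyl algebra, because the operator norm of
  a *-representation is a C*-seminorm; hence $a \mapsto \rho(a) e_0$ identifies the GNS space with a
  closed subspace of $\ell^2$. In this picture $U$ is the relabelling
  $e_{(z,\tilde z)} \mapsto e_{(\tilde z,\varepsilon z)}$, which intertwines the operators $R$ in
  degrees $k$ and $m-k$ because $\zeta_{\rm free}$ preserves $\tau$; by continuity it intertwines the
  representations of the two Weyl algebras.

  On the topological side only the biadditivity of the pairings is needed. It follows from the Leibniz
  rule for cup products of singular cochains, once the $\mathbb T$-valued pairing is written as the
  reduction of the real one: the real cup product of a cocycle with a torsion class is a coboundary.
\<close>

section \<open>Integer multiples and the circle\<close>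

text \<open>Two features shape the proof. First, the GNS space is a completion built on the Weyl
  algebra, which is itself a completion of a completion, and its operations are defined through
  values on classes of Cauchy sequences. Work with such classes is confined to a few general lemmas:
  an injective map that respects sums, scalars and inner products carries the GNS space into one
  concrete function space, and identities between vectors are checked there. Second,
  \<open>ell2\<close> is indexed by a whole type, whereas the lattice is only the carrier of a group
  in that type. The lattice therefore occupies the functions supported on its carrier, the operators
  are cut off outside it, and the neutral element acts as a projection. In return the degrees k and
  m - k share one index type, since degrees are not recorded in types, and the unitary comes from an
  operator on a single space.\<close>

lemma zact_0 [simp]: "zact 0 a = 0"
  by (simp add: zact_def)

lemma zact_1 [simp]: "zact 1 a = a"
  by (simp add: zact_def)

lemma zact_minus: "zact (- n) a = - zact n a"
  by (simp add: zact_def)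

text \<open>On each side of zero one of the two sums in \<open>zact\<close> is empty. The two
  branches are glued here, and the remaining laws in the integer variable follow by induction in
  both directions.\<close>

lemma zact_Suc: "zact (n + 1) a = zact n a + a"
proof (cases "n \<ge> 0")
  case True
  then have "nat (n + 1) = Suc (nat n)" by simp
  with True show ?thesis by (simp add: zact_def)
next
  case False
  then have "nat (- n) = Suc (nat (- (n + 1)))" by linarith
  with False show ?thesis by (simp add: zact_def)
qed

lemma zact_add_left: "zact (m + n) a = zact m a + zact n a"
proof (induction n rule: int_induct[where k = 0])
  case (step1 i)
  show ?case using zact_Suc[of "m + i" a] zact_Suc[of i a] step1 by (simp add: algebra_simps)
next
  case (step2 i)
  show ?case using zact_Suc[of "m + (i - 1)" a] zact_Suc[of "i - 1" a] step2
    by (simp add: algebra_simps)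
qed simp

lemma zact_add_right: "zact n (a + b) = zact n a + zact n b"
  by (simp add: zact_def sum.distrib algebra_simps)

lemma zact_zero_right [simp]: "zact n 0 = 0"
  by (simp add: zact_def)

lemma additive_zact:
  assumes "Modules.additive h"
  shows "h (zact n a) = zact n (h a)"
  by (simp add: zact_def additive.diff[OF assms] additive.sum[OF assms])

lemma zact_real [simp]: "zact n (x :: real) = of_int n * x"
  by (cases "n \<ge> 0") (simp_all add: zact_def)

lemma zact_int [simp]: "zact n (x :: int) = n * x"
  by (cases "n \<ge> 0") (simp_all add: zact_def)

lemma zact_sum_right: "zact n (sum h A) = (\<Sum>x\<in>A. zact n (h x))"
  by (induction A rule: infinite_finite_induct) (simp_all add: zact_add_right)

lemma zact_zact: "zact m (zact n a) = zact (m * n) a"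
proof (induction m rule: int_induct[where k = 0])
  case (step1 i)
  then show ?case using zact_add_left[of i 1 "zact n a"] zact_add_left[of "i * n" n a]
    by (simp add: algebra_simps)
next
  case (step2 i)
  then show ?case using zact_add_left[of "i - 1" 1 "zact n a"] zact_add_left[of "i * n - n" n a]
    by (simp add: algebra_simps)
qed simp

lemma additive_to_circle: "Modules.additive to_circle"
  by (rule additive.intro) (simp add: plus_circle.abs_eq)

lemma to_circle_of_int [simp]: "to_circle (of_int n) = 0"
  unfolding zero_circle_def circle.abs_eq_iff by simp

lemma additive_of_int: "Modules.additive (of_int :: int \<Rightarrow> 'a::ring_1)"
  by (rule additive.intro) simp

section \<open>Evaluation of cochains on chains\<close>

text \<open>The expression inside \<open>coh_eval\<close> before passage to classes: a cochain
  extended to a homomorphism on the free abelian group of simplices.\<close>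

definition chain_eval :: "('a, 'c::ab_group_add) cochain \<Rightarrow> 'a chain \<Rightarrow> 'c" where
  "chain_eval \<phi> c = (\<Sum>f\<in>Poly_Mapping.keys c. zact (Poly_Mapping.lookup c f) (\<phi> f))"

lemma chain_eval_superset:
  assumes "finite K" "Poly_Mapping.keys c \<subseteq> K"
  shows "chain_eval \<phi> c = (\<Sum>f\<in>K. zact (Poly_Mapping.lookup c f) (\<phi> f))"
  unfolding chain_eval_def
  by (rule sum.mono_neutral_left) (use assms in \<open>auto simp: in_keys_iff\<close>)

lemma chain_eval_add: "chain_eval \<phi> (c + d) = chain_eval \<phi> c + chain_eval \<phi> d"
proof -
  let ?K = "Poly_Mapping.keys c \<union> Poly_Mapping.keys d"
  have "Poly_Mapping.keys (c + d) \<subseteq> ?K"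
    by (rule keys_add)
  then show ?thesis
    by (simp add: chain_eval_superset[of ?K] lookup_add zact_add_left sum.distrib)
qed

lemma chain_eval_0 [simp]: "chain_eval \<phi> 0 = 0"
  by (simp add: chain_eval_def)

lemma additive_chain_eval: "Modules.additive (chain_eval \<phi>)"
  by (rule additive.intro) (rule chain_eval_add)

lemma chain_eval_of [simp]: "chain_eval \<phi> (frag_of f) = \<phi> f"
  by (simp add: chain_eval_def)

lemma chain_eval_cmul: "chain_eval \<phi> (frag_cmul n c) = zact n (chain_eval \<phi> c)"
proof -
  have "Poly_Mapping.keys (frag_cmul n c) \<subseteq> Poly_Mapping.keys c"
    by (auto simp: in_keys_iff)
  then show ?thesis
    by (simp add: chain_eval_superset[of "Poly_Mapping.keys c"] zact_sum_right zact_zact)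
qed

lemma chain_eval_plus_fun: "chain_eval (\<lambda>f. \<phi> f + \<psi> f) c = chain_eval \<phi> c + chain_eval \<psi> c"
  by (simp add: chain_eval_def zact_add_right sum.distrib)

lemma chain_eval_zero_fun [simp]: "chain_eval (\<lambda>f. 0) c = 0"
  by (simp add: chain_eval_def)

lemma chain_eval_comp:
  assumes "Modules.additive h"
  shows "chain_eval (h \<circ> \<phi>) c = h (chain_eval \<phi> c)"
  by (simp add: chain_eval_def additive.sum[OF assms] additive_zact[OF assms])

section \<open>Coboundaries, cocycles and coefficient homomorphisms\<close>

lemma cochains_neg: "\<phi> \<in> cochains p X \<Longrightarrow> p < 0 \<Longrightarrow> \<phi> = (\<lambda>f. 0)"
  by (auto simp: cochains_def sing_def)

lemma coboundary_eq_chain_eval: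
  assumes "\<phi> \<in> cochains p X" "f \<in> sing (p + 1) X"
  shows "coboundary p X \<phi> f = chain_eval \<phi> (chain_boundary (nat (p + 1)) (frag_of f))"
proof (cases "p < 0")
  case True
  \<comment> \<open>For \<open>p = -1\<close> the boundary is taken in degree zero, where there are
    no faces; both sides vanish because a cochain of negative degree is zero.\<close>
  then have "\<phi> = (\<lambda>f. 0)" using assms cochains_neg by blast
  then show ?thesis by (simp add: coboundary_def)
next
  case False
  then have "nat (p + 1) \<noteq> 0" by simp
  then show ?thesis using assms(2)
    by (simp add: coboundary_def chain_boundary_of additive.sum[OF additive_chain_eval]
        chain_eval_cmul)
qed

text \<open>Stokes' formula for cochains. Linearity in the chain reduces it to the definition of the
  coboundary on a single simplex.\<close>

lemma chain_eval_coboundary: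
  assumes \<phi>: "\<phi> \<in> cochains p X" and c: "singular_chain (nat (p + 1)) X c" and p: "-1 \<le> p"
  shows "chain_eval (coboundary p X \<phi>) c = chain_eval \<phi> (chain_boundary (nat (p + 1)) c)"
proof -
  have "chain_eval \<phi> (chain_boundary (nat (p + 1)) c) =
    chain_eval \<phi> (chain_boundary (nat (p + 1)) (\<Sum>f\<in>Poly_Mapping.keys c.
      frag_cmul (Poly_Mapping.lookup c f) (frag_of f)))"
    by (subst frag_expansion[of c]) (simp only: frag_extend_def o_apply)
  also have "\<dots> = (\<Sum>f\<in>Poly_Mapping.keys c. zact (Poly_Mapping.lookup c f)
      (chain_eval \<phi> (chain_boundary (nat (p + 1)) (frag_of f))))"
    by (simp add: chain_boundary_sum additive.sum[OF additive_chain_eval] chain_boundary_cmul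
        chain_eval_cmul)
  also have "\<dots> = chain_eval (coboundary p X \<phi>) c"
    unfolding chain_eval_def
  proof (rule sum.cong)
    fix f assume "f \<in> Poly_Mapping.keys c"
    then have "f \<in> sing (p + 1) X"
      using c p by (auto simp: singular_chain_def sing_def)
    then show "zact (Poly_Mapping.lookup c f) (\<Sum>fa\<in>Poly_Mapping.keys (chain_boundary (nat (p + 1)) (frag_of f)).
         zact (Poly_Mapping.lookup (chain_boundary (nat (p + 1)) (frag_of f)) fa) (\<phi> fa)) =
      zact (Poly_Mapping.lookup c f) (coboundary p X \<phi> f)"
      using coboundary_eq_chain_eval[OF \<phi>] by (simp add: chain_eval_def)
  qed simp
  finally show ?thesis by simp
qed

lemma coboundary_in_cochains: "coboundary p X \<phi> \<in> cochains (p + 1) X"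
  by (simp add: coboundary_def cochains_def)

text \<open>The transpose of the fact that a boundary has no boundary. Degrees below zero are split
  off because \<open>nat\<close> would identify them with degree zero.\<close>

lemma coboundary_coboundary:
  assumes "\<phi> \<in> cochains p X"
  shows "coboundary (p + 1) X (coboundary p X \<phi>) = (\<lambda>f. 0)"
proof
  fix f
  show "coboundary (p + 1) X (coboundary p X \<phi>) f = 0"
  proof (cases "f \<in> sing (p + 1 + 1) X \<and> 0 \<le> p")
    case True
    then obtain k where k: "p = int k"
      using nonneg_int_cases by blast
    have n: "nat (p + 1 + 1) = Suc (Suc k)" "nat (p + 1) = Suc k"
      using k by simp_all
    have f: "singular_chain (Suc (Suc k)) X (frag_of f)"
      using True n(1) by (simp only: sing_def mem_Collect_eq singular_chain_of)
    have bf: "singular_chain (nat (p + 1)) X (chain_boundary (Suc (Suc k)) (frag_of f))"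
      unfolding n by (rule singular_chain_boundary_alt[OF f])
    have "coboundary (p + 1) X (coboundary p X \<phi>) f =
        chain_eval (coboundary p X \<phi>) (chain_boundary (Suc (Suc k)) (frag_of f))"
      using coboundary_eq_chain_eval[OF coboundary_in_cochains, of f p X \<phi>] True
      unfolding n by blast
    also have "\<dots> = chain_eval \<phi> (chain_boundary (Suc k) (chain_boundary (Suc (Suc k)) (frag_of f)))"
      using chain_eval_coboundary[OF assms bf] k unfolding n by simp
    also have "\<dots> = 0"
      by (simp only: chain_boundary_boundary_alt[OF f] chain_eval_0)
    finally show ?thesis .
  next
    case False
    then consider "f \<notin> sing (p + 1 + 1) X" | "p < 0" by linarith
    then show ?thesis
    proof cases
      case 2
      then have "coboundary p X \<phi> = (\<lambda>f. 0)"
        using cochains_neg[OF assms] by (auto simp: coboundary_def)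
      then show ?thesis by (simp add: coboundary_def)
    qed (simp add: coboundary_def)
  qed
qed

lemma coboundary_add:
  "coboundary p X (\<lambda>f. \<phi> f + \<psi> f) = (\<lambda>f. coboundary p X \<phi> f + coboundary p X \<psi> f)"
  by (auto simp: coboundary_def zact_add_right sum.distrib)

text \<open>Coefficient change is a cochain map. It will be applied to negation, integer multiples,
  division of reals by a number, the inclusion of the integers in the reals and the reduction of the
  reals to the circle.\<close>

lemma coboundary_comp:
  assumes "Modules.additive h"
  shows "coboundary p X (h \<circ> \<phi>) = h \<circ> coboundary p X \<phi>"
  by (auto simp: coboundary_def additive.sum[OF assms] additive_zact[OF assms] additive.zero[OF assms])

lemma cochains_add: "\<phi> \<in> cochains p X \<Longrightarrow> \<psi> \<in> cochains p X \<Longrightarrow> (\<lambda>f. \<phi> f + \<psi> f) \<in> cochains p X"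
  by (simp add: cochains_def)

lemma cochains_comp: "Modules.additive h \<Longrightarrow> \<phi> \<in> cochains p X \<Longrightarrow> h \<circ> \<phi> \<in> cochains p X"
  using additive.zero[of h] by (simp add: cochains_def)

lemma additive_zact_fun: "Modules.additive (zact n)"
  by (rule additive.intro) (rule zact_add_right)

lemma additive_uminus: "Modules.additive (uminus :: 'a::ab_group_add \<Rightarrow> 'a)"
  by (rule additive.intro) simp

lemma cocycles_add: "\<phi> \<in> cocycles p X \<Longrightarrow> \<psi> \<in> cocycles p X \<Longrightarrow> (\<lambda>f. \<phi> f + \<psi> f) \<in> cocycles p X"
  by (simp add: cocycles_def cochains_add coboundary_add)

lemma cocycles_comp: "Modules.additive h \<Longrightarrow> \<phi> \<in> cocycles p X \<Longrightarrow> h \<circ> \<phi> \<in> cocycles p X"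
  using additive.zero[of h] by (auto simp: cocycles_def cochains_comp coboundary_comp)

lemma coboundaries_add:
  "\<phi> \<in> coboundaries p X \<Longrightarrow> \<psi> \<in> coboundaries p X \<Longrightarrow> (\<lambda>f. \<phi> f + \<psi> f) \<in> coboundaries p X"
  unfolding coboundaries_def by (auto simp flip: coboundary_add intro!: imageI cochains_add)

lemma coboundaries_comp: "Modules.additive h \<Longrightarrow> \<phi> \<in> coboundaries p X \<Longrightarrow> h \<circ> \<phi> \<in> coboundaries p X"
  unfolding coboundaries_def by (auto simp flip: coboundary_comp intro!: imageI cochains_comp)

lemma coboundaries_subset_cocycles: "coboundaries p X \<subseteq> cocycles p X"
proof
  fix \<phi> :: "('a, 'c::ab_group_add) cochain" assume "\<phi> \<in> coboundaries p X"
  then obtain \<eta> where "\<eta> \<in> cochains (p - 1) X" "\<phi> = coboundary (p - 1) X \<eta>"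
    by (auto simp: coboundaries_def)
  then show "\<phi> \<in> cocycles p X"
    using coboundary_in_cochains[of "p - 1" X \<eta>] coboundary_coboundary[of \<eta> "p - 1" X]
    by (simp add: cocycles_def)
qed

lemma zero_in_cochains [simp]: "(\<lambda>f. 0) \<in> cochains p X"
  by (simp add: cochains_def)

lemma coboundary_zero [simp]: "coboundary p X (\<lambda>f. 0) = (\<lambda>f. 0)"
  by (auto simp: coboundary_def)

lemma zero_in_coboundaries [simp]: "(\<lambda>f. 0) \<in> coboundaries p X"
  unfolding coboundaries_def using coboundary_zero[of "p - 1" X] by (intro image_eqI[where x = "\<lambda>f. 0"]) simp_all

lemma zero_in_cocycles [simp]: "(\<lambda>f. 0) \<in> cocycles p X"
  using coboundaries_subset_cocycles zero_in_coboundaries by blast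

section \<open>Cohomology groups\<close>

lemma comm_group_cocycle_group: "comm_group (cocycle_group p X)"
proof (rule comm_groupI)
  show "\<exists>\<psi>\<in>carrier (cocycle_group p X). \<psi> \<otimes>\<^bsub>cocycle_group p X\<^esub> \<phi> = \<one>\<^bsub>cocycle_group p X\<^esub>"
    if "\<phi> \<in> carrier (cocycle_group p X)" for \<phi> :: "('a, 'c::ab_group_add) cochain"
    by (rule bexI[of _ "uminus \<circ> \<phi>"])
      (use that cocycles_comp[OF additive_uminus] in \<open>auto simp: cocycle_group_def\<close>)
qed (auto simp: cocycle_group_def cocycles_add add_ac)

lemma inv_cocycle_group:
  assumes "\<phi> \<in> cocycles p X"
  shows "inv\<^bsub>cocycle_group p X\<^esub> \<phi> = uminus \<circ> \<phi>"
proof -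
  interpret comm_group "cocycle_group p X" by (rule comm_group_cocycle_group)
  show ?thesis
    by (rule inv_equality)
      (use assms cocycles_comp[OF additive_uminus assms] in \<open>auto simp: cocycle_group_def\<close>)
qed

lemma subgroup_coboundaries: "subgroup (coboundaries p X) (cocycle_group p X)"
proof
  show "coboundaries p X \<subseteq> carrier (cocycle_group p X)"
    using coboundaries_subset_cocycles by (auto simp: cocycle_group_def)
  fix \<phi> :: "('a, 'c::ab_group_add) cochain" assume "\<phi> \<in> coboundaries p X"
  then show "inv\<^bsub>cocycle_group p X\<^esub> \<phi> \<in> coboundaries p X"
    using coboundaries_subset_cocycles inv_cocycle_group coboundaries_comp[OF additive_uminus]
    by (metis subsetD)
qed (auto simp: cocycle_group_def coboundaries_add)

lemma comm_group_cohomology: "comm_group (cohomology_group p X)"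
  unfolding cohomology_group_def
  by (intro comm_group.abelian_FactGroup comm_group_cocycle_group subgroup_coboundaries)

lemma coh_class_mem: "\<psi> \<in> coh_class p X \<phi> \<longleftrightarrow> (\<exists>b\<in>coboundaries p X. \<psi> = (\<lambda>f. b f + \<phi> f))"
  by (auto simp: coh_class_def r_coset_def cocycle_group_def)

lemma coh_class_self: "\<phi> \<in> coh_class p X \<phi>"
  unfolding coh_class_mem by (rule bexI[of _ "\<lambda>f. 0"]) simp_all

lemma coh_class_add_coboundary:
  assumes "\<phi> \<in> cocycles p X" "b \<in> coboundaries p X"
  shows "coh_class p X (\<lambda>f. b f + \<phi> f) = coh_class p X \<phi>"
proof -
  interpret comm_group "cocycle_group p X" by (rule comm_group_cocycle_group)
  have "(\<lambda>f. b f + \<phi> f) \<in> coh_class p X \<phi>"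
    using assms(2) by (auto simp: coh_class_mem)
  then show ?thesis
    unfolding coh_class_def using repr_independence[OF _ _ subgroup_coboundaries] assms(1)
    by (auto simp: cocycle_group_def)
qed

lemma carrier_cohomology_group: "carrier (cohomology_group p X) = coh_class p X ` cocycles p X"
  by (simp add: cohomology_group_def carrier_FactGroup coh_class_def cocycle_group_def)

lemma mult_cohomology_group:
  assumes "\<phi> \<in> cocycles p X" "\<psi> \<in> cocycles p X"
  shows "coh_class p X \<phi> \<otimes>\<^bsub>cohomology_group p X\<^esub> coh_class p X \<psi> = coh_class p X (\<lambda>f. \<phi> f + \<psi> f)"
proof -
  interpret comm_group "cocycle_group p X" by (rule comm_group_cocycle_group)
  interpret normal "coboundaries p X" "cocycle_group p X"
    by (rule subgroup_imp_normal[OF subgroup_coboundaries])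
  show ?thesis
    using rcos_sum[of \<phi> \<psi>] assms
    by (simp add: cohomology_group_def coh_class_def cocycle_group_def)
qed

lemma one_cohomology_group: "\<one>\<^bsub>cohomology_group p X\<^esub> = coh_class p X (\<lambda>f. 0)"
  by (auto simp: cohomology_group_def coh_class_mem)

lemma coh_class_eq_one_iff:
  assumes "\<phi> \<in> cocycles p X"
  shows "coh_class p X \<phi> = \<one>\<^bsub>cohomology_group p X\<^esub> \<longleftrightarrow> \<phi> \<in> coboundaries p X"
proof
  assume "coh_class p X \<phi> = \<one>\<^bsub>cohomology_group p X\<^esub>"
  then have "\<phi> \<in> coh_class p X (\<lambda>f. 0)"
    using coh_class_self one_cohomology_group by metis
  then show "\<phi> \<in> coboundaries p X" by (simp add: coh_class_mem)
next
  assume "\<phi> \<in> coboundaries p X"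
  from coh_class_add_coboundary[OF zero_in_cocycles this]
  show "coh_class p X \<phi> = \<one>\<^bsub>cohomology_group p X\<^esub>"
    by (simp add: one_cohomology_group)
qed

lemma pow_cohomology_group:
  assumes "\<phi> \<in> cocycles p X"
  shows "coh_class p X \<phi> [^]\<^bsub>cohomology_group p X\<^esub> (n :: nat) = coh_class p X (zact (int n) \<circ> \<phi>)"
proof (induction n)
  case 0
  show ?case by (simp add: one_cohomology_group comp_def)
next
  case (Suc n)
  have "coh_class p X \<phi> [^]\<^bsub>cohomology_group p X\<^esub> Suc n =
      coh_class p X (zact (int n) \<circ> \<phi>) \<otimes>\<^bsub>cohomology_group p X\<^esub> coh_class p X \<phi>"
    using Suc by (simp add: comp_def)
  also have "\<dots> = coh_class p X (\<lambda>f. (zact (int n) \<circ> \<phi>) f + \<phi> f)"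
    by (intro mult_cohomology_group cocycles_comp additive_zact_fun assms)
  also have "(\<lambda>f. (zact (int n) \<circ> \<phi>) f + \<phi> f) = zact (int (Suc n)) \<circ> \<phi>"
    by (simp add: fun_eq_iff zact_Suc add.commute[of 1 "int n"])
  finally show ?case .
qed

text \<open>The image of a class is a singleton once the class is inhabited and the map is constant
  on it. Operations on classes are computed below by exhibiting one representative and proving
  constancy.\<close>

lemma descend_eqI:
  assumes "x \<in> C" "\<And>y. y \<in> C \<Longrightarrow> f y = v"
  shows "descend f C = v"
proof -
  have "f ` C = {v}" using assms by force
  then show ?thesis by (simp add: descend_def)
qed

lemma descend2_eqI:
  assumes "x \<in> C" "y \<in> D" "\<And>x y. x \<in> C \<Longrightarrow> y \<in> D \<Longrightarrow> f x y = v"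
  shows "descend2 f C D = v"
proof -
  have "(\<lambda>(x, y). f x y) ` (C \<times> D) = {v}" using assms by force
  then show ?thesis by (simp add: descend2_def)
qed

lemma coh_coeff_class:
  assumes "Modules.additive h" "\<phi> \<in> cocycles p X"
  shows "coh_coeff p X h (coh_class p X \<phi>) = coh_class p X (h \<circ> \<phi>)"
  unfolding coh_coeff_def
proof (rule descend_eqI[OF coh_class_self])
  fix \<psi> assume "\<psi> \<in> coh_class p X \<phi>"
  then obtain b where b: "b \<in> coboundaries p X" "\<psi> = (\<lambda>f. b f + \<phi> f)"
    by (auto simp: coh_class_mem)
  then have "h \<circ> \<psi> = (\<lambda>f. (h \<circ> b) f + (h \<circ> \<phi>) f)"
    using additive.add[OF assms(1)] by auto
  then show "coh_class p X (h \<circ> \<psi>) = coh_class p X (h \<circ> \<phi>)"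
    using coh_class_add_coboundary[OF cocycles_comp[OF assms] coboundaries_comp[OF assms(1) b(1)]]
    by simp
qed

subsection \<open>Restriction to a subspace\<close>

text \<open>Pullback along the inclusion of a subspace: a simplex of the subspace is already a
  simplex of the whole space, so only the cutoff to \<open>sing p Y\<close> remains.\<close>

definition cochain_restrict :: "int \<Rightarrow> 'a topology \<Rightarrow> ('a, 'c::ab_group_add) cochain \<Rightarrow> ('a, 'c) cochain" where
  "cochain_restrict p Y \<phi> = (\<lambda>f. if f \<in> sing p Y then \<phi> f else 0)"

lemma cochain_restrict_add:
  "cochain_restrict p Y (\<lambda>f. \<phi> f + \<psi> f) = (\<lambda>f. cochain_restrict p Y \<phi> f + cochain_restrict p Y \<psi> f)"
  by (auto simp: cochain_restrict_def)

lemma cochain_restrict_zero: "cochain_restrict p Y (\<lambda>f. 0) = (\<lambda>f. 0)"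
  by (simp add: cochain_restrict_def)

lemma cochain_restrict_comp:
  "Modules.additive h \<Longrightarrow> cochain_restrict p Y (h \<circ> \<phi>) = h \<circ> cochain_restrict p Y \<phi>"
  using additive.zero[of h] by (auto simp: cochain_restrict_def)

lemma cochain_restrict_in_cochains: "cochain_restrict p Y \<phi> \<in> cochains p Y"
  by (simp add: cochain_restrict_def cochains_def)

lemma singular_face_in_sing:
  assumes "f \<in> sing (p + 1) Y" "0 \<le> p" "i \<le> nat (p + 1)"
  shows "singular_face (nat (p + 1)) i f \<in> sing p Y"
proof -
  have "nat (p + 1) - Suc 0 = nat p" using assms(2) by linarith
  moreover have "1 \<le> nat (p + 1)" using assms(2) by linarith
  ultimately show ?thesis
    using singular_simplex_singular_face[of "nat (p + 1)" Y f i] assms by (simp add: sing_def)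
qed

lemma sing_subtopology: "f \<in> sing p (subtopology X S) \<Longrightarrow> f \<in> sing p X"
  by (auto simp: sing_def singular_simplex_subtopology)

lemma coboundary_restrict:
  assumes "\<phi> \<in> cochains p X"
  shows "coboundary p (subtopology X S) (cochain_restrict p (subtopology X S) \<phi>) =
    cochain_restrict (p + 1) (subtopology X S) (coboundary p X \<phi>)"
proof (cases "0 \<le> p")
  case True
  show ?thesis
    by (auto simp: coboundary_def cochain_restrict_def sing_subtopology singular_face_in_sing[OF _ True]
        intro!: sum.cong)
next
  case False
  then have "\<phi> = (\<lambda>f. 0)" using cochains_neg[OF assms] by simp
  then show ?thesis by (simp add: cochain_restrict_zero)
qed

lemma cocycles_restrict:
  assumes "\<phi> \<in> cocycles p X"
  shows "cochain_restrict p (subtopology X S) \<phi> \<in> cocycles p (subtopology X S)"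
  using assms coboundary_restrict[of \<phi> p X S]
  by (auto simp: cocycles_def cochain_restrict_in_cochains) (simp add: cochain_restrict_def)

lemma coboundaries_restrict:
  assumes "\<phi> \<in> coboundaries p X"
  shows "cochain_restrict p (subtopology X S) \<phi> \<in> coboundaries p (subtopology X S)"
proof -
  obtain \<eta> where \<eta>: "\<eta> \<in> cochains (p - 1) X" "\<phi> = coboundary (p - 1) X \<eta>"
    using assms by (auto simp: coboundaries_def)
  then have "cochain_restrict p (subtopology X S) \<phi> =
      coboundary (p - 1) (subtopology X S) (cochain_restrict (p - 1) (subtopology X S) \<eta>)"
    using coboundary_restrict[OF \<eta>(1), of S] by simp
  then show ?thesis
    unfolding coboundaries_def by (metis cochain_restrict_in_cochains image_eqI)
qed

lemma coh_pullback_class: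
  assumes "\<phi> \<in> cocycles p X"
  shows "coh_pullback p (subtopology X S) id (coh_class p X \<phi>) =
    coh_class p (subtopology X S) (cochain_restrict p (subtopology X S) \<phi>)"
  unfolding coh_pullback_def
proof (rule descend_eqI[OF coh_class_self])
  fix \<psi> assume "\<psi> \<in> coh_class p X \<phi>"
  then obtain b where b: "b \<in> coboundaries p X" "\<psi> = (\<lambda>f. b f + \<phi> f)"
    by (auto simp: coh_class_mem)
  have "(\<lambda>f. if f \<in> sing p (subtopology X S) then \<psi> (simplex_map (nat p) id f) else 0) =
      cochain_restrict p (subtopology X S) \<psi>"
  proof -
    \<comment> \<open>A singular simplex is extensional, so composing it with the identity and
      restricting again changes nothing.\<close>
    have "simplex_map (nat p) id f = f" if "f \<in> sing p (subtopology X S)" for f :: "(nat \<Rightarrow> real) \<Rightarrow> 'a"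
      using that simplex_map_id_gen[of "nat p" "subtopology X S" f id] by (simp only: sing_def) simp
    then show ?thesis
      by (simp only: cochain_restrict_def cong: if_cong)
  qed
  also have "\<dots> = (\<lambda>f. cochain_restrict p (subtopology X S) b f + cochain_restrict p (subtopology X S) \<phi> f)"
    by (simp add: b cochain_restrict_add)
  finally show "coh_class p (subtopology X S)
      (\<lambda>f. if f \<in> sing p (subtopology X S) then \<psi> (simplex_map (nat p) id f) else 0) =
    coh_class p (subtopology X S) (cochain_restrict p (subtopology X S) \<phi>)"
    using coh_class_add_coboundary[OF cocycles_restrict[OF assms] coboundaries_restrict[OF b(1)]]
    by simp
qed

section \<open>Cup products\<close>

text \<open>The \<open>p\<close>-fold iterate of \<open>simplical_face 0\<close>.\<close>

definition simplex_shift :: "nat \<Rightarrow> (nat \<Rightarrow> real) \<Rightarrow> nat \<Rightarrow> real" where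
  "simplex_shift p x = (\<lambda>i. if i < p then 0 else x (i - p))"

lemma simplex_shift_0: "simplex_shift 0 x = x"
  by (simp add: simplex_shift_def)

lemma simplex_shift_Suc: "simplex_shift (Suc p) x = simplical_face 0 (simplex_shift p x)"
  by (auto simp: simplex_shift_def simplical_face_def fun_eq_iff intro!: arg_cong[where f = x])

lemma simplex_shift_in: "x \<in> standard_simplex q \<Longrightarrow> simplex_shift p x \<in> standard_simplex (p + q)"
proof (induction p)
  case (Suc p)
  then show ?case
    using simplical_face_in_standard_simplex[of "Suc (p + q)" 0] by (simp add: simplex_shift_Suc)
qed (simp add: simplex_shift_0)

lemma back_face_alt: "back_face p q f = restrict (f \<circ> simplex_shift p) (standard_simplex q)"
  by (simp add: back_face_def simplex_shift_def comp_def)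

lemma simplical_face_ge:
  assumes "x \<in> standard_simplex p" "p < i"
  shows "simplical_face i x = x"
  using assms by (auto simp: simplical_face_def standard_simplex_def)

lemma simplical_face_shift_le: "i \<le> p \<Longrightarrow> simplical_face i (simplex_shift p x) = simplex_shift (Suc p) x"
  by (auto simp: simplical_face_def simplex_shift_def fun_eq_iff intro!: arg_cong[where f = x])

lemma simplical_face_shift_ge:
  "simplical_face (p + j) (simplex_shift p x) = simplex_shift p (simplical_face j x)"
  by (auto simp: simplical_face_def simplex_shift_def fun_eq_iff intro!: arg_cong[where f = x])

text \<open>Among the faces of a simplex of dimension p + q + 1, those with i <= p + 1 can be taken
  on the front part and those with i >= p on the back part. The ranges of this and the next three
  lemmas overlap at i = p and i = p + 1; the overlaps later identify the two cancelling terms of the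
  Leibniz rule.\<close>

lemma front_face_of_face:
  assumes "i \<le> Suc p"
  shows "front_face p (singular_face (Suc (p + q)) i f) = singular_face (Suc p) i (front_face (Suc p) f)"
proof -
  have "simplical_face i x \<in> standard_simplex (Suc p)" if "x \<in> standard_simplex p" for x :: "nat \<Rightarrow> real"
    using simplical_face_in_standard_simplex[of "Suc p" i x] assms that by simp
  moreover have "x \<in> standard_simplex (p + q)" if "x \<in> standard_simplex p" for x
    using that standard_simplex_mono[of p "p + q"] by auto
  ultimately show ?thesis
    by (auto simp: front_face_def singular_face_def restrict_def fun_eq_iff)
qed

lemma front_face_of_face_ge:
  assumes "p < i"
  shows "front_face p (singular_face (Suc (p + q)) i f) = front_face p f"
proof -
  have "x \<in> standard_simplex (p + q)" if "x \<in> standard_simplex p" for x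
    using that standard_simplex_mono[of p "p + q"] by auto
  then show ?thesis
    using assms by (auto simp: front_face_def singular_face_def restrict_def fun_eq_iff simplical_face_ge)
qed

lemma back_face_of_face_le:
  assumes "i \<le> p"
  shows "back_face p q (singular_face (Suc (p + q)) i f) = back_face (Suc p) q f"
  using assms simplex_shift_in[of _ q p]
  by (auto simp: back_face_alt singular_face_def restrict_def fun_eq_iff simplical_face_shift_le)

lemma back_face_of_face_ge:
  assumes "j \<le> Suc q"
  shows "back_face p q (singular_face (Suc (p + q)) (p + j) f) =
    singular_face (Suc q) j (back_face p (Suc q) f)"
proof -
  have "simplical_face j x \<in> standard_simplex (Suc q)" if "x \<in> standard_simplex q" for x :: "nat \<Rightarrow> real"
    using simplical_face_in_standard_simplex[of "Suc q" j x] assms that by simp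
  then show ?thesis
    using simplex_shift_in[of _ q p]
    by (auto simp: back_face_alt singular_face_def restrict_def fun_eq_iff simplical_face_shift_ge)
qed

text \<open>A front face arises by dropping last vertices one at a time, a back face by dropping
  first vertices, so both claims reduce to the one for single faces.\<close>

lemma singular_simplex_front_face:
  "singular_simplex (p + q) X f \<Longrightarrow> singular_simplex p X (front_face p f)"
proof (induction q arbitrary: f)
  case 0
  then show ?case by (simp add: front_face_def singular_simplex_def extensional_restrict)
next
  case (Suc q)
  have "singular_simplex (p + q) X (singular_face (Suc (p + q)) (Suc (p + q)) f)"
    using singular_simplex_singular_face[of "Suc (p + q)" X f "Suc (p + q)"] Suc.prems by simp
  from Suc.IH[OF this] show ?case by (simp add: front_face_of_face_ge)
qed

lemma singular_simplex_back_face: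
  "singular_simplex (p + q) X f \<Longrightarrow> singular_simplex q X (back_face p q f)"
proof (induction p arbitrary: f)
  case 0
  have "f \<circ> simplex_shift 0 = f" by (auto simp: simplex_shift_0)
  with 0 show ?case by (simp add: back_face_alt singular_simplex_def extensional_restrict)
next
  case (Suc p)
  have "singular_simplex (p + q) X (singular_face (Suc (p + q)) 0 f)"
    using singular_simplex_singular_face[of "Suc (p + q)" X f 0] Suc.prems by simp
  from Suc.IH[OF this] show ?case by (simp add: back_face_of_face_le)
qed

section \<open>Cup products of cochains and the Leibniz rule\<close>

definition biadditive :: "('c::ab_group_add \<Rightarrow> 'd::ab_group_add \<Rightarrow> 'e::ab_group_add) \<Rightarrow> bool" where
  "biadditive \<beta> \<longleftrightarrow> (\<forall>y. Modules.additive (\<lambda>x. \<beta> x y)) \<and> (\<forall>x. Modules.additive (\<beta> x))"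

lemma biadditive_left: "biadditive \<beta> \<Longrightarrow> Modules.additive (\<lambda>x. \<beta> x y)"
  and biadditive_right: "biadditive \<beta> \<Longrightarrow> Modules.additive (\<beta> x)"
  by (auto simp: biadditive_def)

lemma biadditive_times: "biadditive ((*) :: real \<Rightarrow> real \<Rightarrow> real)"
  by (auto simp: biadditive_def intro!: additive.intro simp: algebra_simps)

lemma biadditive_zact: "biadditive (\<lambda>t n. zact n t)"
  by (auto simp: biadditive_def intro!: additive.intro simp: zact_add_left zact_add_right)

definition cochain_cup :: "('c \<Rightarrow> 'd \<Rightarrow> 'e) \<Rightarrow> int \<Rightarrow> int \<Rightarrow> 'a topology \<Rightarrow> ('a, 'c::ab_group_add) cochain
     \<Rightarrow> ('a, 'd::ab_group_add) cochain \<Rightarrow> ('a, 'e::ab_group_add) cochain" where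
  "cochain_cup \<beta> p q X \<phi> \<psi> = (\<lambda>f. if f \<in> sing (p + q) X
     then \<beta> (\<phi> (front_face (nat p) f)) (\<psi> (back_face (nat p) (nat q) f)) else 0)"

lemma zact_neg_one_Suc: "zact ((-1) ^ Suc i) a = - zact ((-1) ^ i) a"
  using zact_minus[of "(-1) ^ i" a] by simp

text \<open>The first p + 1 faces differentiate the front factor, the remaining q + 1 the back
  factor. Each sum on the right has one term more than that, the face opposite the vertex shared by
  the two factors, and the two surplus terms cancel.\<close>

lemma cup_leibniz_simplex:
  assumes "biadditive \<beta>"
  shows "(\<Sum>i\<le>Suc (p + q). zact ((-1) ^ i) (\<beta> (\<phi> (front_face p (singular_face (Suc (p + q)) i f)))
      (\<psi> (back_face p q (singular_face (Suc (p + q)) i f))))) =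
    \<beta> (\<Sum>i\<le>Suc p. zact ((-1) ^ i) (\<phi> (singular_face (Suc p) i (front_face (Suc p) f))))
      (\<psi> (back_face (Suc p) q f)) +
    zact ((-1) ^ p) (\<beta> (\<phi> (front_face p f))
      (\<Sum>j\<le>Suc q. zact ((-1) ^ j) (\<psi> (singular_face (Suc q) j (back_face p (Suc q) f)))))"
    (is "sum ?t _ = ?A + ?B")
proof -
  let ?a = "\<lambda>i. zact ((-1) ^ i) (\<beta> (\<phi> (singular_face (Suc p) i (front_face (Suc p) f)))
    (\<psi> (back_face (Suc p) q f)))"
  let ?b = "\<lambda>j. zact ((-1) ^ (p + j)) (\<beta> (\<phi> (front_face p f))
    (\<psi> (singular_face (Suc q) j (back_face p (Suc q) f))))"
  have A: "?A = sum ?a {..Suc p}"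
    using biadditive_left[OF assms]
    by (subst additive.sum[OF biadditive_left[OF assms]])
      (simp add: additive_zact[OF biadditive_left[OF assms]] comp_def)
  have B: "?B = sum ?b {..Suc q}"
    by (simp add: additive.sum[OF biadditive_right[OF assms]] zact_sum_right zact_zact power_add
        additive_zact[OF biadditive_right[OF assms]] del: sum.atMost_Suc)
  have "sum ?t {..Suc (p + q)} = sum ?t {..p} + sum ?t {Suc p..Suc (p + q)}"
    using sum.ub_add_nat[of 0 p ?t "Suc q"] by (simp add: atMost_atLeast0)
  also have "sum ?t {..p} = sum ?a {..p}"
    by (rule sum.cong) (simp_all add: front_face_of_face back_face_of_face_le)
  also have "sum ?t {Suc p..Suc (p + q)} = sum ?b {Suc 0..Suc q}"
  proof -
    have "sum ?t {Suc p..Suc (p + q)} = (\<Sum>j\<in>{Suc 0..Suc q}. ?t (p + j))"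
      by (rule sum.reindex_bij_witness[where i = "\<lambda>j. p + j" and j = "\<lambda>i. i - p"]) auto
    also have "\<dots> = sum ?b {Suc 0..Suc q}"
      by (rule sum.cong) (simp_all add: front_face_of_face_ge back_face_of_face_ge)
    finally show ?thesis .
  qed
  also have "sum ?a {..p} = ?A - ?a (Suc p)"
    unfolding A by simp
  also have "sum ?b {Suc 0..Suc q} = ?B - ?b 0"
    unfolding B by (simp add: atMost_atLeast0 sum.atLeast_Suc_atMost)
  \<comment> \<open>Both are the product of the front p-face with the last q-face, with signs
    (-1)^(p+1) and (-1)^p.\<close>
  also have "?a (Suc p) = - ?b 0"
  proof -
    have "singular_face (Suc p) (Suc p) (front_face (Suc p) f) = front_face p f"
      using front_face_of_face[of "Suc p" p 0 f] front_face_of_face_ge[of p "Suc p" 0 f] by simp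
    moreover have "singular_face (Suc q) 0 (back_face p (Suc q) f) = back_face (Suc p) q f"
      using back_face_of_face_ge[of 0 q p f] back_face_of_face_le[of p p q f] by simp
    ultimately show ?thesis by (simp only: zact_neg_one_Suc add_0_right)
  qed
  finally show ?thesis by simp
qed

lemma cochain_cup_in_cochains: "cochain_cup \<beta> p q X \<phi> \<psi> \<in> cochains (p + q) X"
  by (simp add: cochain_cup_def cochains_def)

lemma cochain_cup_zero_left: "biadditive \<beta> \<Longrightarrow> cochain_cup \<beta> p q X (\<lambda>f. 0) \<psi> = (\<lambda>f. 0)"
  using additive.zero[OF biadditive_left] by (fastforce simp: cochain_cup_def)

lemma cochain_cup_zero_right: "biadditive \<beta> \<Longrightarrow> cochain_cup \<beta> p q X \<phi> (\<lambda>f. 0) = (\<lambda>f. 0)"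
  using additive.zero[OF biadditive_right] by (fastforce simp: cochain_cup_def)

lemma cochain_cup_add_left:
  assumes "biadditive \<beta>"
  shows "cochain_cup \<beta> p q X (\<lambda>f. \<phi> f + \<phi>' f) \<psi> =
    (\<lambda>f. cochain_cup \<beta> p q X \<phi> \<psi> f + cochain_cup \<beta> p q X \<phi>' \<psi> f)"
  by (auto simp: cochain_cup_def additive.add[OF biadditive_left[OF assms]])

lemma cochain_cup_add_right:
  assumes "biadditive \<beta>"
  shows "cochain_cup \<beta> p q X \<phi> (\<lambda>f. \<psi> f + \<psi>' f) =
    (\<lambda>f. cochain_cup \<beta> p q X \<phi> \<psi> f + cochain_cup \<beta> p q X \<phi> \<psi>' f)"
  by (auto simp: cochain_cup_def additive.add[OF biadditive_right[OF assms]])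

lemma coboundary_cup:
  fixes \<phi> :: "('a, 'c::ab_group_add) cochain" and \<psi> :: "('a, 'd::ab_group_add) cochain"
  assumes \<beta>: "biadditive \<beta>" and \<phi>: "\<phi> \<in> cochains p X" and \<psi>: "\<psi> \<in> cochains q X"
  shows "coboundary (p + q) X (cochain_cup \<beta> p q X \<phi> \<psi>) =
    (\<lambda>f. cochain_cup \<beta> (p + 1) q X (coboundary p X \<phi>) \<psi> f +
      zact ((-1) ^ nat p) (cochain_cup \<beta> p (q + 1) X \<phi> (coboundary q X \<psi>) f))"
proof -
  \<comment> \<open>A negative degree can hide in a nonnegative sum p + q, where \<open>nat\<close>
    would misread it as zero. It is settled by one factor being the zero cochain.\<close>
  consider "p < 0" | "q < 0" | "0 \<le> p" "0 \<le> q" by linarith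
  then show ?thesis
  proof cases
    case 1
    then have "\<phi> = (\<lambda>f. 0)" using cochains_neg \<phi> by blast
    then show ?thesis by (simp add: cochain_cup_zero_left[OF \<beta>])
  next
    case 2
    then have "\<psi> = (\<lambda>f. 0)" using cochains_neg \<psi> by blast
    then show ?thesis by (simp add: cochain_cup_zero_right[OF \<beta>])
  next
    case 3
    then obtain a b where ab: "p = int a" "q = int b"
      using nonneg_int_cases by metis
    have nats: "nat (int a + int b + 1) = Suc (a + b)" "nat (int a + 1) = Suc a" "nat (int b + 1) = Suc b"
      "nat (1 + int a) = Suc a" "nat (1 + int b) = Suc b" "nat (1 + (int a + int b)) = Suc (a + b)"
      "nat (int a + int b) = a + b"
      by simp_all
    show ?thesis
    proof
      fix f
      show "coboundary (p + q) X (cochain_cup \<beta> p q X \<phi> \<psi>) f =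
        cochain_cup \<beta> (p + 1) q X (coboundary p X \<phi>) \<psi> f +
          zact ((-1) ^ nat p) (cochain_cup \<beta> p (q + 1) X \<phi> (coboundary q X \<psi>) f)"
      proof (cases "f \<in> sing (p + q + 1) X")
        case True
        then have f: "singular_simplex (Suc (a + b)) X f"
          by (simp add: sing_def ab nats)
        have "front_face (Suc a) f \<in> sing (p + 1) X"
          using singular_simplex_front_face[of "Suc a" b X f] f by (simp add: sing_def ab nats)
        moreover have "back_face a (Suc b) f \<in> sing (q + 1) X"
          using singular_simplex_back_face[of a "Suc b" X f] f by (simp add: sing_def ab nats)
        moreover have "singular_face (Suc (a + b)) i f \<in> sing (p + q) X" if "i \<le> Suc (a + b)" for i
          using singular_face_in_sing[of f "p + q" X i] True that by (simp add: ab nats)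
        ultimately show ?thesis
          using True cup_leibniz_simplex[OF \<beta>, where p = a and q = b and \<phi> = \<phi> and \<psi> = \<psi> and f = f]
          by (simp add: coboundary_def cochain_cup_def ab nats add_ac cong: sum.cong_simp
              del: sum.atMost_Suc)
      next
        case False
        then show ?thesis by (simp add: coboundary_def cochain_cup_def add_ac)
      qed
    qed
  qed
qed

lemma cocycles_cup:
  assumes "biadditive \<beta>" "\<phi> \<in> cocycles p X" "\<psi> \<in> cocycles q X"
  shows "cochain_cup \<beta> p q X \<phi> \<psi> \<in> cocycles (p + q) X"
  using assms coboundary_cup[OF assms(1), of \<phi> p X \<psi> q]
  by (simp add: cocycles_def cochain_cup_in_cochains cochain_cup_zero_left cochain_cup_zero_right)

lemma coboundaries_cup_left:
  assumes \<beta>: "biadditive \<beta>" and "\<phi> \<in> coboundaries p X" "\<psi> \<in> cocycles q X"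
  shows "cochain_cup \<beta> p q X \<phi> \<psi> \<in> coboundaries (p + q) X"
proof -
  obtain \<eta> where \<eta>: "\<eta> \<in> cochains (p - 1) X" "\<phi> = coboundary (p - 1) X \<eta>"
    using assms(2) by (auto simp: coboundaries_def)
  have "coboundary (p - 1 + q) X (cochain_cup \<beta> (p - 1) q X \<eta> \<psi>) = cochain_cup \<beta> p q X \<phi> \<psi>"
    using coboundary_cup[OF \<beta> \<eta>(1), of \<psi> q] assms(3)
    by (simp add: cocycles_def \<eta>(2) cochain_cup_zero_right[OF \<beta>])
  moreover have "p - 1 + q = p + q - 1" by simp
  ultimately show ?thesis
    unfolding coboundaries_def by (metis cochain_cup_in_cochains image_eqI)
qed

lemma coboundaries_cup_right:
  assumes \<beta>: "biadditive \<beta>" and "\<phi> \<in> cocycles p X" "\<psi> \<in> coboundaries q X"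
  shows "cochain_cup \<beta> p q X \<phi> \<psi> \<in> coboundaries (p + q) X"
proof -
  obtain \<eta> where \<eta>: "\<eta> \<in> cochains (q - 1) X" "\<psi> = coboundary (q - 1) X \<eta>"
    using assms(3) by (auto simp: coboundaries_def)
  let ?c = "cochain_cup \<beta> p q X \<phi> \<psi>" and ?s = "(-1) ^ nat p :: int"
  \<comment> \<open>Only the sign times the cup product is visibly a coboundary; multiplying by the
    sign once more removes it.\<close>
  have "coboundary (p + (q - 1)) X (cochain_cup \<beta> p (q - 1) X \<phi> \<eta>) = zact ?s \<circ> ?c"
    using coboundary_cup[OF \<beta> _ \<eta>(1), of \<phi> p] assms(2)
    by (auto simp: cocycles_def \<eta>(2) cochain_cup_zero_left[OF \<beta>])
  moreover have "p + (q - 1) = p + q - 1" by simp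
  ultimately have "zact ?s \<circ> ?c \<in> coboundaries (p + q) X"
    unfolding coboundaries_def by (metis cochain_cup_in_cochains image_eqI)
  from coboundaries_comp[OF additive_zact_fun[of ?s] this]
  have "zact ?s \<circ> (zact ?s \<circ> ?c) \<in> coboundaries (p + q) X" .
  moreover have "zact ?s \<circ> (zact ?s \<circ> ?c) = ?c"
    by (auto simp: zact_zact simp flip: power_add power_mult_distrib)
  ultimately show ?thesis by simp
qed

lemma coh_cup_class:
  assumes \<beta>: "biadditive \<beta>" and \<phi>: "\<phi> \<in> cocycles p X" and \<psi>: "\<psi> \<in> cocycles q X"
  shows "coh_cup \<beta> p q X (coh_class p X \<phi>) (coh_class q X \<psi>) =
    coh_class (p + q) X (cochain_cup \<beta> p q X \<phi> \<psi>)"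
  unfolding coh_cup_def cochain_cup_def[symmetric]
proof (rule descend2_eqI[OF coh_class_self coh_class_self])
  fix \<phi>' \<psi>' assume "\<phi>' \<in> coh_class p X \<phi>" "\<psi>' \<in> coh_class q X \<psi>"
  then obtain a b where a: "a \<in> coboundaries p X" "\<phi>' = (\<lambda>f. a f + \<phi> f)"
    and b: "b \<in> coboundaries q X" "\<psi>' = (\<lambda>f. b f + \<psi> f)"
    by (auto simp: coh_class_mem)
  \<comment> \<open>The factors are changed one at a time: the left one against \<psi>', which must
    therefore be a cocycle too, then the right one against \<phi>.\<close>
  have \<psi>': "\<psi>' \<in> cocycles q X"
    unfolding b(2) using b(1) coboundaries_subset_cocycles by (intro cocycles_add \<psi>) blast
  have "cochain_cup \<beta> p q X \<phi>' \<psi>' = (\<lambda>f. cochain_cup \<beta> p q X a \<psi>' f + cochain_cup \<beta> p q X \<phi> \<psi>' f)"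
    by (simp add: a cochain_cup_add_left[OF \<beta>])
  then have "coh_class (p + q) X (cochain_cup \<beta> p q X \<phi>' \<psi>') =
      coh_class (p + q) X (cochain_cup \<beta> p q X \<phi> \<psi>')"
    using coh_class_add_coboundary[OF cocycles_cup[OF \<beta> \<phi> \<psi>'] coboundaries_cup_left[OF \<beta> a(1) \<psi>']]
    by simp
  also have "cochain_cup \<beta> p q X \<phi> \<psi>' = (\<lambda>f. cochain_cup \<beta> p q X \<phi> b f + cochain_cup \<beta> p q X \<phi> \<psi> f)"
    by (simp add: b cochain_cup_add_right[OF \<beta>])
  then have "coh_class (p + q) X (cochain_cup \<beta> p q X \<phi> \<psi>') = coh_class (p + q) X (cochain_cup \<beta> p q X \<phi> \<psi>)"
    using coh_class_add_coboundary[OF cocycles_cup[OF \<beta> \<phi> \<psi>] coboundaries_cup_right[OF \<beta> \<phi> b(1)]]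
    by simp
  finally show "coh_class (p + q) X (cochain_cup \<beta> p q X \<phi>' \<psi>') =
      coh_class (p + q) X (cochain_cup \<beta> p q X \<phi> \<psi>)" .
qed

section \<open>Evaluation of cohomology classes on homology classes\<close>

lemma chain_eval_coboundary_cycle:
  assumes "b \<in> coboundaries (int n) X" "singular_relcycle n X {} c"
  shows "chain_eval b c = 0"
proof -
  obtain \<eta> where \<eta>: "\<eta> \<in> cochains (int n - 1) X" "b = coboundary (int n - 1) X \<eta>"
    using assms(1) by (auto simp: coboundaries_def)
  then show ?thesis
    using chain_eval_coboundary[OF \<eta>(1), of c] assms(2) by (simp add: singular_cycle)
qed

lemma chain_eval_cocycle_boundary:
  assumes "\<phi> \<in> cocycles (int n) X" "singular_relboundary n X {} c"
  shows "chain_eval \<phi> c = 0"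
proof -
  obtain d where d: "singular_chain (Suc n) X d" "c = chain_boundary (Suc n) d"
    using assms(2) by (auto simp: singular_boundary)
  have n: "nat (int n + 1) = Suc n" by simp
  show ?thesis
    using chain_eval_coboundary[of \<phi> "int n" X d] assms(1) d by (simp add: n cocycles_def)
qed

lemma homology_group_mem:
  assumes "\<sigma> \<in> carrier (homology_group (int n) X)" "c \<in> \<sigma>" "d \<in> \<sigma>"
  shows "singular_relcycle n X {} c \<and> singular_relboundary n X {} (d - c)"
proof -
  obtain c0 where c0: "singular_relcycle n X {} c0" "\<sigma> = homologous_rel_set n X {} c0"
    using assms(1) by (auto simp: carrier_relative_homology_group)
  have b: "singular_relboundary n X {} (c0 - c)" "singular_relboundary n X {} (c0 - d)"
    using assms c0 by (auto simp: homologous_rel_def)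
  have "singular_relcycle n X {} (c0 - (c0 - c))"
    by (intro singular_relcycle_diff c0(1) singular_relboundary_imp_relcycle b(1))
  moreover have "singular_relboundary n X {} ((c0 - c) - (c0 - d))"
    by (intro singular_relboundary_diff b)
  ultimately show ?thesis by simp
qed

text \<open>Stokes' formula enters twice: a coboundary vanishes on cycles and a cocycle vanishes on
  boundaries, so neither choice of representative matters.\<close>

lemma coh_eval_class:
  assumes \<phi>: "\<phi> \<in> cocycles (int n) X" and \<sigma>: "\<sigma> \<in> carrier (homology_group (int n) X)" and c: "c \<in> \<sigma>"
  shows "coh_eval (coh_class (int n) X \<phi>) \<sigma> = chain_eval \<phi> c"
  unfolding coh_eval_def chain_eval_def[symmetric]
proof (rule descend2_eqI[OF coh_class_self c])
  fix \<psi> d assume "\<psi> \<in> coh_class (int n) X \<phi>" "d \<in> \<sigma>"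
  then obtain b where b: "b \<in> coboundaries (int n) X" "\<psi> = (\<lambda>f. b f + \<phi> f)"
    by (auto simp: coh_class_mem)
  have d: "singular_relcycle n X {} d" "singular_relboundary n X {} (d - c)"
    using homology_group_mem[OF \<sigma> c \<open>d \<in> \<sigma>\<close>] homology_group_mem[OF \<sigma> \<open>d \<in> \<sigma>\<close> \<open>d \<in> \<sigma>\<close>] by auto
  have "chain_eval \<psi> d = chain_eval \<phi> d"
    using chain_eval_coboundary_cycle[OF b(1) d(1)] by (simp add: b chain_eval_plus_fun)
  also have "\<dots> = chain_eval \<phi> (d - c) + chain_eval \<phi> c"
    by (simp flip: chain_eval_add)
  also have "\<dots> = chain_eval \<phi> c"
    using chain_eval_cocycle_boundary[OF \<phi> d(2)] by simp
  finally show "chain_eval \<psi> d = chain_eval \<phi> c" .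
qed

section \<open>Free cohomology and pairings\<close>

lemma comm_group_coh_Z: "comm_group (coh_Z p X)"
  unfolding coh_Z_def by (rule comm_group_cohomology)

lemma comm_group_coh_R: "comm_group (coh_R p X)"
  unfolding coh_R_def by (rule comm_group_cohomology)

lemma (in comm_group) subgroup_torsion_part: "subgroup (torsion_part G) G"
proof
  show "x \<otimes> y \<in> torsion_part G" if xy: "x \<in> torsion_part G" "y \<in> torsion_part G" for x y
  proof -
    obtain m n :: nat where mn: "0 < m" "x [^] m = \<one>" "0 < n" "y [^] n = \<one>"
      using xy by (auto simp: torsion_part_def)
    have c: "x \<in> carrier G" "y \<in> carrier G"
      using xy by (auto simp: torsion_part_def)
    have "(x \<otimes> y) [^] (m * n) = (x [^] m) [^] n \<otimes> (y [^] n) [^] m"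
      using c by (simp add: nat_pow_distrib nat_pow_pow mult.commute)
    then have "(x \<otimes> y) [^] (m * n) = \<one>" by (simp add: mn)
    moreover have "0 < m * n" using mn by simp
    ultimately show ?thesis
      using c unfolding torsion_part_def by (intro CollectI conjI exI[of _ "m * n"]) simp_all
  qed
  show "inv x \<in> torsion_part G" if "x \<in> torsion_part G" for x
    using that by (auto simp: torsion_part_def nat_pow_inv intro!: exI)
  show "\<one> \<in> torsion_part G"
    by (auto simp: torsion_part_def intro!: exI[of _ 1])
qed (auto simp: torsion_part_def)

lemma comm_group_coh_free: "comm_group (coh_free p X)"
  unfolding coh_free_def
  by (intro comm_group.abelian_FactGroup comm_group.subgroup_torsion_part comm_group_coh_Z)

definition free_class :: "int \<Rightarrow> 'a topology \<Rightarrow> ('a, int) cochain \<Rightarrow> 'a free_class" where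
  "free_class p X \<psi> = torsion_part (coh_Z p X) #>\<^bsub>coh_Z p X\<^esub> coh_class p X \<psi>"

lemma carrier_coh_free: "carrier (coh_free p X) = free_class p X ` cocycles p X"
  by (auto simp: coh_free_def carrier_FactGroup free_class_def coh_Z_def carrier_cohomology_group)

lemma free_class_mult:
  assumes "\<phi> \<in> cocycles p X" "\<psi> \<in> cocycles p X"
  shows "free_class p X \<phi> \<otimes>\<^bsub>coh_free p X\<^esub> free_class p X \<psi> = free_class p X (\<lambda>f. \<phi> f + \<psi> f)"
proof -
  interpret comm_group "coh_Z p X" by (rule comm_group_coh_Z)
  interpret normal "torsion_part (coh_Z p X)" "coh_Z p X"
    by (rule subgroup_imp_normal[OF subgroup_torsion_part])
  show ?thesis
    using rcos_sum[of "coh_class p X \<phi>" "coh_class p X \<psi>"] mult_cohomology_group[OF assms] assms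
    by (simp add: coh_free_def free_class_def coh_Z_def carrier_cohomology_group)
qed

lemma free_class_self:
  assumes "\<psi> \<in> cocycles p X"
  shows "coh_class p X \<psi> \<in> free_class p X \<psi>"
proof -
  interpret comm_group "coh_Z p X" by (rule comm_group_coh_Z)
  show ?thesis
    unfolding free_class_def
    by (rule rcos_self[OF _ subgroup_torsion_part])
      (use assms in \<open>auto simp: coh_Z_def carrier_cohomology_group\<close>)
qed

text \<open>A torsion class vanishes over the reals: if \<open>n\<close> times a cocycle is the coboundary of \<open>\<eta>\<close>, then the
  cocycle is the coboundary of \<open>\<eta> / n\<close>.\<close>

lemma free_class_memE:
  assumes y: "y \<in> free_class p X \<psi>" and \<psi>: "\<psi> \<in> cocycles p X"
  obtains \<tau> where "\<tau> \<in> cocycles p X" "(of_int :: int \<Rightarrow> real) \<circ> \<tau> \<in> coboundaries p X"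
    "y = coh_class p X (\<lambda>f. \<tau> f + \<psi> f)"
proof -
  obtain t where t: "t \<in> torsion_part (coh_Z p X)" "y = t \<otimes>\<^bsub>coh_Z p X\<^esub> coh_class p X \<psi>"
    using y by (auto simp: free_class_def r_coset_def)
  obtain n :: nat where n: "0 < n" "t [^]\<^bsub>coh_Z p X\<^esub> n = \<one>\<^bsub>coh_Z p X\<^esub>"
    using t by (auto simp: torsion_part_def)
  obtain \<tau> where \<tau>: "\<tau> \<in> cocycles p X" "t = coh_class p X \<tau>"
    using t by (auto simp: torsion_part_def coh_Z_def carrier_cohomology_group)
  have "zact (int n) \<circ> \<tau> \<in> coboundaries p X"
    using n(2) coh_class_eq_one_iff[OF cocycles_comp[OF additive_zact_fun \<tau>(1)], of "int n"]
    by (simp add: coh_Z_def \<tau>(2) pow_cohomology_group[OF \<tau>(1)])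
  from coboundaries_comp[OF additive_of_int this]
  have "(of_int :: int \<Rightarrow> real) \<circ> (zact (int n) \<circ> \<tau>) \<in> coboundaries p X" .
  moreover have "Modules.additive (\<lambda>x :: real. x / real n)"
    by (rule additive.intro) (simp add: add_divide_distrib)
  ultimately have "(\<lambda>x. x / real n) \<circ> (of_int \<circ> (zact (int n) \<circ> \<tau>)) \<in> coboundaries p X"
    by (rule coboundaries_comp[rotated])
  moreover have "(\<lambda>x. x / real n) \<circ> (of_int \<circ> (zact (int n) \<circ> \<tau>)) = of_int \<circ> \<tau>"
    using n(1) by (auto simp: fun_eq_iff)
  moreover have "y = coh_class p X (\<lambda>f. \<tau> f + \<psi> f)"
    using mult_cohomology_group[OF \<tau>(1) \<psi>] by (simp add: t(2) \<tau>(2) coh_Z_def)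
  ultimately show ?thesis using that \<tau>(1) by simp
qed

lemma of_int_cocycle: "\<psi> \<in> cocycles p X \<Longrightarrow> (of_int :: int \<Rightarrow> real) \<circ> \<psi> \<in> cocycles p X"
  by (rule cocycles_comp[OF additive_of_int])

lemma free_to_real_class:
  assumes "\<psi> \<in> cocycles p X"
  shows "free_to_real p X (free_class p X \<psi>) = coh_class p X (of_int \<circ> \<psi>)"
  unfolding free_to_real_def
proof (rule descend_eqI[OF free_class_self[OF assms]])
  fix y assume "y \<in> free_class p X \<psi>"
  then obtain \<tau> where \<tau>: "\<tau> \<in> cocycles p X" "(of_int :: int \<Rightarrow> real) \<circ> \<tau> \<in> coboundaries p X"
    "y = coh_class p X (\<lambda>f. \<tau> f + \<psi> f)"
    using assms by (rule free_class_memE)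
  have "coh_coeff p X of_int y = coh_class p X ((of_int :: int \<Rightarrow> real) \<circ> (\<lambda>f. \<tau> f + \<psi> f))"
    unfolding \<tau>(3) by (rule coh_coeff_class[OF additive_of_int cocycles_add[OF \<tau>(1) assms]])
  also have "(of_int :: int \<Rightarrow> real) \<circ> (\<lambda>f. \<tau> f + \<psi> f) = (\<lambda>f. (of_int \<circ> \<tau>) f + (of_int \<circ> \<psi>) f)"
    by auto
  finally show "coh_coeff p X of_int y = coh_class p X ((of_int :: int \<Rightarrow> real) \<circ> \<psi>)"
    using coh_class_add_coboundary[OF of_int_cocycle[OF assms] \<tau>(2)] by simp
qed

section \<open>The integral lattice in real cohomology and the quotient by it\<close>

lemma lattice_eq: "lattice p X = (\<lambda>\<psi>. coh_class p X (of_int \<circ> \<psi>)) ` cocycles p X"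
  unfolding lattice_def carrier_coh_free image_image by (simp add: free_to_real_class cong: image_cong)

lemma subgroup_lattice: "subgroup (lattice p X) (coh_R p X)"
proof -
  interpret comm_group "coh_R p X" by (rule comm_group_coh_R)
  show ?thesis
  proof (rule subgroupI)
    show "lattice p X \<subseteq> carrier (coh_R p X)"
      by (auto simp: lattice_eq coh_R_def carrier_cohomology_group of_int_cocycle)
    show "lattice p X \<noteq> {}"
      unfolding lattice_eq image_is_empty using zero_in_cocycles by blast
    fix a assume "a \<in> lattice p X"
    then obtain \<psi> where \<psi>: "\<psi> \<in> cocycles p X" "a = coh_class p X (of_int \<circ> \<psi>)"
      by (auto simp: lattice_eq)
    let ?n = "uminus \<circ> \<psi>"
    have n: "?n \<in> cocycles p X" by (rule cocycles_comp[OF additive_uminus \<psi>(1)])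
    have "coh_class p X (of_int \<circ> ?n) \<otimes>\<^bsub>coh_R p X\<^esub> a = \<one>\<^bsub>coh_R p X\<^esub>"
      unfolding \<psi>(2) coh_R_def mult_cohomology_group[OF of_int_cocycle[OF n] of_int_cocycle[OF \<psi>(1)]]
      by (simp add: one_cohomology_group)
    then have "inv\<^bsub>coh_R p X\<^esub> a = coh_class p X (of_int \<circ> ?n)"
      by (rule inv_equality)
        (use n \<psi> in \<open>auto simp: coh_R_def carrier_cohomology_group of_int_cocycle\<close>)
    then show "inv\<^bsub>coh_R p X\<^esub> a \<in> lattice p X"
      using n by (auto simp: lattice_eq)
    fix b assume "b \<in> lattice p X"
    then obtain \<xi> where \<xi>: "\<xi> \<in> cocycles p X" "b = coh_class p X (of_int \<circ> \<xi>)"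
      by (auto simp: lattice_eq)
    have "a \<otimes>\<^bsub>coh_R p X\<^esub> b = coh_class p X (of_int \<circ> (\<lambda>f. \<psi> f + \<xi> f))"
      unfolding \<psi>(2) \<xi>(2) coh_R_def
        mult_cohomology_group[OF of_int_cocycle[OF \<psi>(1)] of_int_cocycle[OF \<xi>(1)]]
      by (simp add: comp_def)
    then show "a \<otimes>\<^bsub>coh_R p X\<^esub> b \<in> lattice p X"
      using cocycles_add[OF \<psi>(1) \<xi>(1)] by (auto simp: lattice_eq)
  qed
qed

lemma comm_group_coh_Rquot: "comm_group (coh_Rquot p X)"
  unfolding coh_Rquot_def
  by (intro comm_group.abelian_FactGroup comm_group_coh_R subgroup_lattice)

definition rquot_class :: "int \<Rightarrow> 'a topology \<Rightarrow> ('a, real) cochain \<Rightarrow> 'a rquot_class" where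
  "rquot_class p X \<phi> = lattice p X #>\<^bsub>coh_R p X\<^esub> coh_class p X \<phi>"

lemma carrier_coh_Rquot: "carrier (coh_Rquot p X) = rquot_class p X ` cocycles p X"
  by (auto simp: coh_Rquot_def carrier_FactGroup rquot_class_def coh_R_def carrier_cohomology_group)

lemma rquot_class_mult:
  assumes "\<phi> \<in> cocycles p X" "\<psi> \<in> cocycles p X"
  shows "rquot_class p X \<phi> \<otimes>\<^bsub>coh_Rquot p X\<^esub> rquot_class p X \<psi> = rquot_class p X (\<lambda>f. \<phi> f + \<psi> f)"
proof -
  interpret comm_group "coh_R p X" by (rule comm_group_coh_R)
  interpret normal "lattice p X" "coh_R p X"
    by (rule subgroup_imp_normal[OF subgroup_lattice])
  show ?thesis
    using rcos_sum[of "coh_class p X \<phi>" "coh_class p X \<psi>"] mult_cohomology_group[OF assms] assms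
    by (simp add: coh_Rquot_def rquot_class_def coh_R_def carrier_cohomology_group)
qed

lemma rquot_class_self:
  assumes "\<phi> \<in> cocycles p X"
  shows "coh_class p X \<phi> \<in> rquot_class p X \<phi>"
proof -
  interpret comm_group "coh_R p X" by (rule comm_group_coh_R)
  show ?thesis
    unfolding rquot_class_def
    by (rule rcos_self[OF _ subgroup_lattice])
      (use assms in \<open>auto simp: coh_R_def carrier_cohomology_group\<close>)
qed

lemma rquot_class_memE:
  assumes "\<rho> \<in> rquot_class p X \<phi>" "\<phi> \<in> cocycles p X"
  obtains \<psi> where "\<psi> \<in> cocycles p X" "\<rho> = coh_class p X (\<lambda>f. of_int (\<psi> f) + \<phi> f)"
proof -
  obtain \<psi> where \<psi>: "\<psi> \<in> cocycles p X"
      "\<rho> = coh_class p X (of_int \<circ> \<psi>) \<otimes>\<^bsub>coh_R p X\<^esub> coh_class p X \<phi>"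
    using assms by (auto simp: rquot_class_def r_coset_def lattice_eq)
  have "\<rho> = coh_class p X (\<lambda>f. of_int (\<psi> f) + \<phi> f)"
    unfolding \<psi>(2) coh_R_def mult_cohomology_group[OF of_int_cocycle[OF \<psi>(1)] assms(2)] by simp
  with \<psi>(1) show ?thesis by (rule that)
qed

lemma rquot_class_add_integral:
  assumes "\<phi> \<in> cocycles p X" "\<psi> \<in> cocycles p X"
  shows "rquot_class p X (\<lambda>f. of_int (\<psi> f) + \<phi> f) = rquot_class p X \<phi>"
proof -
  interpret comm_group "coh_R p X" by (rule comm_group_coh_R)
  have "coh_class p X (\<lambda>f. of_int (\<psi> f) + \<phi> f) = coh_class p X (of_int \<circ> \<psi>) \<otimes>\<^bsub>coh_R p X\<^esub> coh_class p X \<phi>"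
    unfolding coh_R_def mult_cohomology_group[OF of_int_cocycle[OF assms(2)] assms(1)] by simp
  then have "coh_class p X (\<lambda>f. of_int (\<psi> f) + \<phi> f) \<in> rquot_class p X \<phi>"
    using assms(2) by (auto simp: rquot_class_def r_coset_def lattice_eq)
  then show ?thesis
    using repr_independence[OF _ _ subgroup_lattice] assms(1)
    by (auto simp: rquot_class_def coh_R_def carrier_cohomology_group)
qed

lemma rquot_pullback_class:
  assumes "\<phi> \<in> cocycles p X"
  shows "rquot_pullback p (subtopology X S) id (rquot_class p X \<phi>) =
    rquot_class p (subtopology X S) (cochain_restrict p (subtopology X S) \<phi>)"
  unfolding rquot_pullback_def
proof (rule descend_eqI[OF rquot_class_self[OF assms]])
  let ?Y = "subtopology X S"
  fix \<rho> assume "\<rho> \<in> rquot_class p X \<phi>"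
  then obtain \<psi> where \<psi>: "\<psi> \<in> cocycles p X" "\<rho> = coh_class p X (\<lambda>f. of_int (\<psi> f) + \<phi> f)"
    using assms by (rule rquot_class_memE)
  have c: "(\<lambda>f. of_int (\<psi> f) + \<phi> f) \<in> cocycles p X"
    using cocycles_add[OF of_int_cocycle[OF \<psi>(1)] assms] by simp
  have "cochain_restrict p ?Y (\<lambda>f. of_int (\<psi> f) + \<phi> f) =
      (\<lambda>f. of_int (cochain_restrict p ?Y \<psi> f) + cochain_restrict p ?Y \<phi> f)"
    by (auto simp: cochain_restrict_def)
  then show "lattice p ?Y #>\<^bsub>coh_R p ?Y\<^esub> coh_pullback p ?Y id \<rho> =
      rquot_class p ?Y (cochain_restrict p ?Y \<phi>)"
    using rquot_class_add_integral[OF cocycles_restrict[OF assms, of S] cocycles_restrict[OF \<psi>(1), of S]]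
    by (simp add: \<psi>(2) coh_pullback_class[OF c] rquot_class_def)
qed

text \<open>Up to coboundaries, representatives differ by an integer cocycle, which the reduction
  modulo the integers kills already on cochains.\<close>

lemma mu_class:
  assumes "\<phi> \<in> cocycles p X"
  shows "mu p X (rquot_class p X \<phi>) = coh_class p X (to_circle \<circ> \<phi>)"
  unfolding mu_def
proof (rule descend_eqI[OF rquot_class_self[OF assms]])
  fix \<rho> assume "\<rho> \<in> rquot_class p X \<phi>"
  then obtain \<psi> where \<psi>: "\<psi> \<in> cocycles p X" "\<rho> = coh_class p X (\<lambda>f. of_int (\<psi> f) + \<phi> f)"
    using assms by (rule rquot_class_memE)
  have c: "(\<lambda>f. of_int (\<psi> f) + \<phi> f) \<in> cocycles p X"
    using cocycles_add[OF of_int_cocycle[OF \<psi>(1)] assms] by simp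
  have "to_circle \<circ> (\<lambda>f. of_int (\<psi> f) + \<phi> f) = to_circle \<circ> \<phi>"
    by (auto simp: additive.add[OF additive_to_circle])
  then show "coh_coeff p X to_circle \<rho> = coh_class p X (to_circle \<circ> \<phi>)"
    unfolding \<psi>(2) by (simp add: coh_coeff_class[OF additive_to_circle c])
qed

text \<open>The bridge between the two pairings, valid on cochains: when the circle-valued factor
  has a real lift, its product with an integral cochain can be computed in the reals and reduced
  afterwards.\<close>

lemma cup_zact_to_circle:
  "cochain_cup (\<lambda>t n. zact n t) p q X (to_circle \<circ> \<phi>) \<psi> = to_circle \<circ> cochain_cup (*) p q X \<phi> (of_int \<circ> \<psi>)"
proof -
  have "zact n (to_circle x) = to_circle (x * of_int n)" for n x
    using additive_zact[OF additive_to_circle, of n x] by (simp add: mult.commute)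
  moreover have "to_circle 0 = 0"
    using additive.zero[OF additive_to_circle] by simp
  ultimately show ?thesis by (auto simp: cochain_cup_def)
qed

section \<open>Circle-valued and real pairings over the hypersurface\<close>

locale hypersurface_class =
  fixes X :: "'a topology" and S :: "'a set" and \<sigma> :: "'a chain set" and n :: nat
  assumes fund: "\<sigma> \<in> carrier (homology_group (int n) (subtopology X S))"
begin

text \<open>One cycle is fixed once and for all, so that evaluation becomes a linear functional of
  the cochain.\<close>

definition rep :: "'a chain" where "rep = (SOME c. c \<in> \<sigma>)"

lemma rep: "rep \<in> \<sigma>"
proof -
  obtain c where "\<sigma> = homologous_rel_set n (subtopology X S) {} c"
    using fund by (auto simp: carrier_relative_homology_group)
  then have "c \<in> \<sigma>" by simp
  then have "\<sigma> \<noteq> {}" by blast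
  then show ?thesis unfolding rep_def by (simp add: some_in_eq)
qed

lemma rep_cycle: "singular_relcycle n (subtopology X S) {} rep"
  using homology_group_mem[OF fund rep rep] by simp

text \<open>A single real number serves both pairings: it equals \<open>real_pairing\<close>, and
  its reduction modulo the integers is \<open>pairing\<close>. Biadditivity is thus checked once, on
  cochains.\<close>

definition integral_cup :: "int \<Rightarrow> int \<Rightarrow> ('a, real) cochain \<Rightarrow> ('a, int) cochain \<Rightarrow> real" where
  "integral_cup p q \<phi> \<psi> = chain_eval (cochain_cup (*) p q (subtopology X S)
     (cochain_restrict p (subtopology X S) \<phi>)
     (of_int \<circ> cochain_restrict q (subtopology X S) \<psi>)) rep"

lemma integral_cup_add_left:
  "integral_cup p q (\<lambda>f. \<phi> f + \<phi>' f) \<psi> = integral_cup p q \<phi> \<psi> + integral_cup p q \<phi>' \<psi>"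
  by (simp add: integral_cup_def cochain_restrict_add cochain_cup_add_left[OF biadditive_times]
      chain_eval_plus_fun)

lemma integral_cup_add_right:
  "integral_cup p q \<phi> (\<lambda>f. \<psi> f + \<psi>' f) = integral_cup p q \<phi> \<psi> + integral_cup p q \<phi> \<psi>'"
proof -
  have "of_int \<circ> (\<lambda>f. a f + b f) = (\<lambda>f. (of_int \<circ> a) f + (of_int \<circ> b) f :: real)" for a b :: "('a, int) cochain"
    by auto
  then show ?thesis
    by (simp only: integral_cup_def cochain_restrict_add cochain_cup_add_right[OF biadditive_times]
      chain_eval_plus_fun)
qed

text \<open>The delicate point is the choice of an integral class over the free one. A torsion class
  may pair nontrivially with a general circle-valued class; here the left factor lifts to a real
  cocycle, whose product with a torsion cocycle is a real coboundary.\<close>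

lemma pairing_class:
  assumes \<phi>: "\<phi> \<in> cocycles p X" and \<psi>: "\<psi> \<in> cocycles q X" and pq: "p + q = int n"
  shows "pairing X S \<sigma> p q (rquot_class p X \<phi>) (free_class q X \<psi>) = to_circle (integral_cup p q \<phi> \<psi>)"
  unfolding pairing_def Let_def
proof (rule descend_eqI[OF free_class_self[OF \<psi>]])
  let ?Y = "subtopology X S"
  fix y assume "y \<in> free_class q X \<psi>"
  then obtain \<tau> where \<tau>: "\<tau> \<in> cocycles q X" "(of_int :: int \<Rightarrow> real) \<circ> \<tau> \<in> coboundaries q X"
    "y = coh_class q X (\<lambda>f. \<tau> f + \<psi> f)"
    using \<psi> by (rule free_class_memE)
  have c: "(\<lambda>f. \<tau> f + \<psi> f) \<in> cocycles q X" by (rule cocycles_add[OF \<tau>(1) \<psi>])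
  have \<phi>': "to_circle \<circ> cochain_restrict p ?Y \<phi> \<in> cocycles p ?Y"
    by (intro cocycles_comp[OF additive_to_circle] cocycles_restrict \<phi>)
  have cup: "cochain_cup (\<lambda>t n. zact n t) p q ?Y (to_circle \<circ> cochain_restrict p ?Y \<phi>)
      (cochain_restrict q ?Y (\<lambda>f. \<tau> f + \<psi> f)) \<in> cocycles (int n) ?Y"
    using cocycles_cup[OF biadditive_zact \<phi>' cocycles_restrict[OF c]] by (simp add: pq)
  have "coh_eval (coh_cup (\<lambda>t n. zact n t) p q ?Y
       (mu p ?Y (rquot_pullback p ?Y id (rquot_class p X \<phi>))) (coh_pullback q ?Y id y)) \<sigma> =
     chain_eval (cochain_cup (\<lambda>t n. zact n t) p q ?Y (to_circle \<circ> cochain_restrict p ?Y \<phi>)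
      (cochain_restrict q ?Y (\<lambda>f. \<tau> f + \<psi> f))) rep"
    using coh_eval_class[OF cup fund rep]
    by (simp add: \<tau>(3) rquot_pullback_class[OF \<phi>] mu_class[OF cocycles_restrict[OF \<phi>]]
        coh_pullback_class[OF c] coh_cup_class[OF biadditive_zact \<phi>' cocycles_restrict[OF c]] pq)
  also have "\<dots> = to_circle (integral_cup p q \<phi> (\<lambda>f. \<tau> f + \<psi> f))"
    unfolding cup_zact_to_circle integral_cup_def by (rule chain_eval_comp[OF additive_to_circle])
  also have "integral_cup p q \<phi> (\<lambda>f. \<tau> f + \<psi> f) = integral_cup p q \<phi> \<psi>"
  proof -
    have "(of_int :: int \<Rightarrow> real) \<circ> cochain_restrict q ?Y \<tau> \<in> coboundaries q ?Y"
      using coboundaries_restrict[OF \<tau>(2), of S]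
      by (simp add: cochain_restrict_comp[OF additive_of_int])
    from coboundaries_cup_right[OF biadditive_times cocycles_restrict[OF \<phi>] this]
    have "integral_cup p q \<phi> \<tau> = 0"
      unfolding integral_cup_def
      by (intro chain_eval_coboundary_cycle[OF _ rep_cycle]) (simp add: pq)
    then show ?thesis by (simp add: integral_cup_add_right)
  qed
  finally show "coh_eval (coh_cup (\<lambda>t n. zact n t) p q ?Y
       (mu p ?Y (rquot_pullback p ?Y id (rquot_class p X \<phi>))) (coh_pullback q ?Y id y)) \<sigma> =
     to_circle (integral_cup p q \<phi> \<psi>)" .
qed

lemma real_pairing_class:
  assumes \<phi>: "\<phi> \<in> cocycles p X" and \<psi>: "\<psi> \<in> cocycles q X" and pq: "p + q = int n"
  shows "real_pairing X S \<sigma> p q (coh_class p X \<phi>) (free_class q X \<psi>) = integral_cup p q \<phi> \<psi>"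
proof -
  let ?Y = "subtopology X S"
  note c = cocycles_restrict[OF \<phi>, of S]
    cocycles_restrict[OF of_int_cocycle[OF \<psi>], of S, unfolded cochain_restrict_comp[OF additive_of_int]]
  have "cochain_cup (*) p q ?Y (cochain_restrict p ?Y \<phi>) (of_int \<circ> cochain_restrict q ?Y \<psi>)
      \<in> cocycles (int n) ?Y"
    using cocycles_cup[OF biadditive_times c] by (simp add: pq)
  from coh_eval_class[OF this fund rep] show ?thesis
    by (simp add: real_pairing_def Let_def free_to_real_class[OF \<psi>] coh_pullback_class[OF \<phi>]
        coh_pullback_class[OF of_int_cocycle[OF \<psi>]] coh_cup_class[OF biadditive_times c] pq
        integral_cup_def cochain_restrict_comp[OF additive_of_int])
qed

lemma pairing_mult_left:
  assumes "v \<in> carrier (coh_Rquot p X)" "v' \<in> carrier (coh_Rquot p X)" "w \<in> carrier (coh_free q X)"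
    and pq: "p + q = int n"
  shows "pairing X S \<sigma> p q (v \<otimes>\<^bsub>coh_Rquot p X\<^esub> v') w = pairing X S \<sigma> p q v w + pairing X S \<sigma> p q v' w"
proof -
  obtain \<phi> \<phi>' \<psi> where c: "\<phi> \<in> cocycles p X" "\<phi>' \<in> cocycles p X" "\<psi> \<in> cocycles q X"
    and "v = rquot_class p X \<phi>" "v' = rquot_class p X \<phi>'" "w = free_class q X \<psi>"
    using assms(1-3) unfolding carrier_coh_Rquot carrier_coh_free by blast
  then show ?thesis
    by (simp only: rquot_class_mult[OF c(1,2)] pairing_class[OF c(1,3) pq] pairing_class[OF c(2,3) pq]
        pairing_class[OF cocycles_add[OF c(1,2)] c(3) pq] integral_cup_add_left
        additive.add[OF additive_to_circle])
qed

lemma pairing_mult_right: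
  assumes "v \<in> carrier (coh_Rquot p X)" "w \<in> carrier (coh_free q X)" "w' \<in> carrier (coh_free q X)"
    and pq: "p + q = int n"
  shows "pairing X S \<sigma> p q v (w \<otimes>\<^bsub>coh_free q X\<^esub> w') = pairing X S \<sigma> p q v w + pairing X S \<sigma> p q v w'"
proof -
  obtain \<phi> \<psi> \<psi>' where c: "\<phi> \<in> cocycles p X" "\<psi> \<in> cocycles q X" "\<psi>' \<in> cocycles q X"
    and "v = rquot_class p X \<phi>" "w = free_class q X \<psi>" "w' = free_class q X \<psi>'"
    using assms(1-3) unfolding carrier_coh_Rquot carrier_coh_free by blast
  then show ?thesis
    by (simp only: free_class_mult[OF c(2,3)] pairing_class[OF c(1,2) pq] pairing_class[OF c(1,3) pq]
        pairing_class[OF c(1) cocycles_add[OF c(2,3)] pq] integral_cup_add_right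
        additive.add[OF additive_to_circle])
qed

lemma real_pairing_mult_left:
  assumes "r \<in> carrier (coh_R p X)" "r' \<in> carrier (coh_R p X)" "w \<in> carrier (coh_free q X)"
    and pq: "p + q = int n"
  shows "real_pairing X S \<sigma> p q (r \<otimes>\<^bsub>coh_R p X\<^esub> r') w =
    real_pairing X S \<sigma> p q r w + real_pairing X S \<sigma> p q r' w"
proof -
  obtain \<phi> \<phi>' \<psi> where c: "\<phi> \<in> cocycles p X" "\<phi>' \<in> cocycles p X" "\<psi> \<in> cocycles q X"
    and "r = coh_class p X \<phi>" "r' = coh_class p X \<phi>'" "w = free_class q X \<psi>"
    using assms(1-3) unfolding coh_R_def carrier_cohomology_group carrier_coh_free by blast
  then show ?thesis
    by (simp only: coh_R_def mult_cohomology_group[OF c(1,2)] real_pairing_class[OF c(1,3) pq]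
        real_pairing_class[OF c(2,3) pq] real_pairing_class[OF cocycles_add[OF c(1,2)] c(3) pq]
        integral_cup_add_left)
qed

lemma real_pairing_mult_right:
  assumes "r \<in> carrier (coh_R p X)" "w \<in> carrier (coh_free q X)" "w' \<in> carrier (coh_free q X)"
    and pq: "p + q = int n"
  shows "real_pairing X S \<sigma> p q r (w \<otimes>\<^bsub>coh_free q X\<^esub> w') =
    real_pairing X S \<sigma> p q r w + real_pairing X S \<sigma> p q r w'"
proof -
  obtain \<phi> \<psi> \<psi>' where c: "\<phi> \<in> cocycles p X" "\<psi> \<in> cocycles q X" "\<psi>' \<in> cocycles q X"
    and "r = coh_class p X \<phi>" "w = free_class q X \<psi>" "w' = free_class q X \<psi>'"
    using assms(1-3) unfolding coh_R_def carrier_cohomology_group carrier_coh_free by blast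
  then show ?thesis
    by (simp only: free_class_mult[OF c(2,3)] real_pairing_class[OF c(1,2) pq]
        real_pairing_class[OF c(1,3) pq] real_pairing_class[OF c(1) cocycles_add[OF c(2,3)] pq]
        integral_cup_add_right)
qed

end

section \<open>The Hilbert space of square-summable functions\<close>

lemma square_summable_add:
  fixes x y :: "'i \<Rightarrow> complex"
  assumes "(\<lambda>i. (cmod (x i))\<^sup>2) summable_on UNIV" "(\<lambda>i. (cmod (y i))\<^sup>2) summable_on UNIV"
  shows "(\<lambda>i. (cmod (x i + y i))\<^sup>2) summable_on UNIV"
proof (rule summable_on_comparison_test)
  show "(\<lambda>i. 2 * (cmod (x i))\<^sup>2 + 2 * (cmod (y i))\<^sup>2) summable_on UNIV"
    using assms by (intro summable_on_add summable_on_cmult_right)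
  fix i
  have "(cmod (x i + y i))\<^sup>2 \<le> (cmod (x i) + cmod (y i))\<^sup>2"
    by (intro power_mono norm_triangle_ineq) simp
  also have "\<dots> \<le> 2 * (cmod (x i))\<^sup>2 + 2 * (cmod (y i))\<^sup>2"
    using sum_squares_bound[of "cmod (x i)" "cmod (y i)"] by (simp add: power2_sum)
  finally show "(cmod (x i + y i))\<^sup>2 \<le> 2 * (cmod (x i))\<^sup>2 + 2 * (cmod (y i))\<^sup>2" .
qed simp

lemma square_summable_cmult:
  fixes x :: "'i \<Rightarrow> complex"
  assumes "(\<lambda>i. (cmod (x i))\<^sup>2) summable_on UNIV"
  shows "(\<lambda>i. (cmod (a * x i))\<^sup>2) summable_on UNIV"
  using summable_on_cmult_right[OF assms, of "(cmod a)\<^sup>2"] by (simp add: norm_mult power_mult_distrib)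

typedef 'i ell2 = "{x :: 'i \<Rightarrow> complex. (\<lambda>i. (cmod (x i))\<^sup>2) summable_on UNIV}"
  morphisms coord Abs_ell2
  by (rule exI[of _ "\<lambda>i. 0"]) simp

setup_lifting type_definition_ell2

lemma coord_summable: "(\<lambda>i. (cmod (coord x i))\<^sup>2) summable_on UNIV"
  using coord by auto

lemma ell2_eqI: "(\<And>i. coord x i = coord y i) \<Longrightarrow> x = y"
  by (rule coord_inject[THEN iffD1], rule ext)

lift_definition cscale :: "complex \<Rightarrow> 'i ell2 \<Rightarrow> 'i ell2" is "\<lambda>a x i. a * x i"
  by (rule square_summable_cmult)

lemma summable_inner: "(\<lambda>i. Re (cnj (coord x i) * coord y i)) summable_on UNIV"
proof (rule Infinite_Sum.abs_summable_summable, rule summable_on_comparison_test)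
  show "(\<lambda>i. (cmod (coord x i))\<^sup>2 + (cmod (coord y i))\<^sup>2) summable_on UNIV"
    by (rule summable_on_add[OF coord_summable coord_summable])
  fix i
  have "\<bar>Re (cnj (coord x i) * coord y i)\<bar> \<le> cmod (coord x i) * cmod (coord y i)"
    using abs_Re_le_cmod[of "cnj (coord x i) * coord y i"] by (simp add: norm_mult)
  also have "\<dots> \<le> (cmod (coord x i))\<^sup>2 + (cmod (coord y i))\<^sup>2"
    using sum_squares_bound[of "cmod (coord x i)" "cmod (coord y i)"]
      mult_nonneg_nonneg[OF norm_ge_zero norm_ge_zero, of "coord x i" "coord y i"] by linarith
  finally show "norm (Re (cnj (coord x i) * coord y i)) \<le> (cmod (coord x i))\<^sup>2 + (cmod (coord y i))\<^sup>2"
    by simp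
qed simp

instantiation ell2 :: (type) real_vector
begin

lift_definition zero_ell2 :: "'a ell2" is "\<lambda>i. 0" by simp

lift_definition plus_ell2 :: "'a ell2 \<Rightarrow> 'a ell2 \<Rightarrow> 'a ell2" is "\<lambda>x y i. x i + y i"
  by (rule square_summable_add)

lift_definition uminus_ell2 :: "'a ell2 \<Rightarrow> 'a ell2" is "\<lambda>x i. - x i" by simp

definition minus_ell2 :: "'a ell2 \<Rightarrow> 'a ell2 \<Rightarrow> 'a ell2" where "minus_ell2 x y = x + - y"

definition scaleR_ell2 :: "real \<Rightarrow> 'a ell2 \<Rightarrow> 'a ell2" where "scaleR_ell2 r = cscale (of_real r)"

instance
proof
  fix x y z :: "'a ell2" and a b :: real
  show "x + y + z = x + (y + z)" "x + y = y + x" "0 + x = x" "- x + x = 0"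
    by (transfer; simp add: algebra_simps)+
  show "x - y = x + - y" by (simp add: minus_ell2_def)
  show "a *\<^sub>R (x + y) = a *\<^sub>R x + a *\<^sub>R y" "(a + b) *\<^sub>R x = a *\<^sub>R x + b *\<^sub>R x"
    "a *\<^sub>R b *\<^sub>R x = (a * b) *\<^sub>R x" "1 *\<^sub>R x = x"
    unfolding scaleR_ell2_def by (transfer; simp add: algebra_simps)+
qed

end

instantiation ell2 :: (type) real_inner
begin

text \<open>The real part of the Hermitian product. As the type class is real, complex linearity of
  operators is carried separately, as commutation with \<open>cscale\<close>.\<close>

definition inner_ell2 :: "'a ell2 \<Rightarrow> 'a ell2 \<Rightarrow> real" where
  "inner_ell2 x y = (\<Sum>\<^sub>\<infinity>i. Re (cnj (coord x i) * coord y i))"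

definition norm_ell2 :: "'a ell2 \<Rightarrow> real" where "norm_ell2 x = sqrt (x \<bullet> x)"

definition dist_ell2 :: "'a ell2 \<Rightarrow> 'a ell2 \<Rightarrow> real" where "dist_ell2 x y = norm (x - y)"

definition sgn_ell2 :: "'a ell2 \<Rightarrow> 'a ell2" where "sgn_ell2 x = x /\<^sub>R norm x"

definition uniformity_ell2 :: "('a ell2 \<times> 'a ell2) filter" where
  "uniformity_ell2 = (INF e\<in>{0 <..}. principal {(x, y). dist x y < e})"

definition open_ell2 :: "'a ell2 set \<Rightarrow> bool" where
  "open_ell2 U = (\<forall>x\<in>U. \<forall>\<^sub>F (x', y) in uniformity. x' = x \<longrightarrow> y \<in> U)"

instance
proof
  fix x y z :: "'a ell2" and a b :: real
  show "dist x y = norm (x - y)" "sgn x = x /\<^sub>R norm x" "norm x = sqrt (x \<bullet> x)"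
    "(uniformity :: ('a ell2 \<times> 'a ell2) filter) = (INF e\<in>{0 <..}. principal {(x, y). dist x y < e})"
    "\<And>U :: 'a ell2 set. open U = (\<forall>x\<in>U. \<forall>\<^sub>F (x', y) in uniformity. x' = x \<longrightarrow> y \<in> U)"
    by (simp_all add: dist_ell2_def sgn_ell2_def norm_ell2_def uniformity_ell2_def open_ell2_def)
  show "x \<bullet> y = y \<bullet> x"
    unfolding inner_ell2_def by (rule infsum_cong) simp
  have "(\<Sum>\<^sub>\<infinity>i. Re (cnj (coord (x + y) i) * coord z i)) =
      (\<Sum>\<^sub>\<infinity>i. Re (cnj (coord x i) * coord z i) + Re (cnj (coord y i) * coord z i))"
    by (rule infsum_cong) (simp add: plus_ell2.rep_eq algebra_simps)
  then show "(x + y) \<bullet> z = x \<bullet> z + y \<bullet> z"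
    unfolding inner_ell2_def
    by (simp only: infsum_add[OF summable_inner summable_inner])
  have "(\<Sum>\<^sub>\<infinity>i. Re (cnj (coord (a *\<^sub>R x) i) * coord y i)) = (\<Sum>\<^sub>\<infinity>i. a * Re (cnj (coord x i) * coord y i))"
    by (rule infsum_cong) (simp add: scaleR_ell2_def cscale.rep_eq algebra_simps)
  then show "a *\<^sub>R x \<bullet> y = a * (x \<bullet> y)"
    unfolding inner_ell2_def by (simp only: infsum_cmult_right')
  have sq: "x \<bullet> x = (\<Sum>\<^sub>\<infinity>i. (cmod (coord x i))\<^sup>2)" for x :: "'a ell2"
    unfolding inner_ell2_def by (rule infsum_cong) (simp only: mult.commute[of "cnj _"] complex_norm_square[symmetric] Re_complex_of_real)
  show "0 \<le> x \<bullet> x"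
    unfolding sq by (rule infsum_nonneg) simp
  show "x \<bullet> x = 0 \<longleftrightarrow> x = 0"
  proof
    assume "x \<bullet> x = 0"
    then have "(cmod (coord x i))\<^sup>2 = 0" for i
      unfolding sq using nonneg_infsum_le_0D[OF _ coord_summable, of x i] by simp
    then show "x = 0"
      by (intro ell2_eqI) (simp add: zero_ell2.rep_eq)
  qed (simp add: sq zero_ell2.rep_eq)
qed

end

lemma coord_0 [simp]: "coord 0 i = 0"
  by (simp add: zero_ell2.rep_eq)

lemma coord_add [simp]: "coord (x + y) i = coord x i + coord y i"
  by (simp add: plus_ell2.rep_eq)

lemma coord_minus [simp]: "coord (- x) i = - coord x i"
  by (simp add: uminus_ell2.rep_eq)

lemma coord_diff [simp]: "coord (x - y) i = coord x i - coord y i"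
  unfolding minus_ell2_def coord_add coord_minus by simp

lemma coord_cscale [simp]: "coord (cscale a x) i = a * coord x i"
  by (simp add: cscale.rep_eq)

lemma coord_scaleR [simp]: "coord (r *\<^sub>R x) i = r *\<^sub>R coord x i"
  by (simp add: scaleR_ell2_def scaleR_conv_of_real)

lemma coord_sum: "coord (sum f A) i = (\<Sum>j\<in>A. coord (f j) i)"
  by (induction A rule: infinite_finite_induct) auto

lemma norm_ell2_sq: "(norm x)\<^sup>2 = (\<Sum>\<^sub>\<infinity>i. (cmod (coord x i))\<^sup>2)"
proof -
  have "(norm x)\<^sup>2 = x \<bullet> x" by (simp add: power2_norm_eq_inner)
  also have "\<dots> = (\<Sum>\<^sub>\<infinity>i. (cmod (coord x i))\<^sup>2)"
    unfolding inner_ell2_def by (rule infsum_cong) (simp only: mult.commute[of "cnj _"] complex_norm_square[symmetric] Re_complex_of_real)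
  finally show ?thesis .
qed

lemma sum_coord_le_norm: "finite A \<Longrightarrow> (\<Sum>i\<in>A. (cmod (coord x i))\<^sup>2) \<le> (norm x)\<^sup>2"
  unfolding norm_ell2_sq by (rule finite_sum_le_infsum[OF coord_summable]) auto

lemma coord_le_norm: "cmod (coord x i) \<le> norm x"
  using sum_coord_le_norm[of "{i}" x] by (simp add: power2_le_iff_abs_le)

lemma bounded_linear_coord: "bounded_linear (\<lambda>x. coord x i)"
  by (rule bounded_linear_intro[where K = 1]) (simp_all add: coord_le_norm)

text \<open>Uniform bounds on finite partial sums give square summability and the norm bound at
  once. Both the limits of Cauchy sequences and the values of operators are constructed in this
  way.\<close>

lemma ell2_of_bounded_sums:
  fixes f :: "'i \<Rightarrow> complex"
  assumes "\<And>A. finite A \<Longrightarrow> (\<Sum>i\<in>A. (cmod (f i))\<^sup>2) \<le> c\<^sup>2" "0 \<le> c"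
  shows "\<exists>x. coord x = f \<and> norm x \<le> c"
proof -
  have s: "(\<lambda>i. (cmod (f i))\<^sup>2) summable_on UNIV"
    by (rule nonneg_bdd_above_summable_on) (use assms(1) in \<open>auto intro!: bdd_aboveI2[where M = "c\<^sup>2"]\<close>)
  then have x: "coord (Abs_ell2 f) = f"
    by (simp add: Abs_ell2_inverse)
  have "(norm (Abs_ell2 f))\<^sup>2 \<le> c\<^sup>2"
    unfolding norm_ell2_sq x by (rule infsum_le_finite_sums[OF s]) (use assms in auto)
  then have "norm (Abs_ell2 f) \<le> c"
    using assms(2) by (rule power2_le_imp_le)
  with x show ?thesis by blast
qed

instance ell2 :: (type) complete_space
proof
  fix X :: "nat \<Rightarrow> 'a ell2" assume X: "Cauchy X"
  have "convergent (\<lambda>n. coord (X n) i)" for i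
    by (intro Cauchy_convergent bounded_linear.Cauchy[OF bounded_linear_coord X])
  then obtain L where L: "\<And>i. (\<lambda>n. coord (X n) i) \<longlonglongrightarrow> L i"
    unfolding convergent_def by metis
  \<comment> \<open>The bound on \<open>X m - X n\<close> is restricted to finitely many
    coordinates, where n can be sent to infinity; only afterwards is the finite set
    arbitrary.\<close>
  have tail: "\<exists>y. coord y = (\<lambda>i. coord (X m) i - L i) \<and> norm y \<le> e"
    if e: "0 \<le> e" and m: "\<And>n. n \<ge> m \<Longrightarrow> norm (X m - X n) \<le> e" for m e
  proof (rule ell2_of_bounded_sums)
    fix A :: "'a set" assume A: "finite A"
    have "(\<lambda>n. \<Sum>i\<in>A. (cmod (coord (X m) i - coord (X n) i))\<^sup>2) \<longlonglongrightarrow> (\<Sum>i\<in>A. (cmod (coord (X m) i - L i))\<^sup>2)"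
      by (intro tendsto_intros L)
    moreover have "(\<Sum>i\<in>A. (cmod (coord (X m) i - coord (X n) i))\<^sup>2) \<le> e\<^sup>2" if "n \<ge> m" for n
      using sum_coord_le_norm[OF A, of "X m - X n"] power_mono[OF m[OF that] norm_ge_zero, of 2]
      by simp
    ultimately show "(\<Sum>i\<in>A. (cmod (coord (X m) i - L i))\<^sup>2) \<le> e\<^sup>2"
      by (intro LIMSEQ_le_const2) auto
  qed (use e in simp)
  obtain N where N: "\<And>n. n \<ge> N \<Longrightarrow> norm (X N - X n) \<le> 1"
  proof -
    obtain N where "\<And>m n. m \<ge> N \<Longrightarrow> n \<ge> N \<Longrightarrow> norm (X m - X n) < 1"
      using CauchyD[OF X, of 1] by auto
    then have "norm (X N - X n) \<le> 1" if "n \<ge> N" for n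
      using that by (simp add: less_imp_le)
    then show ?thesis by (rule that)
  qed
  \<comment> \<open>The pointwise limit L is square summable because it is \<open>X N\<close> minus
    a square summable tail. Any tolerance would do; here it is 1.\<close>
  obtain y where y: "coord y = (\<lambda>i. coord (X N) i - L i)"
    using tail[of 1 N] N by auto
  have Lx: "coord (X N - y) = L"
    by (rule ext) (simp add: y)
  have "X \<longlonglongrightarrow> X N - y"
  proof (rule LIMSEQ_I)
    fix r :: real assume r: "0 < r"
    obtain M where M: "\<And>m n. m \<ge> M \<Longrightarrow> n \<ge> M \<Longrightarrow> norm (X m - X n) < r / 2"
      using CauchyD[OF X, of "r / 2"] r by auto
    have "norm (X m - (X N - y)) < r" if m: "m \<ge> M" for m
    proof -
      obtain z where z: "coord z = (\<lambda>i. coord (X m) i - L i)" "norm z \<le> r / 2"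
      proof -
        have "norm (X m - X n) \<le> r / 2" if "n \<ge> m" for n
          using M[of m n] m that by simp
        with tail[of "r / 2" m] r that show ?thesis by auto
      qed
      have "z = X m - (X N - y)"
        by (rule ell2_eqI) (simp add: z(1) y)
      with z(2) r show ?thesis by simp
    qed
    then show "\<exists>M. \<forall>m\<ge>M. norm (X m - (X N - y)) < r" by blast
  qed
  then show "convergent X" by (rule convergentI)
qed

instance ell2 :: (type) banach ..

lemma norm_cscale [simp]: "norm (cscale a x) = cmod a * norm x"
proof -
  have "(norm (cscale a x))\<^sup>2 = (cmod a * norm x)\<^sup>2"
    by (simp add: norm_ell2_sq norm_mult power_mult_distrib infsum_cmult_right')
  then show ?thesis by (simp add: power2_eq_iff_nonneg)
qed

lemma bounded_linear_cscale: "bounded_linear (cscale a)"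
  by (rule bounded_linear_intro[where K = "cmod a"]) (auto intro!: ell2_eqI simp: algebra_simps)

lemma cscale_simps [simp]:
  "cscale 1 x = x" "cscale 0 x = 0" "cscale a 0 = 0" "cscale a (cscale b x) = cscale (a * b) x"
  "cscale a (- x) = - cscale a x" "cscale (-1) x = - x"
  by (auto intro!: ell2_eqI)

lemma cscale_add: "cscale a (x + y) = cscale a x + cscale a y"
  and cscale_add_left: "cscale (a + b) x = cscale a x + cscale b x"
  by (auto intro!: ell2_eqI simp: algebra_simps)

lemma inner_cscale_left: "cscale a x \<bullet> y = x \<bullet> cscale (cnj a) y"
  by (simp add: inner_ell2_def algebra_simps)

text \<open>Conjugate linear in the first argument.\<close>

definition cinner :: "'i ell2 \<Rightarrow> 'i ell2 \<Rightarrow> complex" where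
  "cinner x y = Complex (x \<bullet> y) (cscale \<i> x \<bullet> y)"

lemma cscale_eq: "cscale a x = Re a *\<^sub>R x + Im a *\<^sub>R cscale \<i> x"
  by (rule ell2_eqI) (simp add: complex_eq_iff)

lemma inner_cscale_i: "x \<bullet> cscale \<i> y = - (cscale \<i> x \<bullet> y)"
proof -
  have "cscale (cnj \<i>) y = - cscale \<i> y"
    by (rule ell2_eqI) simp
  then show ?thesis by (simp only: inner_cscale_left inner_minus_right minus_minus)
qed

lemma cinner_cscale_right: "cinner x (cscale a y) = a * cinner x y"
  by (subst cscale_eq) (simp add: cinner_def complex_eq_iff inner_add_right inner_cscale_i)

lemma cinner_self: "cinner x x = of_real ((norm x)\<^sup>2)"
proof -
  have "cscale \<i> x \<bullet> x = 0"
    using inner_cscale_i[of x x] inner_commute[of x "cscale \<i> x"] by simp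
  then show ?thesis
    by (simp add: cinner_def complex_eq_iff power2_norm_eq_inner)
qed

lemma tendsto_cscale [tendsto_intros]: "(f \<longlongrightarrow> x) F \<Longrightarrow> ((\<lambda>n. cscale a (f n)) \<longlongrightarrow> cscale a x) F"
  by (rule bounded_linear.tendsto[OF bounded_linear_cscale])

lemma tendsto_cinner [tendsto_intros]:
  "(f \<longlongrightarrow> x) F \<Longrightarrow> (g \<longlongrightarrow> y) F \<Longrightarrow> ((\<lambda>n. cinner (f n) (g n)) \<longlongrightarrow> cinner x y) F"
  unfolding cinner_def by (intro tendsto_intros)

subsection \<open>Weighted composition operators\<close>

text \<open>Shifts with phases and relabellings of the basis are both of this form. The map f acts
  on the argument, so basis vectors are moved by its inverse.\<close>

definition weighted_comp :: "('i \<Rightarrow> complex) \<Rightarrow> ('i \<Rightarrow> 'i) \<Rightarrow> 'i set \<Rightarrow> 'i ell2 \<Rightarrow>\<^sub>L 'i ell2" where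
  "weighted_comp c f S = Blinfun (\<lambda>x. Abs_ell2 (\<lambda>i. if i \<in> S then c i * coord x (f i) else 0))"

lemma weighted_comp_aux:
  assumes "inj_on f S" "\<forall>i\<in>S. cmod (c i) \<le> 1"
  shows "\<exists>y. coord y = (\<lambda>i. if i \<in> S then c i * coord x (f i) else 0) \<and> norm y \<le> norm x"
proof (rule ell2_of_bounded_sums)
  fix A :: "'a set" assume A: "finite A"
  have "(\<Sum>i\<in>A. (cmod (if i \<in> S then c i * coord x (f i) else 0))\<^sup>2) \<le>
      (\<Sum>i\<in>A \<inter> S. (cmod (coord x (f i)))\<^sup>2)"
  proof -
    have "(\<Sum>i\<in>A. (cmod (if i \<in> S then c i * coord x (f i) else 0))\<^sup>2) =
        (\<Sum>i\<in>A \<inter> S. (cmod (c i * coord x (f i)))\<^sup>2)"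
      by (rule sum.mono_neutral_cong_right) (use A in auto)
    also have "\<dots> \<le> (\<Sum>i\<in>A \<inter> S. (cmod (coord x (f i)))\<^sup>2)"
    proof (rule sum_mono, rule power_mono)
      fix i assume "i \<in> A \<inter> S"
      then show "cmod (c i * coord x (f i)) \<le> cmod (coord x (f i))"
        using mult_right_mono[of "cmod (c i)" 1 "cmod (coord x (f i))"] assms(2) by (simp add: norm_mult)
    qed simp
    finally show ?thesis .
  qed
  \<comment> \<open>Injectivity of f turns the reindexed terms into a partial sum of the squared
    norm of x.\<close>
  also have "\<dots> = (\<Sum>j\<in>f ` (A \<inter> S). (cmod (coord x j))\<^sup>2)"
    using inj_on_subset[OF assms(1), of "A \<inter> S"] by (simp add: sum.reindex)
  also have "\<dots> \<le> (norm x)\<^sup>2"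
    by (rule sum_coord_le_norm) (use A in simp)
  finally show "(\<Sum>i\<in>A. (cmod (if i \<in> S then c i * coord x (f i) else 0))\<^sup>2) \<le> (norm x)\<^sup>2" .
qed simp

lemma
  assumes "inj_on f S" "\<forall>i\<in>S. cmod (c i) \<le> 1"
  shows coord_weighted_comp:
      "coord (weighted_comp c f S x) i = (if i \<in> S then c i * coord x (f i) else 0)"
    and norm_weighted_comp: "norm (weighted_comp c f S) \<le> 1"
proof -
  let ?c = "\<lambda>x i. if i \<in> S then c i * coord x (f i) else 0"
  define T where "T x = Abs_ell2 (?c x)" for x
  have T: "coord (T x) i = ?c x i" "norm (T x) \<le> norm x" for x i
  proof -
    obtain y where y: "coord y = ?c x" "norm y \<le> norm x"
      using weighted_comp_aux[OF assms, where x = x] by blast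
    have "T x = y"
      unfolding T_def y(1)[symmetric] by (rule coord_inverse)
    with y show "coord (T x) i = ?c x i" "norm (T x) \<le> norm x" by simp_all
  qed
  have "bounded_linear T"
    by (rule bounded_linear_intro[where K = 1]) (auto intro!: ell2_eqI simp: T algebra_simps)
  then have W: "blinfun_apply (weighted_comp c f S) = T"
    unfolding weighted_comp_def T_def[abs_def] by (rule bounded_linear_Blinfun_apply)
  show "coord (weighted_comp c f S x) i = (if i \<in> S then c i * coord x (f i) else 0)"
    by (simp add: W T)
  show "norm (weighted_comp c f S) \<le> 1"
    by (rule norm_blinfun_bound) (simp_all add: W T)
qed

text \<open>Substitution j = f i in the inner product, with g inverse to f and conjugate weights. It
  yields the adjoint of a Weyl generator as well as that of the duality operator.\<close>

lemma weighted_comp_adjoint: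
  assumes f: "bij_betw f S S'" and g: "\<And>i. i \<in> S \<Longrightarrow> g (f i) = i"
    and c: "\<forall>i\<in>S. cmod (c i) \<le> 1" and d: "\<And>i. i \<in> S \<Longrightarrow> d (f i) = cnj (c i)"
  shows "weighted_comp c f S x \<bullet> y = x \<bullet> weighted_comp d g S' y"
proof -
  have inj: "inj_on f S" and S': "S' = f ` S" using f by (auto simp: bij_betw_def)
  have inj': "inj_on g S'" unfolding S' by (rule inj_onI) (use g in auto)
  have d': "\<forall>j\<in>S'. cmod (d j) \<le> 1"
    using c d by (auto simp: S')
  have "weighted_comp c f S x \<bullet> y = (\<Sum>\<^sub>\<infinity>i\<in>S. Re (cnj (c i) * cnj (coord x (f i)) * coord y i))"
    unfolding inner_ell2_def
    by (rule infsum_cong_neutral) (auto simp: coord_weighted_comp[OF inj c])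
  also have "\<dots> = (\<Sum>\<^sub>\<infinity>i\<in>S. Re (cnj (coord x (f i)) * (d (f i) * coord y (g (f i)))))"
    by (rule infsum_cong) (simp add: d g algebra_simps)
  also have "\<dots> = (\<Sum>\<^sub>\<infinity>j\<in>S'. Re (cnj (coord x j) * (d j * coord y (g j))))"
    by (rule infsum_reindex_bij_betw[OF f])
  also have "\<dots> = x \<bullet> weighted_comp d g S' y"
    unfolding inner_ell2_def
    by (rule infsum_cong_neutral) (auto simp: coord_weighted_comp[OF inj' d'])
  finally show ?thesis .
qed

subsection \<open>The standard orthonormal basis\<close>

lift_definition ket_vec :: "'i \<Rightarrow> 'i ell2" is "\<lambda>j i. if i = j then 1 else 0"
  by (rule finite_nonzero_values_imp_summable_on) simp

lemma coord_ket_vec: "coord (ket_vec j) i = (if i = j then 1 else 0)"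
  by (simp add: ket_vec.rep_eq)

text \<open>Density of finite combinations of basis vectors, in a form that keeps the indices in F.
  It is used for the cyclicity of the vacuum and for the uniqueness of bounded operators.\<close>

lemma ell2_truncation:
  fixes x :: "'i ell2"
  assumes "\<And>i. i \<notin> F \<Longrightarrow> coord x i = 0" "0 < e"
  shows "\<exists>A. finite A \<and> A \<subseteq> F \<and> norm (x - (\<Sum>j\<in>A. cscale (coord x j) (ket_vec j))) < e"
proof -
  have "((\<lambda>i. (cmod (coord x i))\<^sup>2) has_sum (norm x)\<^sup>2) UNIV"
    using has_sum_infsum[OF coord_summable] by (simp add: norm_ell2_sq)
  then have "\<forall>\<^sub>F A in finite_subsets_at_top UNIV. dist (\<Sum>i\<in>A. (cmod (coord x i))\<^sup>2) ((norm x)\<^sup>2) < e\<^sup>2"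
    unfolding has_sum_def by (rule tendstoD) (use assms in simp)
  then obtain B where B: "finite B" "dist (\<Sum>i\<in>B. (cmod (coord x i))\<^sup>2) ((norm x)\<^sup>2) < e\<^sup>2"
    unfolding eventually_finite_subsets_at_top by blast
  \<comment> \<open>Indices outside F contribute nothing to x and are dropped, so that the
    approximating sum only uses basis vectors from F.\<close>
  define A where "A = B \<inter> F"
  let ?t = "\<Sum>j\<in>A. cscale (coord x j) (ket_vec j)"
  have A: "finite A" "A \<subseteq> F" using B by (auto simp: A_def)
  have t: "coord ?t i = (if i \<in> A then coord x i else 0)" for i
  proof -
    have "coord ?t i = (\<Sum>j\<in>A. if i = j then coord x j else 0)"
      unfolding coord_sum by (rule sum.cong) (auto simp: coord_ket_vec)
    then show ?thesis using A(1) by simp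
  qed
  have 1: "(norm (x - ?t))\<^sup>2 = (\<Sum>\<^sub>\<infinity>i\<in>UNIV - A. (cmod (coord x i))\<^sup>2)"
    unfolding norm_ell2_sq by (rule infsum_cong_neutral) (auto simp: t)
  have 2: "(\<Sum>\<^sub>\<infinity>i\<in>UNIV - A. (cmod (coord x i))\<^sup>2) = (norm x)\<^sup>2 - (\<Sum>i\<in>A. (cmod (coord x i))\<^sup>2)"
    unfolding norm_ell2_sq
    using infsum_Diff[OF coord_summable[of x] summable_on_finite[OF A(1)] subset_UNIV]
    by (simp only: infsum_finite[OF A(1)])
  have 3: "(\<Sum>i\<in>A. (cmod (coord x i))\<^sup>2) = (\<Sum>i\<in>B. (cmod (coord x i))\<^sup>2)"
    unfolding A_def by (rule sum.mono_neutral_left) (use B assms(1) in auto)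
  have "(norm x)\<^sup>2 - (\<Sum>i\<in>B. (cmod (coord x i))\<^sup>2) < e\<^sup>2"
    using B(2) unfolding dist_real_def by linarith
  then have "(norm (x - ?t))\<^sup>2 < e\<^sup>2"
    by (simp only: 1 2 3)
  then have "norm (x - ?t) < e"
    by (rule power2_less_imp_less) (use assms(2) in simp)
  with A show ?thesis by blast
qed

section \<open>Completions\<close>

locale pseudometric =
  fixes A :: "'a set" and d :: "'a \<Rightarrow> 'a \<Rightarrow> real"
  assumes d_self: "x \<in> A \<Longrightarrow> d x x = 0"
    and d_sym: "x \<in> A \<Longrightarrow> y \<in> A \<Longrightarrow> d x y = d y x"
    and d_triangle: "x \<in> A \<Longrightarrow> y \<in> A \<Longrightarrow> z \<in> A \<Longrightarrow> d x z \<le> d x y + d y z"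
begin

lemma d_nonneg: "x \<in> A \<Longrightarrow> y \<in> A \<Longrightarrow> 0 \<le> d x y"
  using d_triangle[of x y x] d_self[of x] d_sym[of x y] by simp

lemma cauchy_seqs_mem: "s \<in> cauchy_seqs A d \<Longrightarrow> s n \<in> A"
  by (simp add: cauchy_seqs_def)

lemma cauchy_class_self: "s \<in> cauchy_seqs A d \<Longrightarrow> s \<in> cauchy_class A d s"
  by (simp add: cauchy_class_def d_self cauchy_seqs_mem)

lemma cauchy_class_eqI:
  assumes s: "s \<in> cauchy_seqs A d" and t: "t \<in> cauchy_seqs A d"
    and st: "(\<lambda>n. d (s n) (t n)) \<longlonglongrightarrow> 0"
  shows "cauchy_class A d s = cauchy_class A d t"
proof -
  have sub: "cauchy_class A d s \<subseteq> cauchy_class A d t"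
    if s: "s \<in> cauchy_seqs A d" and t: "t \<in> cauchy_seqs A d"
      and st: "(\<lambda>n. d (s n) (t n)) \<longlonglongrightarrow> 0" for s t
  proof
    fix u assume "u \<in> cauchy_class A d s"
    then have u: "u \<in> cauchy_seqs A d" and su: "(\<lambda>n. d (s n) (u n)) \<longlonglongrightarrow> 0"
      by (simp_all add: cauchy_class_def)
    have "(\<lambda>n. d (t n) (u n)) \<longlonglongrightarrow> 0"
    proof (rule tendsto_sandwich[OF _ _ tendsto_const])
      show "\<forall>\<^sub>F n in sequentially. 0 \<le> d (t n) (u n)"
        by (intro always_eventually allI d_nonneg cauchy_seqs_mem t u)
      show "\<forall>\<^sub>F n in sequentially. d (t n) (u n) \<le> d (s n) (t n) + d (s n) (u n)"
        using d_triangle[OF cauchy_seqs_mem[OF t] cauchy_seqs_mem[OF s] cauchy_seqs_mem[OF u]]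
          d_sym[OF cauchy_seqs_mem[OF t] cauchy_seqs_mem[OF s]] by simp
      show "(\<lambda>n. d (s n) (t n) + d (s n) (u n)) \<longlonglongrightarrow> 0"
        using tendsto_add[OF st su] by simp
    qed
    with u show "u \<in> cauchy_class A d t" by (simp add: cauchy_class_def)
  qed
  have "(\<lambda>n. d (t n) (s n)) \<longlonglongrightarrow> 0"
    using st d_sym[OF cauchy_seqs_mem[OF t] cauchy_seqs_mem[OF s]] by simp
  with sub assms show ?thesis by blast
qed

lemma descend_cauchy_class:
  assumes "s \<in> cauchy_seqs A d"
    and "\<And>t. t \<in> cauchy_seqs A d \<Longrightarrow> (\<lambda>n. d (s n) (t n)) \<longlonglongrightarrow> 0 \<Longrightarrow> f t = f s"
  shows "descend f (cauchy_class A d s) = f s"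
  by (rule descend_eqI[OF cauchy_class_self[OF assms(1)]]) (simp add: cauchy_class_def assms(2))

lemma const_cauchy: "x \<in> A \<Longrightarrow> (\<lambda>n. x) \<in> cauchy_seqs A d"
  by (simp add: cauchy_seqs_def d_self)

end

locale lipschitz_map = src: pseudometric A d + dst: pseudometric B d'
  for A :: "'a set" and d and B :: "'b set" and d' +
  fixes F :: "'a \<Rightarrow> 'b" and K :: real
  assumes F_closed: "x \<in> A \<Longrightarrow> F x \<in> B"
    and F_lipschitz: "x \<in> A \<Longrightarrow> y \<in> A \<Longrightarrow> d' (F x) (F y) \<le> K * d x y"
begin

lemma F_cauchy: 
  assumes s: "s \<in> cauchy_seqs A d"
  shows "(\<lambda>n. F (s n)) \<in> cauchy_seqs B d'"
  unfolding cauchy_seqs_def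
proof (intro CollectI conjI allI impI)
  fix e :: real assume e: "0 < e"
  \<comment> \<open>Raising the constant to at least 1 allows division by it, also when K is zero or
    negative.\<close>
  define k where "k = max K 1"
  have k: "0 < k" "K \<le> k" by (simp_all add: k_def)
  obtain N where N: "\<And>i j. i \<ge> N \<Longrightarrow> j \<ge> N \<Longrightarrow> d (s i) (s j) < e / k"
    using s e k unfolding cauchy_seqs_def by (auto dest!: spec[of _ "e / k"])
  have "d' (F (s i)) (F (s j)) < e" if "i \<ge> N" "j \<ge> N" for i j
  proof -
    note m = src.cauchy_seqs_mem[OF s]
    have "d' (F (s i)) (F (s j)) \<le> k * d (s i) (s j)"
      using F_lipschitz[OF m m, of i j] mult_right_mono[OF k(2) src.d_nonneg[OF m m], of i j]
      by linarith
    also have "\<dots> < e"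
      using N[OF that] k(1) by (simp add: field_simps)
    finally show ?thesis .
  qed
  then show "\<exists>N. \<forall>i\<ge>N. \<forall>j\<ge>N. d' (F (s i)) (F (s j)) < e" by blast
qed (use F_closed src.cauchy_seqs_mem[OF s] in blast)

lemma F_null:
  assumes "s \<in> cauchy_seqs A d" "t \<in> cauchy_seqs A d" "(\<lambda>n. d (s n) (t n)) \<longlonglongrightarrow> 0"
  shows "(\<lambda>n. d' (F (s n)) (F (t n))) \<longlonglongrightarrow> 0"
proof (rule tendsto_sandwich[OF _ _ tendsto_const])
  show "\<forall>\<^sub>F n in sequentially. 0 \<le> d' (F (s n)) (F (t n))"
    by (intro always_eventually allI dst.d_nonneg F_closed src.cauchy_seqs_mem assms)
  show "\<forall>\<^sub>F n in sequentially. d' (F (s n)) (F (t n)) \<le> K * d (s n) (t n)"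
    by (intro always_eventually allI F_lipschitz src.cauchy_seqs_mem assms)
  show "(\<lambda>n. K * d (s n) (t n)) \<longlonglongrightarrow> 0"
    using tendsto_mult_left[OF assms(3), of K] by simp
qed

lemma descend_F:
  assumes "s \<in> cauchy_seqs A d"
  shows "descend (\<lambda>s. cauchy_class B d' (\<lambda>n. F (s n))) (cauchy_class A d s) = cauchy_class B d' (\<lambda>n. F (s n))"
proof (rule src.descend_cauchy_class[OF assms])
  fix t assume t: "t \<in> cauchy_seqs A d" "(\<lambda>n. d (s n) (t n)) \<longlonglongrightarrow> 0"
  show "cauchy_class B d' (\<lambda>n. F (t n)) = cauchy_class B d' (\<lambda>n. F (s n))"
    by (rule dst.cauchy_class_eqI[OF F_cauchy F_cauchy F_null, symmetric]) (use t assms in auto)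
qed

end

subsection \<open>Normed *-algebras\<close>

text \<open>Not necessarily associative, and $(xy)^* = y^* x^*$ is not assumed.\<close>

locale normed_star_algebra =
  fixes A :: "'a star_algebra" (structure)
  assumes abelian: "abelian_group A"
    and smult_closed: "x \<in> carrier A \<Longrightarrow> \<alpha> \<odot> x \<in> carrier A"
    and smult_add_left: "x \<in> carrier A \<Longrightarrow> (\<alpha> + \<beta>) \<odot> x = \<alpha> \<odot> x \<oplus> \<beta> \<odot> x"
    and smult_add: "x \<in> carrier A \<Longrightarrow> y \<in> carrier A \<Longrightarrow> \<alpha> \<odot> (x \<oplus> y) = \<alpha> \<odot> x \<oplus> \<alpha> \<odot> y"
    and smult_smult: "x \<in> carrier A \<Longrightarrow> \<alpha> \<odot> (\<beta> \<odot> x) = (\<alpha> * \<beta>) \<odot> x"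
    and smult_one: "x \<in> carrier A \<Longrightarrow> 1 \<odot> x = x"
    and mult_closed: "x \<in> carrier A \<Longrightarrow> y \<in> carrier A \<Longrightarrow> x \<otimes> y \<in> carrier A"
    and mult_add_left: "x \<in> carrier A \<Longrightarrow> y \<in> carrier A \<Longrightarrow> z \<in> carrier A \<Longrightarrow>
      (x \<oplus> y) \<otimes> z = x \<otimes> z \<oplus> y \<otimes> z"
    and mult_add_right: "x \<in> carrier A \<Longrightarrow> y \<in> carrier A \<Longrightarrow> z \<in> carrier A \<Longrightarrow>
      z \<otimes> (x \<oplus> y) = z \<otimes> x \<oplus> z \<otimes> y"
    and mult_smult_left: "x \<in> carrier A \<Longrightarrow> y \<in> carrier A \<Longrightarrow> (\<alpha> \<odot> x) \<otimes> y = \<alpha> \<odot> (x \<otimes> y)"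
    and mult_smult_right: "x \<in> carrier A \<Longrightarrow> y \<in> carrier A \<Longrightarrow> x \<otimes> (\<alpha> \<odot> y) = \<alpha> \<odot> (x \<otimes> y)"
    and adj_closed: "x \<in> carrier A \<Longrightarrow> adj A x \<in> carrier A"
    and adj_add: "x \<in> carrier A \<Longrightarrow> y \<in> carrier A \<Longrightarrow> adj A (x \<oplus> y) = adj A x \<oplus> adj A y"
    and adj_smult: "x \<in> carrier A \<Longrightarrow> adj A (\<alpha> \<odot> x) = cnj \<alpha> \<odot> adj A x"
    and adj_adj: "x \<in> carrier A \<Longrightarrow> adj A (adj A x) = x"
    and nrm_nonneg: "x \<in> carrier A \<Longrightarrow> 0 \<le> nrm A x"
    and nrm_add: "x \<in> carrier A \<Longrightarrow> y \<in> carrier A \<Longrightarrow> nrm A (x \<oplus> y) \<le> nrm A x + nrm A y"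
    and nrm_smult: "x \<in> carrier A \<Longrightarrow> nrm A (\<alpha> \<odot> x) = norm \<alpha> * nrm A x"
    and nrm_mult: "x \<in> carrier A \<Longrightarrow> y \<in> carrier A \<Longrightarrow> nrm A (x \<otimes> y) \<le> nrm A x * nrm A y"
    and nrm_adj: "x \<in> carrier A \<Longrightarrow> nrm A (adj A x) \<le> nrm A x"
begin

sublocale abelian_group A by (rule abelian)

lemma smult_zero_left: assumes "x \<in> carrier A" shows "0 \<odot> x = \<zero>"
proof -
  have "0 \<odot> x \<oplus> 0 \<odot> x = 0 \<odot> x"
    using smult_add_left[OF assms, of 0 0] by simp
  then show ?thesis
    using smult_closed[OF assms, of 0] by (metis add.l_cancel_one' zero_closed)
qed

lemma a_inv_eq: assumes "x \<in> carrier A" shows "\<ominus> x = (-1) \<odot> x"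
proof -
  have "(-1) \<odot> x \<oplus> x = 0 \<odot> x"
    using smult_add_left[OF assms, of "-1" 1] by (simp add: smult_one assms)
  then show ?thesis
    using smult_zero_left[OF assms] smult_closed[OF assms] assms by (metis minus_equality)
qed

lemma minus_eq': "x \<in> carrier A \<Longrightarrow> y \<in> carrier A \<Longrightarrow> x \<ominus> y = x \<oplus> (-1) \<odot> y"
  by (simp add: a_minus_def a_inv_eq)

lemma nrm_zero: "nrm A \<zero> = 0"
  using nrm_smult[OF zero_closed, of 0] smult_zero_left[OF zero_closed] by simp

lemma nrm_a_inv: "x \<in> carrier A \<Longrightarrow> nrm A (\<ominus> x) = nrm A x"
  by (simp add: a_inv_eq nrm_smult)

lemma minus_swap: "x \<in> carrier A \<Longrightarrow> y \<in> carrier A \<Longrightarrow> \<ominus> (x \<ominus> y) = y \<ominus> x"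
  by (simp add: a_minus_def minus_add a_comm)

lemma minus_chain:
  "x \<in> carrier A \<Longrightarrow> y \<in> carrier A \<Longrightarrow> z \<in> carrier A \<Longrightarrow> x \<ominus> z = (x \<ominus> y) \<oplus> (y \<ominus> z)"
  by (simp add: a_minus_def a_ac r_neg1 r_neg2)

lemma add_minus_add:
  assumes "x \<in> carrier A" "y \<in> carrier A" "x' \<in> carrier A" "y' \<in> carrier A"
  shows "(x \<oplus> y) \<ominus> (x' \<oplus> y') = (x \<ominus> x') \<oplus> (y \<ominus> y')"
  using assms by (simp add: a_minus_def minus_add a_ac)

sublocale alg: pseudometric "carrier A" "alg_dist A"
proof
  fix x y z assume c: "x \<in> carrier A" "y \<in> carrier A"
  show "alg_dist A x x = 0" using c by (simp add: alg_dist_def r_neg a_minus_def nrm_zero)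
  show "alg_dist A x y = alg_dist A y x"
    unfolding alg_dist_def minus_swap[OF c, symmetric] by (rule nrm_a_inv[symmetric]) (simp add: c)
  assume z: "z \<in> carrier A"
  show "alg_dist A x z \<le> alg_dist A x y + alg_dist A y z"
    unfolding alg_dist_def minus_chain[OF c z] by (rule nrm_add) (simp_all add: c z)
qed

abbreviation "seqs \<equiv> cauchy_seqs (carrier A) (alg_dist A)"

lemma seqs_mem: "s \<in> seqs \<Longrightarrow> s n \<in> carrier A"
  by (rule alg.cauchy_seqs_mem)

lemma smult_minus: "x \<in> carrier A \<Longrightarrow> y \<in> carrier A \<Longrightarrow> \<alpha> \<odot> (x \<ominus> y) = \<alpha> \<odot> x \<ominus> \<alpha> \<odot> y"
  by (simp add: minus_eq' smult_add smult_closed smult_smult mult.commute)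

lemma adj_minus: "x \<in> carrier A \<Longrightarrow> y \<in> carrier A \<Longrightarrow> adj A (x \<ominus> y) = adj A x \<ominus> adj A y"
  by (simp add: minus_eq' adj_add smult_closed adj_smult adj_closed)

lemma mult_minus_left: "x \<in> carrier A \<Longrightarrow> y \<in> carrier A \<Longrightarrow> z \<in> carrier A \<Longrightarrow>
    (x \<ominus> y) \<otimes> z = x \<otimes> z \<ominus> y \<otimes> z"
  by (simp add: minus_eq' mult_add_left smult_closed mult_smult_left mult_closed)

lemma mult_minus_right: "x \<in> carrier A \<Longrightarrow> y \<in> carrier A \<Longrightarrow> z \<in> carrier A \<Longrightarrow>
    z \<otimes> (x \<ominus> y) = z \<otimes> x \<ominus> z \<otimes> y"
  by (simp add: minus_eq' mult_add_right smult_closed mult_smult_right mult_closed)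

lemma lipschitz_smult: "lipschitz_map (carrier A) (alg_dist A) (carrier A) (alg_dist A) (\<lambda>x. \<alpha> \<odot> x) (norm \<alpha>)"
  by unfold_locales (simp_all add: smult_closed alg_dist_def smult_minus[symmetric] nrm_smult)

lemma lipschitz_adj: "lipschitz_map (carrier A) (alg_dist A) (carrier A) (alg_dist A) (adj A) 1"
  by unfold_locales (simp_all add: adj_closed alg_dist_def adj_minus[symmetric] nrm_adj)

lemma nrm_diff: assumes "x \<in> carrier A" "y \<in> carrier A"
  shows "\<bar>nrm A x - nrm A y\<bar> \<le> alg_dist A x y"
proof -
  have "nrm A x \<le> alg_dist A x y + nrm A y" if "x \<in> carrier A" "y \<in> carrier A" for x y
  proof -
    have "x = (x \<ominus> y) \<oplus> y" using that by (simp add: a_minus_def a_assoc l_neg)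
    then show ?thesis using nrm_add[of "x \<ominus> y" y] that by (simp add: alg_dist_def)
  qed
  from this[OF assms] this[OF assms(2,1)] show ?thesis
    using alg.d_sym[OF assms] by linarith
qed

lemma nrm_Cauchy: assumes "s \<in> seqs" shows "Cauchy (\<lambda>n. nrm A (s n))"
proof (rule metric_CauchyI)
  fix e :: real assume "0 < e"
  then obtain N where N: "\<And>i j. i \<ge> N \<Longrightarrow> j \<ge> N \<Longrightarrow> alg_dist A (s i) (s j) < e"
    using assms unfolding cauchy_seqs_def by blast
  then show "\<exists>M. \<forall>m\<ge>M. \<forall>n\<ge>M. dist (nrm A (s m)) (nrm A (s n)) < e"
    using nrm_diff[OF seqs_mem[OF assms] seqs_mem[OF assms]]
    by (metis dist_real_def order_le_less_trans)
qed

lemma nrm_bounded: assumes "s \<in> seqs" obtains K where "0 < K" "\<And>n. nrm A (s n) \<le> K"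
proof -
  have "Bseq (\<lambda>n. nrm A (s n))"
    using nrm_Cauchy[OF assms] by (simp add: Cauchy_Bseq)
  then obtain K where "0 < K" "\<And>n. norm (nrm A (s n)) \<le> K"
    by (auto simp: Bseq_def)
  then show ?thesis using that by (metis abs_le_D1 real_norm_def)
qed

lemma dist_add_le:
  assumes "x \<in> carrier A" "y \<in> carrier A" "x' \<in> carrier A" "y' \<in> carrier A"
  shows "alg_dist A (x \<oplus> y) (x' \<oplus> y') \<le> alg_dist A x x' + alg_dist A y y'"
  unfolding alg_dist_def add_minus_add[OF assms] by (rule nrm_add) (simp_all add: assms)

lemma dist_mult_le:
  assumes "x \<in> carrier A" "y \<in> carrier A" "x' \<in> carrier A" "y' \<in> carrier A"
  shows "alg_dist A (x \<otimes> y) (x' \<otimes> y') \<le> alg_dist A x x' * nrm A y + nrm A x' * alg_dist A y y'"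
proof -
  have "x \<otimes> y \<ominus> x' \<otimes> y' = (x \<ominus> x') \<otimes> y \<oplus> x' \<otimes> (y \<ominus> y')"
    using minus_chain[of "x \<otimes> y" "x' \<otimes> y" "x' \<otimes> y'"] assms
    by (simp add: mult_minus_left mult_minus_right mult_closed)
  then show ?thesis
    using nrm_add[of "(x \<ominus> x') \<otimes> y" "x' \<otimes> (y \<ominus> y')"] nrm_mult[of "x \<ominus> x'" y] nrm_mult[of x' "y \<ominus> y'"]
      assms by (simp add: alg_dist_def mult_closed)
qed

text \<open>Multiplication is Lipschitz only on bounded sets. The constant K is therefore required
  for the terms of the two given sequences and not for all elements.\<close>

lemma binary_cauchy:
  assumes s: "s \<in> seqs" and t: "t \<in> seqs" and K: "0 < K"
    and F: "\<And>i j. F (s i) (t i) \<in> carrier A"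
      "\<And>i j. alg_dist A (F (s i) (t i)) (F (s j) (t j)) \<le> K * (alg_dist A (s i) (s j) + alg_dist A (t i) (t j))"
  shows "(\<lambda>n. F (s n) (t n)) \<in> seqs"
  unfolding cauchy_seqs_def
proof (intro CollectI conjI allI impI F(1))
  fix e :: real assume e: "0 < e"
  obtain N1 where N1: "\<And>i j. i \<ge> N1 \<Longrightarrow> j \<ge> N1 \<Longrightarrow> alg_dist A (s i) (s j) < e / (2 * K)"
    using s e K unfolding cauchy_seqs_def by (auto dest!: spec[of _ "e / (2 * K)"])
  obtain N2 where N2: "\<And>i j. i \<ge> N2 \<Longrightarrow> j \<ge> N2 \<Longrightarrow> alg_dist A (t i) (t j) < e / (2 * K)"
    using t e K unfolding cauchy_seqs_def by (auto dest!: spec[of _ "e / (2 * K)"])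
  have "alg_dist A (F (s i) (t i)) (F (s j) (t j)) < e" if "i \<ge> max N1 N2" "j \<ge> max N1 N2" for i j
  proof -
    have "alg_dist A (s i) (s j) + alg_dist A (t i) (t j) < e / K"
      using N1[of i j] N2[of i j] that K by (simp add: field_simps)
    then have "K * (alg_dist A (s i) (s j) + alg_dist A (t i) (t j)) < e"
      using K by (simp add: field_simps)
    with F(2)[of i j] show ?thesis by linarith
  qed
  then show "\<exists>N. \<forall>i\<ge>N. \<forall>j\<ge>N. alg_dist A (F (s i) (t i)) (F (s j) (t j)) < e" by blast
qed

lemma binary_null:
  assumes "\<And>n. F n \<in> carrier A" "\<And>n. F' n \<in> carrier A"
    and "\<And>n. alg_dist A (F n) (F' n) \<le> K * (a n + b n)" "a \<longlonglongrightarrow> 0" "b \<longlonglongrightarrow> 0"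
  shows "(\<lambda>n. alg_dist A (F n) (F' n)) \<longlonglongrightarrow> 0"
proof (rule tendsto_sandwich[OF _ _ tendsto_const])
  show "\<forall>\<^sub>F n in sequentially. 0 \<le> alg_dist A (F n) (F' n)"
    by (intro always_eventually allI alg.d_nonneg assms)
  show "\<forall>\<^sub>F n in sequentially. alg_dist A (F n) (F' n) \<le> K * (a n + b n)"
    by (intro always_eventually allI assms)
  show "(\<lambda>n. K * (a n + b n)) \<longlonglongrightarrow> 0"
    using tendsto_mult_left[OF tendsto_add[OF assms(4,5)], of K] by simp
qed

lemma add_seqs: "s \<in> seqs \<Longrightarrow> t \<in> seqs \<Longrightarrow> (\<lambda>n. s n \<oplus> t n) \<in> seqs"
  by (rule binary_cauchy[where K = 1]) (simp_all add: seqs_mem dist_add_le)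

lemma mult_bound:
  assumes "x \<in> carrier A" "y \<in> carrier A" "x' \<in> carrier A" "y' \<in> carrier A" "nrm A y \<le> K" "nrm A x' \<le> K"
  shows "alg_dist A (x \<otimes> y) (x' \<otimes> y') \<le> K * (alg_dist A x x' + alg_dist A y y')"
  using dist_mult_le[OF assms(1-4)]
    mult_left_mono[OF assms(5) alg.d_nonneg[OF assms(1,3)]]
    mult_right_mono[OF assms(6) alg.d_nonneg[OF assms(2,4)]]
  by (simp add: algebra_simps)

lemma mult_seqs: assumes "s \<in> seqs" "t \<in> seqs" shows "(\<lambda>n. s n \<otimes> t n) \<in> seqs"
proof -
  obtain K where K: "0 < K" "\<And>n. nrm A (s n) \<le> K" using nrm_bounded[OF assms(1)] by blast
  obtain L where L: "0 < L" "\<And>n. nrm A (t n) \<le> L" using nrm_bounded[OF assms(2)] by blast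
  show ?thesis
    by (rule binary_cauchy[where K = "max K L"])
      (use assms K L in \<open>auto intro!: mult_bound simp: seqs_mem mult_closed le_max_iff_disj\<close>)
qed

lemma smult_seqs: "s \<in> seqs \<Longrightarrow> (\<lambda>n. \<alpha> \<odot> s n) \<in> seqs"
  by (rule lipschitz_map.F_cauchy[OF lipschitz_smult])

lemma adj_seqs: "s \<in> seqs \<Longrightarrow> (\<lambda>n. adj A (s n)) \<in> seqs"
  by (rule lipschitz_map.F_cauchy[OF lipschitz_adj])

abbreviation "cls \<equiv> alg_class A"
abbreviation "Ac \<equiv> alg_completion A"

lemma cls_eqI: "s \<in> seqs \<Longrightarrow> t \<in> seqs \<Longrightarrow> (\<lambda>n. alg_dist A (s n) (t n)) \<longlonglongrightarrow> 0 \<Longrightarrow> cls s = cls t"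
  unfolding alg_class_def by (rule alg.cauchy_class_eqI)

lemma cls_memD:
  assumes "t \<in> cls s" shows "t \<in> seqs" "(\<lambda>n. alg_dist A (s n) (t n)) \<longlonglongrightarrow> 0"
  using assms by (simp_all add: alg_class_def cauchy_class_def)

lemma cls_self: "s \<in> seqs \<Longrightarrow> s \<in> cls s"
  unfolding alg_class_def by (rule alg.cauchy_class_self)

lemma carrier_completion: "carrier Ac = cls ` seqs"
  by (simp add: alg_completion_def completion_set_def alg_class_def)

lemma completion_smult: "s \<in> seqs \<Longrightarrow> \<alpha> \<odot>\<^bsub>Ac\<^esub> cls s = cls (\<lambda>n. \<alpha> \<odot> s n)"
  using lipschitz_map.descend_F[OF lipschitz_smult] by (simp add: alg_completion_def alg_class_def)

lemma completion_adj: "s \<in> seqs \<Longrightarrow> adj Ac (cls s) = cls (\<lambda>n. adj A (s n))"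
  using lipschitz_map.descend_F[OF lipschitz_adj] by (simp add: alg_completion_def alg_class_def)

lemma completion_add:
  assumes "s \<in> seqs" "t \<in> seqs" shows "cls s \<oplus>\<^bsub>Ac\<^esub> cls t = cls (\<lambda>n. s n \<oplus> t n)"
proof -
  have "descend2 (\<lambda>s t. cls (\<lambda>n. s n \<oplus> t n)) (cls s) (cls t) = cls (\<lambda>n. s n \<oplus> t n)"
  proof (rule descend2_eqI[OF cls_self[OF assms(1)] cls_self[OF assms(2)]])
    fix s' t' assume "s' \<in> cls s" "t' \<in> cls t"
    note st = cls_memD[OF this(1)] cls_memD[OF this(2)]
    show "cls (\<lambda>n. s' n \<oplus> t' n) = cls (\<lambda>n. s n \<oplus> t n)"
    proof (rule cls_eqI[symmetric])
      show "(\<lambda>n. alg_dist A (s n \<oplus> t n) (s' n \<oplus> t' n)) \<longlonglongrightarrow> 0"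
        by (rule binary_null[where K = 1, OF _ _ _ st(2) st(4)])
          (use assms st in \<open>simp_all add: seqs_mem dist_add_le\<close>)
    qed (use assms st in \<open>simp_all add: add_seqs\<close>)
  qed
  then show ?thesis by (simp add: alg_completion_def)
qed

lemma completion_mult:
  assumes "s \<in> seqs" "t \<in> seqs" shows "cls s \<otimes>\<^bsub>Ac\<^esub> cls t = cls (\<lambda>n. s n \<otimes> t n)"
proof -
  have "descend2 (\<lambda>s t. cls (\<lambda>n. s n \<otimes> t n)) (cls s) (cls t) = cls (\<lambda>n. s n \<otimes> t n)"
  proof (rule descend2_eqI[OF cls_self[OF assms(1)] cls_self[OF assms(2)]])
    fix s' t' assume "s' \<in> cls s" "t' \<in> cls t"
    note st = cls_memD[OF this(1)] cls_memD[OF this(2)]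
    \<comment> \<open>In the telescoped difference the factors left standing are the new left factor
      and the old right factor, so these two sequences need bounds.\<close>
    obtain K where K: "0 < K" "\<And>n. nrm A (s' n) \<le> K" using nrm_bounded[OF st(1)] by blast
    obtain L where L: "0 < L" "\<And>n. nrm A (t n) \<le> L" using nrm_bounded[OF assms(2)] by blast
    show "cls (\<lambda>n. s' n \<otimes> t' n) = cls (\<lambda>n. s n \<otimes> t n)"
    proof (rule cls_eqI[symmetric])
      show "(\<lambda>n. alg_dist A (s n \<otimes> t n) (s' n \<otimes> t' n)) \<longlonglongrightarrow> 0"
        by (rule binary_null[where K = "max K L", OF _ _ _ st(2) st(4)])
          (use assms st K L in \<open>auto intro!: mult_bound simp: seqs_mem mult_closed le_max_iff_disj\<close>)
    qed (use assms st in \<open>simp_all add: mult_seqs\<close>)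
  qed
  then show ?thesis by (simp add: alg_completion_def)
qed

text \<open>The form as a limit lets norm inequalities pass from the terms of a sequence to its
  class.\<close>

lemma completion_nrm:
  assumes s: "s \<in> seqs" shows "(\<lambda>n. nrm A (s n)) \<longlonglongrightarrow> nrm Ac (cls s)"
proof -
  have conv: "(\<lambda>n. nrm A (s n)) \<longlonglongrightarrow> lim (\<lambda>n. nrm A (s n))" if "s \<in> seqs" for s
    using Cauchy_convergent[OF nrm_Cauchy[OF that]] by (simp add: convergent_LIMSEQ_iff)
  have "descend (\<lambda>s. lim (\<lambda>n. nrm A (s n))) (cls s) = lim (\<lambda>n. nrm A (s n))"
    unfolding alg_class_def
  proof (rule alg.descend_cauchy_class[OF s])
    fix t assume t: "t \<in> seqs" "(\<lambda>n. alg_dist A (s n) (t n)) \<longlonglongrightarrow> 0"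
    have "(\<lambda>n. nrm A (s n) - nrm A (t n)) \<longlonglongrightarrow> 0"
      by (rule Lim_null_comparison[OF _ t(2)])
        (use nrm_diff[OF seqs_mem[OF s] seqs_mem[OF t(1)]] in simp)
    moreover have "(\<lambda>n. nrm A (s n) - nrm A (t n)) \<longlonglongrightarrow> lim (\<lambda>n. nrm A (s n)) - lim (\<lambda>n. nrm A (t n))"
      by (intro tendsto_diff conv s t)
    ultimately show "lim (\<lambda>n. nrm A (t n)) = lim (\<lambda>n. nrm A (s n))"
      using LIMSEQ_unique by fastforce
  qed
  with conv[OF s] show ?thesis by (simp add: alg_completion_def)
qed

lemma const_seqs: "x \<in> carrier A \<Longrightarrow> (\<lambda>n. x) \<in> seqs"
  by (rule alg.const_cauchy)

lemma completion_zero: "\<zero>\<^bsub>Ac\<^esub> = cls (\<lambda>n. \<zero>)"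
  by (simp add: alg_completion_def)

text \<open>The axioms are equations and inequalities between continuous expressions, and they hold
  termwise for representing sequences.\<close>

lemma normed_star_algebra_completion: "normed_star_algebra Ac"
proof -
  note [simp] = completion_add completion_smult completion_mult completion_adj completion_zero
    add_seqs smult_seqs mult_seqs adj_seqs seqs_mem
  have c: "cls s \<in> carrier Ac" if "s \<in> seqs" for s
    using that by (simp add: carrier_completion)
  have E: "\<exists>s\<in>seqs. x = cls s" if "x \<in> carrier Ac" for x
    using that by (auto simp: carrier_completion)
  have z: "(\<lambda>n. \<zero>) \<in> seqs" by (simp add: const_seqs)
  show ?thesis
  proof (rule normed_star_algebra.intro)
    show "abelian_group Ac"
    proof (rule abelian_groupI)
      fix x y assume "x \<in> carrier Ac" "y \<in> carrier Ac"
      then obtain s t where st: "s \<in> seqs" "x = cls s" "t \<in> seqs" "y = cls t"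
        by (meson E)
      then show "x \<oplus>\<^bsub>Ac\<^esub> y \<in> carrier Ac" by (simp add: c)
      show "x \<oplus>\<^bsub>Ac\<^esub> y = y \<oplus>\<^bsub>Ac\<^esub> x" using st by (simp add: a_comm)
      show "\<zero>\<^bsub>Ac\<^esub> \<oplus>\<^bsub>Ac\<^esub> x = x" using st z by simp
      show "\<exists>y\<in>carrier Ac. y \<oplus>\<^bsub>Ac\<^esub> x = \<zero>\<^bsub>Ac\<^esub>"
      proof (rule bexI[of _ "cls (\<lambda>n. (-1) \<odot> s n)"])
        have "(-1) \<odot> s n \<oplus> s n = \<zero>" for n
          using a_inv_eq[OF seqs_mem[OF st(1)], of n] l_neg[OF seqs_mem[OF st(1)], of n] by simp
        then show "cls (\<lambda>n. (-1) \<odot> s n) \<oplus>\<^bsub>Ac\<^esub> x = \<zero>\<^bsub>Ac\<^esub>" using st by simp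
      qed (use st in \<open>simp add: c\<close>)
      fix w assume "w \<in> carrier Ac"
      then obtain u where "u \<in> seqs" "w = cls u" by (meson E)
      with st show "x \<oplus>\<^bsub>Ac\<^esub> y \<oplus>\<^bsub>Ac\<^esub> w = x \<oplus>\<^bsub>Ac\<^esub> (y \<oplus>\<^bsub>Ac\<^esub> w)" by (simp add: a_assoc)
    next
      show "\<zero>\<^bsub>Ac\<^esub> \<in> carrier Ac" using z by (simp add: c)
    qed
  next
    fix x \<alpha> \<beta> assume "x \<in> carrier Ac"
    then obtain s where s: "s \<in> seqs" "x = cls s" by (meson E)
    show "\<alpha> \<odot>\<^bsub>Ac\<^esub> x \<in> carrier Ac" "adj Ac x \<in> carrier Ac"
      using s by (simp_all add: c)
    show "(\<alpha> + \<beta>) \<odot>\<^bsub>Ac\<^esub> x = \<alpha> \<odot>\<^bsub>Ac\<^esub> x \<oplus>\<^bsub>Ac\<^esub> \<beta> \<odot>\<^bsub>Ac\<^esub> x"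
      using s by (simp add: smult_add_left)
    show "\<alpha> \<odot>\<^bsub>Ac\<^esub> (\<beta> \<odot>\<^bsub>Ac\<^esub> x) = (\<alpha> * \<beta>) \<odot>\<^bsub>Ac\<^esub> x"
      using s by (simp add: smult_smult)
    show "1 \<odot>\<^bsub>Ac\<^esub> x = x" using s by (simp add: smult_one)
    show "adj Ac (\<alpha> \<odot>\<^bsub>Ac\<^esub> x) = cnj \<alpha> \<odot>\<^bsub>Ac\<^esub> adj Ac x"
      using s by (simp add: adj_smult)
    show "adj Ac (adj Ac x) = x" using s by (simp add: adj_adj)
    show "0 \<le> nrm Ac x"
      using LIMSEQ_le_const[OF completion_nrm[OF s(1)]] s by (simp add: nrm_nonneg)
    show "nrm Ac (\<alpha> \<odot>\<^bsub>Ac\<^esub> x) = norm \<alpha> * nrm Ac x"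
    proof -
      have "(\<lambda>n. nrm A (\<alpha> \<odot> s n)) \<longlonglongrightarrow> norm \<alpha> * nrm Ac x"
        using tendsto_mult_left[OF completion_nrm[OF s(1)], of "norm \<alpha>"] s by (simp add: nrm_smult)
      then show ?thesis
        using completion_nrm[OF smult_seqs[OF s(1)], of \<alpha>] s LIMSEQ_unique by fastforce
    qed
    show "nrm Ac (adj Ac x) \<le> nrm Ac x"
      using LIMSEQ_le[OF completion_nrm[OF adj_seqs[OF s(1)]] completion_nrm[OF s(1)]] s
      by (simp add: nrm_adj)
    fix y assume "y \<in> carrier Ac"
    then obtain t where t: "t \<in> seqs" "y = cls t" by (meson E)
    show "\<alpha> \<odot>\<^bsub>Ac\<^esub> (x \<oplus>\<^bsub>Ac\<^esub> y) = \<alpha> \<odot>\<^bsub>Ac\<^esub> x \<oplus>\<^bsub>Ac\<^esub> \<alpha> \<odot>\<^bsub>Ac\<^esub> y"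
      using s t by (simp add: smult_add)
    show "x \<otimes>\<^bsub>Ac\<^esub> y \<in> carrier Ac" using s t by (simp add: c)
    show "(\<alpha> \<odot>\<^bsub>Ac\<^esub> x) \<otimes>\<^bsub>Ac\<^esub> y = \<alpha> \<odot>\<^bsub>Ac\<^esub> (x \<otimes>\<^bsub>Ac\<^esub> y)"
      using s t by (simp add: mult_smult_left)
    show "x \<otimes>\<^bsub>Ac\<^esub> (\<alpha> \<odot>\<^bsub>Ac\<^esub> y) = \<alpha> \<odot>\<^bsub>Ac\<^esub> (x \<otimes>\<^bsub>Ac\<^esub> y)"
      using s t by (simp add: mult_smult_right)
    show "adj Ac (x \<oplus>\<^bsub>Ac\<^esub> y) = adj Ac x \<oplus>\<^bsub>Ac\<^esub> adj Ac y"
      using s t by (simp add: adj_add)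
    show "nrm Ac (x \<oplus>\<^bsub>Ac\<^esub> y) \<le> nrm Ac x + nrm Ac y"
      using LIMSEQ_le[OF completion_nrm[OF add_seqs[OF s(1) t(1)]]
          tendsto_add[OF completion_nrm[OF s(1)] completion_nrm[OF t(1)]]] s t
      by (simp add: nrm_add)
    show "nrm Ac (x \<otimes>\<^bsub>Ac\<^esub> y) \<le> nrm Ac x * nrm Ac y"
      using LIMSEQ_le[OF completion_nrm[OF mult_seqs[OF s(1) t(1)]]
          tendsto_mult[OF completion_nrm[OF s(1)] completion_nrm[OF t(1)]]] s t
      by (simp add: nrm_mult)
    fix w assume "w \<in> carrier Ac"
    then obtain u where u: "u \<in> seqs" "w = cls u" by (meson E)
    show "(x \<oplus>\<^bsub>Ac\<^esub> y) \<otimes>\<^bsub>Ac\<^esub> w = x \<otimes>\<^bsub>Ac\<^esub> w \<oplus>\<^bsub>Ac\<^esub> y \<otimes>\<^bsub>Ac\<^esub> w"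
      using s t u by (simp add: mult_add_left)
    show "w \<otimes>\<^bsub>Ac\<^esub> (x \<oplus>\<^bsub>Ac\<^esub> y) = w \<otimes>\<^bsub>Ac\<^esub> x \<oplus>\<^bsub>Ac\<^esub> w \<otimes>\<^bsub>Ac\<^esub> y"
      using s t u by (simp add: mult_add_right)
  qed
qed

subsection \<open>The largest C*-seminorm\<close>

text \<open>The set of seminorms in \<open>cstar_normed\<close> is thereby nonempty; together with
  the bound by \<open>nrm A\<close> its supremum is meaningful.\<close>

lemma cstar_seminorm_zero: "cstar_seminorm A (\<lambda>x. 0)"
  by (simp add: cstar_seminorm_def nrm_nonneg)

lemma cstar_bdd: "x \<in> carrier A \<Longrightarrow> bdd_above ((\<lambda>p. p x) ` {p. cstar_seminorm A p})"
  by (rule bdd_aboveI2[where M = "nrm A x"]) (simp add: cstar_seminorm_def)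

lemma le_cstar_nrm: "cstar_seminorm A p \<Longrightarrow> x \<in> carrier A \<Longrightarrow> p x \<le> nrm (cstar_normed A) x"
  unfolding cstar_normed_def using cSUP_upper[of p "{p. cstar_seminorm A p}" "\<lambda>p. p x"] cstar_bdd by simp

lemma cstar_nrm_le:
  assumes "\<And>p. cstar_seminorm A p \<Longrightarrow> p x \<le> c"
  shows "nrm (cstar_normed A) x \<le> c"
  unfolding cstar_normed_def using assms cstar_seminorm_zero by (auto intro!: cSUP_least)

lemma cstar_nrm_nonneg: "x \<in> carrier A \<Longrightarrow> 0 \<le> nrm (cstar_normed A) x"
  using le_cstar_nrm[OF cstar_seminorm_zero] by simp

text \<open>The C*-identity for the adjoint and submultiplicativity bound the square of
  \<open>p (adj A x)\<close> by the product of \<open>p x\<close> and \<open>p (adj A x)\<close>;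
  one factor cancels unless it is zero.\<close>

lemma cstar_seminorm_adj:
  assumes p: "cstar_seminorm A p" and x: "x \<in> carrier A" shows "p (adj A x) \<le> p x"
proof -
  have "(p (adj A x))\<^sup>2 = p (x \<otimes> adj A x)"
    using p adj_closed[OF x] adj_adj[OF x] unfolding cstar_seminorm_def by metis
  also have "\<dots> \<le> p x * p (adj A x)"
    using p x adj_closed[OF x] unfolding cstar_seminorm_def by blast
  finally have "p (adj A x) * p (adj A x) \<le> p x * p (adj A x)" by (simp add: power2_eq_square)
  moreover have "0 \<le> p x" "0 \<le> p (adj A x)"
    using p x adj_closed[OF x] unfolding cstar_seminorm_def by blast+
  ultimately show ?thesis
    by (metis mult_right_le_imp_le order_le_less)
qed

lemma cstar_normed_simps [simp]:
  "carrier (cstar_normed A) = carrier A" "monoid.mult (cstar_normed A) = monoid.mult A"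
  "one (cstar_normed A) = one A" "ring.zero (cstar_normed A) = ring.zero A"
  "ring.add (cstar_normed A) = ring.add A" "module.smult (cstar_normed A) = module.smult A"
  "adj (cstar_normed A) = adj A"
  by (simp_all add: cstar_normed_def)

lemma normed_star_algebra_cstar: "normed_star_algebra (cstar_normed A)"
proof (rule normed_star_algebra.intro)
  show "abelian_group (cstar_normed A)"
    by (rule abelian_groupI)
      (auto simp: a_ac l_neg intro: bexI[of _ "\<ominus> _"])
  fix x \<alpha> assume x: "x \<in> carrier (cstar_normed A)"
  then show "0 \<le> nrm (cstar_normed A) x" by (simp add: cstar_nrm_nonneg)
  show "nrm (cstar_normed A) (\<alpha> \<odot>\<^bsub>cstar_normed A\<^esub> x) = norm \<alpha> * nrm (cstar_normed A) x"
  proof -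
    have le: "nrm (cstar_normed A) (\<alpha> \<odot> x) \<le> norm \<alpha> * nrm (cstar_normed A) x"
      if "x \<in> carrier A" for \<alpha> x
    proof (rule cstar_nrm_le)
      fix p assume p: "cstar_seminorm A p"
      then have "p (\<alpha> \<odot> x) = norm \<alpha> * p x" using that unfolding cstar_seminorm_def by blast
      then show "p (\<alpha> \<odot> x) \<le> norm \<alpha> * nrm (cstar_normed A) x"
        using le_cstar_nrm[OF p that] by (simp add: mult_left_mono)
    qed
    \<comment> \<open>The supremum gives only an upper bound for scalar multiples. The reverse bound
      comes from applying it with the inverse scalar, which leaves zero as a separate case.\<close>
    show ?thesis
    proof (cases "\<alpha> = 0")
      case True
      then show ?thesis using le[of x 0] x cstar_nrm_nonneg[OF smult_closed[of x 0]] by simp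
    next
      case False
      have "nrm (cstar_normed A) x \<le> norm (inverse \<alpha>) * nrm (cstar_normed A) (\<alpha> \<odot> x)"
        using le[of "\<alpha> \<odot> x" "inverse \<alpha>"] x False by (simp add: smult_closed smult_smult smult_one)
      then have "norm \<alpha> * nrm (cstar_normed A) x \<le> nrm (cstar_normed A) (\<alpha> \<odot> x)"
        using False by (simp add: norm_divide field_simps)
      with le[of x \<alpha>] x show ?thesis by simp
    qed
  qed
  show "nrm (cstar_normed A) (adj (cstar_normed A) x) \<le> nrm (cstar_normed A) x"
  proof (rule cstar_nrm_le)
    fix p assume p: "cstar_seminorm A p"
    show "p (adj (cstar_normed A) x) \<le> nrm (cstar_normed A) x"
      using cstar_seminorm_adj[OF p, of x] le_cstar_nrm[OF p, of x] x by simp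
  qed
  fix y assume y: "y \<in> carrier (cstar_normed A)"
  show "nrm (cstar_normed A) (x \<oplus>\<^bsub>cstar_normed A\<^esub> y) \<le> nrm (cstar_normed A) x + nrm (cstar_normed A) y"
  proof (rule cstar_nrm_le)
    fix p assume p: "cstar_seminorm A p"
    then have "p (x \<oplus> y) \<le> p x + p y" using x y unfolding cstar_seminorm_def by simp
    then show "p (x \<oplus>\<^bsub>cstar_normed A\<^esub> y) \<le> nrm (cstar_normed A) x + nrm (cstar_normed A) y"
      using le_cstar_nrm[OF p, of x] le_cstar_nrm[OF p, of y] x y by simp
  qed
  show "nrm (cstar_normed A) (x \<otimes>\<^bsub>cstar_normed A\<^esub> y) \<le> nrm (cstar_normed A) x * nrm (cstar_normed A) y"
  proof (rule cstar_nrm_le)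
    fix p assume p: "cstar_seminorm A p"
    then have "p (x \<otimes> y) \<le> p x * p y" "0 \<le> p x" "0 \<le> p y"
      using x y unfolding cstar_seminorm_def by simp_all
    moreover have "p x * p y \<le> nrm (cstar_normed A) x * nrm (cstar_normed A) y"
      by (intro mult_mono) (use le_cstar_nrm[OF p] x y calculation cstar_nrm_nonneg in auto)
    ultimately show "p (x \<otimes>\<^bsub>cstar_normed A\<^esub> y) \<le> nrm (cstar_normed A) x * nrm (cstar_normed A) y"
      by simp
  qed
qed (simp_all add: smult_closed smult_add_left smult_add smult_smult smult_one mult_closed
    mult_add_left mult_add_right mult_smult_left mult_smult_right adj_closed adj_add adj_smult adj_adj)

end

subsection \<open>Contractive *-homomorphisms\<close>

locale contractive_star_hom = src: normed_star_algebra A + dst: normed_star_algebra B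
  for A :: "'a star_algebra" and B :: "'b star_algebra" +
  fixes F :: "'a \<Rightarrow> 'b"
  assumes hom_closed: "x \<in> carrier A \<Longrightarrow> F x \<in> carrier B"
    and hom_add: "x \<in> carrier A \<Longrightarrow> y \<in> carrier A \<Longrightarrow> F (x \<oplus>\<^bsub>A\<^esub> y) = F x \<oplus>\<^bsub>B\<^esub> F y"
    and hom_smult: "x \<in> carrier A \<Longrightarrow> F (\<alpha> \<odot>\<^bsub>A\<^esub> x) = \<alpha> \<odot>\<^bsub>B\<^esub> F x"
    and hom_mult: "x \<in> carrier A \<Longrightarrow> y \<in> carrier A \<Longrightarrow> F (x \<otimes>\<^bsub>A\<^esub> y) = F x \<otimes>\<^bsub>B\<^esub> F y"
    and hom_adj: "x \<in> carrier A \<Longrightarrow> F (adj A x) = adj B (F x)"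
    and hom_nrm: "x \<in> carrier A \<Longrightarrow> nrm B (F x) \<le> nrm A x"
begin

lemma hom_minus: "x \<in> carrier A \<Longrightarrow> y \<in> carrier A \<Longrightarrow> F (x \<ominus>\<^bsub>A\<^esub> y) = F x \<ominus>\<^bsub>B\<^esub> F y"
  by (simp add: src.minus_eq' dst.minus_eq' hom_add hom_smult hom_closed src.smult_closed)

sublocale lipschitz_map "carrier A" "alg_dist A" "carrier B" "alg_dist B" F 1
  by unfold_locales (simp_all add: hom_closed alg_dist_def hom_minus[symmetric] hom_nrm)

lemma extend_map_cls: "s \<in> src.seqs \<Longrightarrow> extend_map B F (src.cls s) = dst.cls (\<lambda>n. F (s n))"
  using descend_F by (simp add: extend_map_def alg_class_def)

lemma extend_map_embed: "x \<in> carrier A \<Longrightarrow> extend_map B F (alg_embed A x) = alg_embed B (F x)"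
  unfolding alg_embed_def by (rule extend_map_cls) (rule src.const_seqs)

lemma contractive_star_hom_completion:
  "contractive_star_hom (alg_completion A) (alg_completion B) (extend_map B F)"
proof (intro contractive_star_hom.intro contractive_star_hom_axioms.intro
    src.normed_star_algebra_completion dst.normed_star_algebra_completion)
  note [simp] = src.completion_add src.completion_smult src.completion_mult src.completion_adj
    src.add_seqs src.smult_seqs src.mult_seqs src.adj_seqs src.seqs_mem
    dst.completion_add dst.completion_smult dst.completion_mult dst.completion_adj
    F_cauchy extend_map_cls
  have E: "\<exists>s\<in>src.seqs. x = src.cls s" if "x \<in> carrier (alg_completion A)" for x
    using that by (auto simp: src.carrier_completion)
  fix x \<alpha> assume "x \<in> carrier (alg_completion A)"
  then obtain s where s: "s \<in> src.seqs" "x = src.cls s" by (meson E)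
  show "extend_map B F x \<in> carrier (alg_completion B)"
    using s by (simp add: dst.carrier_completion)
  show "extend_map B F (\<alpha> \<odot>\<^bsub>alg_completion A\<^esub> x) = \<alpha> \<odot>\<^bsub>alg_completion B\<^esub> extend_map B F x"
    using s by (simp add: hom_smult)
  show "extend_map B F (adj (alg_completion A) x) = adj (alg_completion B) (extend_map B F x)"
    using s by (simp add: hom_adj)
  show "nrm (alg_completion B) (extend_map B F x) \<le> nrm (alg_completion A) x"
    using LIMSEQ_le[OF dst.completion_nrm[OF F_cauchy[OF s(1)]] src.completion_nrm[OF s(1)]] s
    by (simp add: hom_nrm)
  fix y assume "y \<in> carrier (alg_completion A)"
  then obtain t where t: "t \<in> src.seqs" "y = src.cls t" by (meson E)
  show "extend_map B F (x \<oplus>\<^bsub>alg_completion A\<^esub> y) = extend_map B F x \<oplus>\<^bsub>alg_completion B\<^esub> extend_map B F y"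
    using s t by (simp add: hom_add)
  show "extend_map B F (x \<otimes>\<^bsub>alg_completion A\<^esub> y) = extend_map B F x \<otimes>\<^bsub>alg_completion B\<^esub> extend_map B F y"
    using s t by (simp add: hom_mult)
qed

text \<open>C*-seminorms pull back along *-homomorphisms.\<close>

lemma contractive_star_hom_cstar: "contractive_star_hom (cstar_normed A) (cstar_normed B) F"
proof (intro contractive_star_hom.intro contractive_star_hom_axioms.intro
    src.normed_star_algebra_cstar dst.normed_star_algebra_cstar)
  fix x assume x: "x \<in> carrier (cstar_normed A)"
  show "nrm (cstar_normed B) (F x) \<le> nrm (cstar_normed A) x"
  proof (rule dst.cstar_nrm_le)
    fix p assume p: "cstar_seminorm B p"
    have "cstar_seminorm A (\<lambda>x. p (F x))"
      unfolding cstar_seminorm_def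
    proof (intro conjI ballI allI)
      fix x y \<alpha> assume c: "x \<in> carrier A"
      note F = hom_closed[OF c]
      show "0 \<le> p (F x)" using p F unfolding cstar_seminorm_def by blast
      show "p (F (\<alpha> \<odot>\<^bsub>A\<^esub> x)) = norm \<alpha> * p (F x)"
        using p F unfolding hom_smult[OF c] cstar_seminorm_def by blast
      show "p (F (adj A x \<otimes>\<^bsub>A\<^esub> x)) = (p (F x))\<^sup>2"
        using p F c unfolding cstar_seminorm_def by (simp add: hom_mult hom_adj src.adj_closed)
      have "p (F x) \<le> nrm B (F x)" using p F unfolding cstar_seminorm_def by blast
      then show "p (F x) \<le> nrm A x" using hom_nrm[OF c] by linarith
      assume d: "y \<in> carrier A"
      show "p (F (x \<oplus>\<^bsub>A\<^esub> y)) \<le> p (F x) + p (F y)"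
        using p F hom_closed[OF d] unfolding hom_add[OF c d] cstar_seminorm_def by blast
      show "p (F (x \<otimes>\<^bsub>A\<^esub> y)) \<le> p (F x) * p (F y)"
        using p F hom_closed[OF d] unfolding hom_mult[OF c d] cstar_seminorm_def by blast
    qed
    then show "p (F x) \<le> nrm (cstar_normed A) x"
      using src.le_cstar_nrm x by simp
  qed
qed (simp_all add: hom_closed hom_add hom_smult hom_mult hom_adj)

end

subsection \<open>Representations on $\ell^2$\<close>

lift_definition cscale_blinfun :: "complex \<Rightarrow> 'i ell2 \<Rightarrow>\<^sub>L 'i ell2" is cscale
  by (rule bounded_linear_cscale)

lemma cscale_blinfun_apply [simp]: "cscale_blinfun \<alpha> x = cscale \<alpha> x"
  by transfer simp

text \<open>The adjoint relation uses the real inner product; combined with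
  \<open>rep_cscale\<close> it gives the Hermitian one. The unit is allowed to act as a
  projection.\<close>

locale star_rep = normed_star_algebra A
  for A :: "'a star_algebra" (structure) and \<rho> :: "'a \<Rightarrow> 'i ell2 \<Rightarrow>\<^sub>L 'i ell2" +
  assumes rep_add: "x \<in> carrier A \<Longrightarrow> y \<in> carrier A \<Longrightarrow> \<rho> (x \<oplus> y) = \<rho> x + \<rho> y"
    and rep_smult: "x \<in> carrier A \<Longrightarrow> \<rho> (\<alpha> \<odot> x) = cscale_blinfun \<alpha> o\<^sub>L \<rho> x"
    and rep_mult: "x \<in> carrier A \<Longrightarrow> y \<in> carrier A \<Longrightarrow> \<rho> (x \<otimes> y) = \<rho> x o\<^sub>L \<rho> y"
    and rep_adj: "x \<in> carrier A \<Longrightarrow> \<rho> (adj A x) v \<bullet> w = v \<bullet> \<rho> x w"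
    and rep_cscale: "x \<in> carrier A \<Longrightarrow> \<rho> x (cscale \<alpha> v) = cscale \<alpha> (\<rho> x v)"
    and rep_norm: "x \<in> carrier A \<Longrightarrow> norm (\<rho> x) \<le> nrm A x"
begin

lemma rep_minus: "x \<in> carrier A \<Longrightarrow> y \<in> carrier A \<Longrightarrow> \<rho> (x \<ominus> y) = \<rho> x - \<rho> y"
  by (rule blinfun_eqI)
    (simp add: minus_eq' rep_add rep_smult smult_closed blinfun.add_left blinfun.diff_left)

lemma rep_dist: "x \<in> carrier A \<Longrightarrow> y \<in> carrier A \<Longrightarrow> norm (\<rho> x - \<rho> y) \<le> alg_dist A x y"
  using rep_norm[of "x \<ominus> y"] by (simp add: rep_minus alg_dist_def)

lemma rep_convergent: assumes "s \<in> seqs" shows "(\<lambda>n. \<rho> (s n)) \<longlonglongrightarrow> lim (\<lambda>n. \<rho> (s n))"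
proof -
  have "Cauchy (\<lambda>n. \<rho> (s n))"
  proof (rule CauchyI)
    fix e :: real assume "0 < e"
    then obtain N where N: "\<And>i j. i \<ge> N \<Longrightarrow> j \<ge> N \<Longrightarrow> alg_dist A (s i) (s j) < e"
      using assms unfolding cauchy_seqs_def by blast
    have "norm (\<rho> (s i) - \<rho> (s j)) < e" if "i \<ge> N" "j \<ge> N" for i j
      using N[OF that] rep_dist[OF seqs_mem[OF assms] seqs_mem[OF assms], of i j] by linarith
    then show "\<exists>M. \<forall>m\<ge>M. \<forall>n\<ge>M. norm (\<rho> (s m) - \<rho> (s n)) < e" by blast
  qed
  then show ?thesis
    using Cauchy_convergent convergent_LIMSEQ_iff by blast
qed

definition extend_rep :: "(nat \<Rightarrow> 'a) set \<Rightarrow> 'i ell2 \<Rightarrow>\<^sub>L 'i ell2" where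
  "extend_rep = descend (\<lambda>s. lim (\<lambda>n. \<rho> (s n)))"

lemma lim_rep_cong:
  assumes s: "s \<in> seqs" and t: "t \<in> seqs" and st: "(\<lambda>n. alg_dist A (s n) (t n)) \<longlonglongrightarrow> 0"
  shows "lim (\<lambda>n. \<rho> (t n)) = lim (\<lambda>n. \<rho> (s n))"
proof -
  have "(\<lambda>n. \<rho> (s n) - \<rho> (t n)) \<longlonglongrightarrow> 0"
    by (rule Lim_null_comparison[OF _ st])
      (use rep_dist[OF seqs_mem[OF s] seqs_mem[OF t]] in simp)
  moreover have "(\<lambda>n. \<rho> (s n) - \<rho> (t n)) \<longlonglongrightarrow> lim (\<lambda>n. \<rho> (s n)) - lim (\<lambda>n. \<rho> (t n))"
    by (intro tendsto_diff rep_convergent s t)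
  ultimately show ?thesis
    using LIMSEQ_unique by fastforce
qed

lemma extend_rep_cls: assumes "s \<in> seqs" shows "extend_rep (cls s) = lim (\<lambda>n. \<rho> (s n))"
  unfolding extend_rep_def alg_class_def
  by (rule alg.descend_cauchy_class[OF assms]) (rule lim_rep_cong[OF assms])

lemma extend_rep_tendsto: "s \<in> seqs \<Longrightarrow> (\<lambda>n. \<rho> (s n)) \<longlonglongrightarrow> extend_rep (cls s)"
  using rep_convergent extend_rep_cls by simp

lemma extend_rep_eqI: "s \<in> seqs \<Longrightarrow> (\<lambda>n. \<rho> (s n)) \<longlonglongrightarrow> L \<Longrightarrow> extend_rep (cls s) = L"
  using LIMSEQ_unique extend_rep_tendsto by blast

lemma extend_rep_embed: "x \<in> carrier A \<Longrightarrow> extend_rep (alg_embed A x) = \<rho> x"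
  unfolding alg_embed_def by (rule extend_rep_eqI[OF const_seqs]) auto

text \<open>Vanishing of a coordinate is a closed condition. This will confine the represented
  vectors to functions supported on the lattice.\<close>

lemma extend_rep_coord_zero:
  assumes 0: "\<And>x. x \<in> carrier A \<Longrightarrow> coord (\<rho> x v) i = 0" and C: "C \<in> carrier Ac"
  shows "coord (extend_rep C v) i = 0"
proof -
  obtain s where s: "s \<in> seqs" "C = cls s" using C by (auto simp: carrier_completion)
  have "(\<lambda>n. coord (\<rho> (s n) v) i) \<longlonglongrightarrow> coord (extend_rep C v) i"
    unfolding s(2)
    by (intro bounded_linear.tendsto[OF bounded_linear_coord] blinfun.tendsto extend_rep_tendsto s tendsto_const)
  then show ?thesis
    using LIMSEQ_unique[OF _ tendsto_const] by (simp add: 0 seqs_mem s(1))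
qed

lemma star_rep_completion: "star_rep Ac extend_rep"
proof (intro star_rep.intro star_rep_axioms.intro normed_star_algebra_completion)
  note [simp] = completion_add completion_smult completion_mult completion_adj
    add_seqs smult_seqs mult_seqs adj_seqs seqs_mem
  note comp = bounded_bilinear.tendsto[OF bounded_bilinear_blinfun_compose]
  have E: "\<exists>s\<in>seqs. x = cls s" if "x \<in> carrier Ac" for x
    using that by (auto simp: carrier_completion)
  fix x \<alpha> and v w :: "'i ell2" assume "x \<in> carrier Ac"
  then obtain s where s: "s \<in> seqs" "x = cls s" by (meson E)
  note L = extend_rep_tendsto[OF s(1)]
  have app: "(\<lambda>n. \<rho> (s n) u) \<longlonglongrightarrow> extend_rep (cls s) u" if "s \<in> seqs" for s u
    by (intro blinfun.tendsto extend_rep_tendsto that tendsto_const)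
  show "extend_rep (\<alpha> \<odot>\<^bsub>Ac\<^esub> x) = cscale_blinfun \<alpha> o\<^sub>L extend_rep x"
    using extend_rep_eqI[OF smult_seqs[OF s(1)], of \<alpha>] comp[OF tendsto_const L, of "cscale_blinfun \<alpha>"] s
    by (simp add: rep_smult)
  show "extend_rep (adj Ac x) v \<bullet> w = v \<bullet> extend_rep x w"
  proof -
    have "(\<lambda>n. \<rho> (adj A (s n)) v \<bullet> w) \<longlonglongrightarrow> extend_rep (adj Ac x) v \<bullet> w"
      using app[OF adj_seqs[OF s(1)], of v] s by (auto intro!: tendsto_intros)
    moreover have "(\<lambda>n. \<rho> (adj A (s n)) v \<bullet> w) \<longlonglongrightarrow> v \<bullet> extend_rep x w"
      using app[OF s(1), of w] s by (auto simp: rep_adj intro!: tendsto_intros)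
    ultimately show ?thesis by (rule LIMSEQ_unique)
  qed
  show "extend_rep x (cscale \<alpha> v) = cscale \<alpha> (extend_rep x v)"
  proof -
    have "(\<lambda>n. \<rho> (s n) (cscale \<alpha> v)) \<longlonglongrightarrow> cscale \<alpha> (extend_rep x v)"
      using tendsto_cscale[OF app[OF s(1), of v], of \<alpha>] s by (simp add: rep_cscale)
    with app[OF s(1), of "cscale \<alpha> v"] s show ?thesis using LIMSEQ_unique by blast
  qed
  show "norm (extend_rep x) \<le> nrm Ac x"
    using LIMSEQ_le[OF tendsto_norm[OF L] completion_nrm[OF s(1)]] s by (simp add: rep_norm)
  fix y assume "y \<in> carrier Ac"
  then obtain t where t: "t \<in> seqs" "y = cls t" by (meson E)
  note L' = extend_rep_tendsto[OF t(1)]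
  show "extend_rep (x \<oplus>\<^bsub>Ac\<^esub> y) = extend_rep x + extend_rep y"
    using extend_rep_eqI[OF add_seqs[OF s(1) t(1)]] tendsto_add[OF L L'] s t by (simp add: rep_add)
  show "extend_rep (x \<otimes>\<^bsub>Ac\<^esub> y) = extend_rep x o\<^sub>L extend_rep y"
    using extend_rep_eqI[OF mult_seqs[OF s(1) t(1)]] comp[OF L L'] s t by (simp add: rep_mult)
qed

text \<open>The squared norm of \<open>\<rho> (adj A x) v\<close> is the inner product of v with
  \<open>\<rho> x\<close> applied to that same vector; by Cauchy-Schwarz one factor of the norm
  cancels.\<close>

lemma norm_rep_adj_le: assumes "x \<in> carrier A" shows "norm (\<rho> (adj A x)) \<le> norm (\<rho> x)"
proof (rule norm_blinfun_bound)
  fix v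
  let ?y = "\<rho> (adj A x) v"
  have "norm ?y * norm ?y = v \<bullet> \<rho> x ?y"
    using rep_adj[OF assms, of v ?y] by (simp add: power2_norm_eq_inner flip: power2_eq_square)
  also have "\<dots> \<le> norm v * (norm (\<rho> x) * norm ?y)"
    using norm_cauchy_schwarz[of v "\<rho> x ?y"] norm_blinfun[of "\<rho> x" ?y]
    by (meson mult_left_mono norm_ge_zero order_trans)
  finally have "norm ?y * norm ?y \<le> (norm (\<rho> x) * norm v) * norm ?y" by (simp add: algebra_simps)
  then show "norm ?y \<le> norm (\<rho> x) * norm v"
    by (metis mult_nonneg_nonneg mult_right_le_imp_le norm_ge_zero order_le_less)
qed simp

lemma cstar_seminorm_rep: "cstar_seminorm A (\<lambda>x. norm (\<rho> x))"
  unfolding cstar_seminorm_def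
proof (intro conjI ballI allI)
  fix x y \<alpha> assume x: "x \<in> carrier A"
  show "norm (\<rho> x) \<le> nrm A x" by (rule rep_norm[OF x])
  show "norm (\<rho> (\<alpha> \<odot> x)) = norm \<alpha> * norm (\<rho> x)"
  proof -
    have le: "norm (\<rho> (\<alpha> \<odot> x)) \<le> norm \<alpha> * norm (\<rho> x)" if x: "x \<in> carrier A" for \<alpha> x
    proof (rule norm_blinfun_bound)
      fix v
      show "norm (\<rho> (\<alpha> \<odot> x) v) \<le> norm \<alpha> * norm (\<rho> x) * norm v"
        using mult_left_mono[OF norm_blinfun[of "\<rho> x" v] norm_ge_zero[of \<alpha>]] rep_smult[OF x]
        by (simp add: mult.assoc)
    qed simp
    show ?thesis
    proof (cases "\<alpha> = 0")
      case True
      then show ?thesis using le[OF x, of 0] by simp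
    next
      case False
      have "norm (\<rho> x) \<le> norm (inverse \<alpha>) * norm (\<rho> (\<alpha> \<odot> x))"
        using le[OF smult_closed[OF x], of "inverse \<alpha>" \<alpha>] x False by (simp add: smult_smult smult_one)
      then have "norm \<alpha> * norm (\<rho> x) \<le> norm (\<rho> (\<alpha> \<odot> x))"
        using False by (simp add: norm_divide field_simps)
      with le[OF x, of \<alpha>] show ?thesis by simp
    qed
  qed
  show "norm (\<rho> (adj A x \<otimes> x)) = (norm (\<rho> x))\<^sup>2"
  proof (rule antisym)
    show "norm (\<rho> (adj A x \<otimes> x)) \<le> (norm (\<rho> x))\<^sup>2"
      using norm_blinfun_compose[of "\<rho> (adj A x)" "\<rho> x"]
        mult_right_mono[OF norm_rep_adj_le[OF x] norm_ge_zero[of "\<rho> x"]]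
      by (simp add: rep_mult adj_closed x power2_eq_square)
    \<comment> \<open>The nontrivial half of the C*-identity: the squared norm of
      \<open>\<rho> x v\<close> is the inner product of
      \<open>\<rho> (adj A x \<otimes> x) v\<close> with v. The square root puts this in the form of
      an operator norm bound.\<close>
    have "norm (\<rho> x) \<le> sqrt (norm (\<rho> (adj A x \<otimes> x)))"
    proof (rule norm_blinfun_bound)
      fix v
      have "(norm (\<rho> x v))\<^sup>2 = \<rho> (adj A x \<otimes> x) v \<bullet> v"
        using rep_adj[OF x, of "\<rho> x v" v] by (simp add: power2_norm_eq_inner rep_mult adj_closed x)
      also have "\<dots> \<le> norm (\<rho> (adj A x \<otimes> x)) * norm v * norm v"
        using norm_cauchy_schwarz[of "\<rho> (adj A x \<otimes> x) v" v]
          mult_right_mono[OF norm_blinfun[of "\<rho> (adj A x \<otimes> x)" v] norm_ge_zero[of v]] by linarith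
      also have "\<dots> = (sqrt (norm (\<rho> (adj A x \<otimes> x))) * norm v)\<^sup>2"
        by (simp add: power2_eq_square algebra_simps)
      finally show "norm (\<rho> x v) \<le> sqrt (norm (\<rho> (adj A x \<otimes> x))) * norm v"
        by (rule power2_le_imp_le) simp
    qed simp
    then show "(norm (\<rho> x))\<^sup>2 \<le> norm (\<rho> (adj A x \<otimes> x))"
      by (metis norm_ge_zero power_mono real_sqrt_pow2)
  qed
  assume y: "y \<in> carrier A"
  show "norm (\<rho> (x \<oplus> y)) \<le> norm (\<rho> x) + norm (\<rho> y)"
    by (simp add: rep_add x y norm_triangle_ineq)
  show "norm (\<rho> (x \<otimes> y)) \<le> norm (\<rho> x) * norm (\<rho> y)"
    by (simp add: rep_mult x y norm_blinfun_compose)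
qed simp

text \<open>The operator norm is one of the seminorms under the supremum. Hence the same map is
  contractive for the enveloping norm and can be extended a second time.\<close>

lemma star_rep_cstar: "star_rep (cstar_normed A) \<rho>"
proof (intro star_rep.intro star_rep_axioms.intro normed_star_algebra_cstar)
  show "norm (\<rho> x) \<le> nrm (cstar_normed A) x" if "x \<in> carrier (cstar_normed A)" for x
    using le_cstar_nrm[OF cstar_seminorm_rep, of x] that by simp
qed (simp_all add: rep_add rep_smult rep_mult rep_adj rep_cscale)

lemma extend_fun_vector_state:
  assumes F: "\<And>x. x \<in> carrier A \<Longrightarrow> F x = cinner e (\<rho> x e)" and C: "C \<in> carrier Ac"
  shows "extend_fun F C = cinner e (extend_rep C e)"
proof -
  obtain s where s: "s \<in> seqs" "C = cls s" using C by (auto simp: carrier_completion)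
  have "lim (\<lambda>n. F (t n)) = cinner e (extend_rep C e)" if "t \<in> cls s" for t
  proof -
    note t = cls_memD[OF that]
    have "cls t = C" unfolding s(2) by (rule cls_eqI[OF s(1) t, symmetric])
    then have "(\<lambda>n. \<rho> (t n) e) \<longlonglongrightarrow> extend_rep C e"
      using blinfun.tendsto[OF extend_rep_tendsto[OF t(1)] tendsto_const, of e] by simp
    then have "(\<lambda>n. F (t n)) \<longlonglongrightarrow> cinner e (extend_rep C e)"
      by (simp add: F seqs_mem t(1) tendsto_intros)
    then show ?thesis by (rule limI)
  qed
  then show ?thesis
    unfolding extend_fun_def s(2) by (intro descend_eqI[OF cls_self[OF s(1)]])
qed

end

text \<open>Composition of bounded operators is continuous in the operator norm, so an intertwining
  relation survives the passage to limits.\<close>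

lemma intertwiner_completion:
  assumes "contractive_star_hom A B F" "star_rep A \<rho>" "star_rep B \<rho>'"
    and T: "\<And>x. x \<in> carrier A \<Longrightarrow> T o\<^sub>L \<rho> x = \<rho>' (F x) o\<^sub>L T"
    and C: "C \<in> carrier (alg_completion A)"
  shows "T o\<^sub>L star_rep.extend_rep \<rho> C = star_rep.extend_rep \<rho>' (extend_map B F C) o\<^sub>L T"
proof -
  interpret \<rho>: star_rep A \<rho> by fact
  interpret \<rho>': star_rep B \<rho>' by fact
  interpret F: contractive_star_hom A B F by fact
  note comp = bounded_bilinear.tendsto[OF bounded_bilinear_blinfun_compose]
  obtain s where s: "s \<in> \<rho>.seqs" "C = \<rho>.cls s" using C by (auto simp: \<rho>.carrier_completion)
  have "(\<lambda>n. T o\<^sub>L \<rho> (s n)) \<longlonglongrightarrow> (T o\<^sub>L \<rho>.extend_rep C)"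
    unfolding s(2) by (intro comp tendsto_const \<rho>.extend_rep_tendsto s)
  moreover have "(\<lambda>n. \<rho>' (F (s n)) o\<^sub>L T) \<longlonglongrightarrow> (\<rho>'.extend_rep (extend_map B F C) o\<^sub>L T)"
    unfolding s(2) F.extend_map_cls[OF s(1)]
    by (intro comp tendsto_const \<rho>'.extend_rep_tendsto F.F_cauchy s)
  ultimately show ?thesis
    using T[OF \<rho>.seqs_mem[OF s(1)]] LIMSEQ_unique by simp
qed

subsection \<open>The GNS space of a vector state\<close>

text \<open>The vector space laws of H are not postulated; injectivity of J transports them back
  from \<open>ell2\<close>.\<close>

locale hilbert_model =
  fixes H :: "'v inner_space" (structure) and J :: "'v \<Rightarrow> 'i ell2"
  assumes J_inj: "inj_on J (carrier H)"
    and zero_mem: "\<zero> \<in> carrier H" and J_zero: "J \<zero> = 0"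
    and add_mem: "x \<in> carrier H \<Longrightarrow> y \<in> carrier H \<Longrightarrow> x \<oplus> y \<in> carrier H"
    and J_add: "x \<in> carrier H \<Longrightarrow> y \<in> carrier H \<Longrightarrow> J (x \<oplus> y) = J x + J y"
    and smult_mem: "x \<in> carrier H \<Longrightarrow> \<alpha> \<odot> x \<in> carrier H"
    and J_smult: "x \<in> carrier H \<Longrightarrow> J (\<alpha> \<odot> x) = cscale \<alpha> (J x)"
    and J_ip: "x \<in> carrier H \<Longrightarrow> y \<in> carrier H \<Longrightarrow> ip H x y = cinner (J x) (J y)"
begin

lemma J_eqI: "x \<in> carrier H \<Longrightarrow> y \<in> carrier H \<Longrightarrow> J x = J y \<Longrightarrow> x = y"
  using J_inj by (auto dest: inj_onD)

text \<open>The finite sums in \<open>lincomb\<close> are sums in an abelian monoid; this makes them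
  unfold one term at a time.\<close>

sublocale abelian_monoid H
  by (rule abelian_monoidI)
    (auto intro!: J_eqI simp: zero_mem add_mem J_add J_zero add_ac)

lemma lincomb_mem:
  assumes "\<And>j. j \<in> F \<Longrightarrow> e j \<in> carrier H"
  shows "lincomb H e \<alpha> F \<in> carrier H"
  unfolding lincomb_def using assms by (intro finsum_closed) (auto simp: smult_mem)

lemma J_lincomb:
  assumes "finite F" "\<And>j. j \<in> F \<Longrightarrow> e j \<in> carrier H"
  shows "J (lincomb H e \<alpha> F) = (\<Sum>j\<in>F. cscale (\<alpha> j) (J (e j)))"
  using assms
proof (induction F rule: finite_induct)
  case empty
  then show ?case by (simp add: lincomb_def J_zero)
next
  case (insert j F)
  have "lincomb H e \<alpha> (insert j F) = \<alpha> j \<odot> e j \<oplus> lincomb H e \<alpha> F"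
    unfolding lincomb_def using insert by (intro finsum_insert) (auto simp: smult_mem)
  then show ?case
    using insert lincomb_mem[of F e \<alpha>] by (simp add: J_add J_smult smult_mem)
qed

lemma hnorm_eq: "x \<in> carrier H \<Longrightarrow> hnorm H x = norm (J x)"
  by (simp add: hnorm_def J_ip cinner_self)

end

text \<open>The operator T is defined on all of \<open>ell2\<close> but controlled only on the range
  of J, where it is unitary onto the range of J'. In the application it kills the functions
  supported off the lattice, so a global isometry cannot be asked for.\<close>

locale hilbert_model_map = src: hilbert_model H J + dst: hilbert_model K J'
  for H :: "'v inner_space" and J :: "'v \<Rightarrow> 'i ell2" and K :: "'w inner_space" and J' :: "'w \<Rightarrow> 'j ell2" +
  fixes T :: "'i ell2 \<Rightarrow>\<^sub>L 'j ell2"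
  assumes T_image: "T ` J ` carrier H = J' ` carrier K"
    and T_cscale: "T (cscale \<alpha> v) = cscale \<alpha> (T v)"
    and T_cinner: "x \<in> carrier H \<Longrightarrow> y \<in> carrier H \<Longrightarrow> cinner (T (J x)) (T (J y)) = cinner (J x) (J y)"
begin

definition U :: "'v \<Rightarrow> 'w" where "U x = inv_into (carrier K) J' (T (J x))"

lemma U_mem: "x \<in> carrier H \<Longrightarrow> U x \<in> carrier K"
  and J_U: "x \<in> carrier H \<Longrightarrow> J' (U x) = T (J x)"
proof -
  assume "x \<in> carrier H"
  then have "T (J x) \<in> J' ` carrier K" using T_image by blast
  then show "U x \<in> carrier K" "J' (U x) = T (J x)"
    unfolding U_def by (simp_all add: inv_into_into f_inv_into_f)
qed

lemma norm_T: "x \<in> carrier H \<Longrightarrow> norm (T (J x)) = norm (J x)"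
proof -
  assume "x \<in> carrier H"
  then have "complex_of_real ((norm (T (J x)))\<^sup>2) = of_real ((norm (J x))\<^sup>2)"
    using T_cinner[of x x] by (simp only: cinner_self)
  then have "(norm (T (J x)))\<^sup>2 = (norm (J x))\<^sup>2"
    by (simp only: of_real_eq_iff)
  then show ?thesis by (simp add: power2_eq_iff_nonneg)
qed

lemma hilbert_iso_U: "hilbert_iso H K U"
  unfolding hilbert_iso_def bounded_operator_def
proof (intro conjI ballI allI)
  show "U \<in> carrier H \<rightarrow> carrier K" using U_mem by blast
  fix x y \<alpha> assume x: "x \<in> carrier H"
  show "U (\<alpha> \<odot>\<^bsub>H\<^esub> x) = \<alpha> \<odot>\<^bsub>K\<^esub> U x"
    by (rule dst.J_eqI) (simp_all add: U_mem J_U x src.smult_mem dst.smult_mem src.J_smult dst.J_smult T_cscale)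
  assume y: "y \<in> carrier H"
  show "U (x \<oplus>\<^bsub>H\<^esub> y) = U x \<oplus>\<^bsub>K\<^esub> U y"
    by (rule dst.J_eqI)
      (simp_all add: U_mem J_U x y src.add_mem dst.add_mem src.J_add dst.J_add blinfun.add_right)
  show "ip K (U x) (U y) = ip H x y"
    by (simp add: src.J_ip dst.J_ip U_mem J_U x y T_cinner)
next
  show "\<exists>C. \<forall>x\<in>carrier H. hnorm K (U x) \<le> C * hnorm H x"
    by (rule exI[of _ 1]) (simp add: src.hnorm_eq dst.hnorm_eq U_mem J_U norm_T)
  show "bij_betw U (carrier H) (carrier K)"
    unfolding bij_betw_def
  proof
    show "inj_on U (carrier H)"
    proof (rule inj_onI)
      fix x y assume c: "x \<in> carrier H" "y \<in> carrier H" and U: "U x = U y"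
      \<comment> \<open>The difference of x and y is formed with the scalar -1, for which the value
        of J is known. Being isometric, T can send it to zero only if it is zero.\<close>
      let ?d = "x \<oplus>\<^bsub>H\<^esub> (-1) \<odot>\<^bsub>H\<^esub> y"
      have d: "?d \<in> carrier H" "J ?d = J x - J y"
        using c by (simp_all add: src.add_mem src.smult_mem src.J_add src.J_smult)
      have "T (J ?d) = 0"
        using U c by (simp add: d(2) blinfun.diff_right J_U[symmetric])
      with norm_T[OF d(1)] have "J ?d = 0" by simp
      then show "x = y" using d(2) by (intro src.J_eqI c) simp
    qed
    show "U ` carrier H = carrier K"
    proof
      show "carrier K \<subseteq> U ` carrier H"
      proof
        fix z assume z: "z \<in> carrier K"
        then obtain x where x: "x \<in> carrier H" "T (J x) = J' z"
          using T_image by (metis (no_types, opaque_lifting) image_iff)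
        have "U x = z"
          by (rule dst.J_eqI) (simp_all add: U_mem J_U x z)
        then show "z \<in> U ` carrier H" using x(1) by blast
      qed
    qed (use U_mem in blast)
  qed
qed

lemma U_lincomb:
  assumes "finite F" "\<And>j. j \<in> F \<Longrightarrow> e j \<in> carrier H"
  shows "U (lincomb H e \<alpha> F) = lincomb K (\<lambda>j. U (e j)) \<alpha> F"
proof (rule dst.J_eqI)
  have "T (\<Sum>j\<in>F. cscale (\<alpha> j) (J (e j))) = (\<Sum>j\<in>F. cscale (\<alpha> j) (T (J (e j))))"
    by (simp add: blinfun.sum_right T_cscale)
  also have "\<dots> = (\<Sum>j\<in>F. cscale (\<alpha> j) (J' (U (e j))))"
    using assms by (intro sum.cong) (simp_all add: J_U)
  finally show "J' (U (lincomb H e \<alpha> F)) = J' (lincomb K (\<lambda>j. U (e j)) \<alpha> F)"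
    using assms by (simp add: J_U src.lincomb_mem src.J_lincomb dst.J_lincomb U_mem)
qed (use assms in \<open>auto intro!: U_mem src.lincomb_mem dst.lincomb_mem\<close>)

text \<open>Agreement on an orthonormal basis extends to finite combinations by linearity and to all
  vectors by truncation and boundedness. The condition \<open>supp\<close> expresses completeness of
  the basis indexed by B.\<close>

lemma bounded_operator_unique:
  assumes V: "bounded_operator H K V"
    and e: "\<And>j. j \<in> B \<Longrightarrow> e j \<in> carrier H" "\<And>j. j \<in> B \<Longrightarrow> J (e j) = ket_vec j"
    and VU: "\<And>j. j \<in> B \<Longrightarrow> V (e j) = U (e j)"
    and supp: "\<And>x i. x \<in> carrier H \<Longrightarrow> i \<notin> B \<Longrightarrow> coord (J x) i = 0"
    and x: "x \<in> carrier H"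
  shows "V x = U x"
proof -
  obtain C where C: "\<And>x. x \<in> carrier H \<Longrightarrow> hnorm K (V x) \<le> C * hnorm H x"
    using V unfolding bounded_operator_def by blast
  have V_mem: "V x \<in> carrier K" if "x \<in> carrier H" for x
    using V that unfolding bounded_operator_def by blast
  have V_add: "V (x \<oplus>\<^bsub>H\<^esub> y) = V x \<oplus>\<^bsub>K\<^esub> V y" if "x \<in> carrier H" "y \<in> carrier H" for x y
    using V that unfolding bounded_operator_def by blast
  have V_smult: "V (\<alpha> \<odot>\<^bsub>H\<^esub> x) = \<alpha> \<odot>\<^bsub>K\<^esub> V x" if "x \<in> carrier H" for \<alpha> x
    using V that unfolding bounded_operator_def by blast
  have U_add: "U (x \<oplus>\<^bsub>H\<^esub> y) = U x \<oplus>\<^bsub>K\<^esub> U y" if "x \<in> carrier H" "y \<in> carrier H" for x y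
    using hilbert_iso_U that unfolding hilbert_iso_def bounded_operator_def by blast
  have U_smult: "U (\<alpha> \<odot>\<^bsub>H\<^esub> x) = \<alpha> \<odot>\<^bsub>K\<^esub> U x" if "x \<in> carrier H" for \<alpha> x
    using hilbert_iso_U that unfolding hilbert_iso_def bounded_operator_def by blast
  have lin: "V (lincomb H e \<alpha> A) = U (lincomb H e \<alpha> A)" if "finite A" "A \<subseteq> B" for \<alpha> A
    using that
  proof (induction A rule: finite_induct)
    case empty
    \<comment> \<open>\<open>bounded_operator\<close> speaks of sums and scalar multiples; the value
      of V at zero comes from writing zero as 0 times zero.\<close>
    have "\<zero>\<^bsub>H\<^esub> = 0 \<odot>\<^bsub>H\<^esub> \<zero>\<^bsub>H\<^esub>"
      by (rule src.J_eqI) (simp_all add: src.zero_mem src.smult_mem src.J_smult src.J_zero)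
    then have "J' (V \<zero>\<^bsub>H\<^esub>) = 0"
      using V_smult[OF src.zero_mem, of 0] dst.J_smult[OF V_mem[OF src.zero_mem], of 0] by simp
    then have "V \<zero>\<^bsub>H\<^esub> = U \<zero>\<^bsub>H\<^esub>"
      by (intro dst.J_eqI V_mem U_mem src.zero_mem)
        (simp add: J_U[OF src.zero_mem] src.J_zero)
    then show ?case by (simp add: lincomb_def)
  next
    case (insert j A)
    have m: "e j \<in> carrier H" "lincomb H e \<alpha> A \<in> carrier H"
      using insert e by (auto intro!: src.lincomb_mem)
    have "lincomb H e \<alpha> (insert j A) = \<alpha> j \<odot>\<^bsub>H\<^esub> e j \<oplus>\<^bsub>H\<^esub> lincomb H e \<alpha> A"
      unfolding lincomb_def using insert e by (intro src.finsum_insert) (auto simp: src.smult_mem)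
    then show ?case
      using insert m VU by (simp add: V_add U_add V_smult U_smult src.smult_mem)
  qed
  have "norm (J' (V x) - J' (U x)) \<le> \<epsilon>" if "0 < \<epsilon>" for \<epsilon>
  proof -
    \<comment> \<open>C + 1 bounds the contribution of V together with that of the isometry U; the
      maximum with zero keeps the constant positive when C is negative.\<close>
    define k where "k = max C 0 + 1"
    have k: "0 < k" "C \<le> k - 1" "1 \<le> k" by (simp_all add: k_def)
    have \<epsilon>k: "0 < \<epsilon> / k" using that k by simp
    obtain A where A: "finite A" "A \<subseteq> B"
        "norm (J x - (\<Sum>j\<in>A. cscale (coord (J x) j) (ket_vec j))) < \<epsilon> / k"
      using ell2_truncation[of B "J x" "\<epsilon> / k"] supp[OF x] \<epsilon>k by auto
    let ?l = "lincomb H e (coord (J x)) A"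
    let ?d = "x \<oplus>\<^bsub>H\<^esub> (-1) \<odot>\<^bsub>H\<^esub> ?l"
    have l: "?l \<in> carrier H" using A e by (intro src.lincomb_mem) blast
    have "J ?l = (\<Sum>j\<in>A. cscale (coord (J x) j) (J (e j)))"
      using A e(1) by (intro src.J_lincomb) auto
    also have "\<dots> = (\<Sum>j\<in>A. cscale (coord (J x) j) (ket_vec j))"
      using A e(2) by (intro sum.cong) auto
    finally have d: "?d \<in> carrier H" "norm (J ?d) < \<epsilon> / k"
      using A(3) x l by (simp_all add: src.add_mem src.smult_mem src.J_add src.J_smult)
    have V: "J' (V ?d) = J' (V x) - J' (V ?l)"
      using x l by (simp add: V_add V_smult src.smult_mem dst.J_add dst.J_smult V_mem dst.smult_mem)
    have U: "J' (U ?d) = J' (U x) - J' (U ?l)"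
      using x l by (simp add: U_add U_smult src.smult_mem dst.J_add dst.J_smult U_mem dst.smult_mem)
    have "norm (J' (V x) - J' (U x)) = norm (J' (V ?d) - J' (U ?d))"
      unfolding V U lin[OF A(1,2)] by simp
    also have "\<dots> \<le> norm (J' (V ?d)) + norm (J' (U ?d))"
      by (rule norm_triangle_ineq4)
    also have "\<dots> \<le> C * norm (J ?d) + norm (J ?d)"
      using C[OF d(1)] d(1) by (simp add: src.hnorm_eq dst.hnorm_eq V_mem J_U norm_T)
    also have "\<dots> \<le> k * norm (J ?d)"
      using mult_right_mono[OF k(2) norm_ge_zero[of "J ?d"]] by (simp add: algebra_simps)
    also have "\<dots> \<le> \<epsilon>"
      using d(2) k(1) by (simp add: field_simps)
    finally show ?thesis .
  qed
  then have "norm (J' (V x) - J' (U x)) \<le> 0"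
    by (rule field_le_epsilon[where y = 0, simplified])
  then show ?thesis
    by (intro dst.J_eqI V_mem U_mem x) simp
qed

end

locale vector_state = star_rep A \<rho> for A :: "'a star_algebra" (structure) and \<rho> :: "'a \<Rightarrow> 'i ell2 \<Rightarrow>\<^sub>L 'i ell2" +
  fixes e :: "'i ell2" and \<omega> :: "'a \<Rightarrow> complex"
  assumes \<omega>: "x \<in> carrier A \<Longrightarrow> \<omega> x = cinner e (\<rho> x e)"
begin

text \<open>The imaginary part is the real adjoint relation applied to
  \<open>cscale \<i> v\<close>.\<close>

lemma cinner_rep_adj: "x \<in> carrier A \<Longrightarrow> cinner v (\<rho> (adj A x) w) = cinner (\<rho> x v) w"
  using rep_adj[of x w v] rep_adj[of x w "cscale \<i> v"]
  by (simp add: cinner_def inner_commute rep_cscale)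

lemma state_adj_mult:
  "x \<in> carrier A \<Longrightarrow> y \<in> carrier A \<Longrightarrow> \<omega> (adj A x \<otimes> y) = cinner (\<rho> x e) (\<rho> y e)"
  by (simp add: \<omega> mult_closed adj_closed rep_mult cinner_rep_adj)

lemma gns_dist_eq: "x \<in> carrier A \<Longrightarrow> y \<in> carrier A \<Longrightarrow> gns_dist A \<omega> x y = norm (\<rho> x e - \<rho> y e)"
  by (simp add: gns_dist_def state_adj_mult cinner_self rep_minus blinfun.diff_left)

text \<open>The GNS distance of x and y is the norm of \<open>\<rho> x e - \<rho> y e\<close>. So
  the Cauchy sequences are those whose vectors converge, and two of them are equivalent iff the
  limits agree: the GNS vectors are the nonempty sets of this form, labelled by the limit.\<close>

definition approx :: "'i ell2 \<Rightarrow> (nat \<Rightarrow> 'a) set" where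
  "approx L = {s. (\<forall>n. s n \<in> carrier A) \<and> (\<lambda>n. \<rho> (s n) e) \<longlonglongrightarrow> L}"

lemma gns_cauchy_iff: "s \<in> cauchy_seqs (carrier A) (gns_dist A \<omega>) \<longleftrightarrow> (\<exists>L. s \<in> approx L)"
proof
  assume s: "s \<in> cauchy_seqs (carrier A) (gns_dist A \<omega>)"
  then have c: "s n \<in> carrier A" for n by (simp add: cauchy_seqs_def)
  have "Cauchy (\<lambda>n. \<rho> (s n) e)"
  proof (rule CauchyI)
    fix r :: real assume "0 < r"
    then obtain N where "\<And>i j. i \<ge> N \<Longrightarrow> j \<ge> N \<Longrightarrow> gns_dist A \<omega> (s i) (s j) < r"
      using s unfolding cauchy_seqs_def by blast
    then show "\<exists>M. \<forall>m\<ge>M. \<forall>n\<ge>M. norm (\<rho> (s m) e - \<rho> (s n) e) < r"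
      unfolding gns_dist_eq[OF c c] by blast
  qed
  then show "\<exists>L. s \<in> approx L"
    using c by (auto simp: approx_def dest!: Cauchy_convergent simp: convergent_def)
next
  assume "\<exists>L. s \<in> approx L"
  then have c: "s n \<in> carrier A" and C: "Cauchy (\<lambda>n. \<rho> (s n) e)" for n
    by (auto simp: approx_def intro: LIMSEQ_imp_Cauchy)
  then show "s \<in> cauchy_seqs (carrier A) (gns_dist A \<omega>)"
    unfolding cauchy_seqs_def using CauchyD[OF C] by (simp add: gns_dist_eq)
qed

lemma gns_class_eq:
  assumes s: "s \<in> approx L" shows "gns_class A \<omega> s = approx L"
proof
  have c: "s n \<in> carrier A" for n
    using s by (simp add: approx_def)
  have L: "(\<lambda>n. \<rho> (s n) e) \<longlonglongrightarrow> L"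
    using s by (simp add: approx_def)
  show "gns_class A \<omega> s \<subseteq> approx L"
  proof
    fix t assume "t \<in> gns_class A \<omega> s"
    then have d: "(\<lambda>n. gns_dist A \<omega> (s n) (t n)) \<longlonglongrightarrow> 0" and t: "t \<in> cauchy_seqs (carrier A) (gns_dist A \<omega>)"
      by (auto simp: gns_class_def cauchy_class_def)
    have c': "t n \<in> carrier A" for n using t by (simp add: cauchy_seqs_def)
    have "(\<lambda>n. \<rho> (s n) e - \<rho> (t n) e) \<longlonglongrightarrow> 0"
      using d unfolding gns_dist_eq[OF c c'] by (simp add: tendsto_norm_zero_iff)
    from tendsto_diff[OF L this] show "t \<in> approx L"
      using c' by (simp add: approx_def)
  qed
  show "approx L \<subseteq> gns_class A \<omega> s"
  proof
    fix t assume t: "t \<in> approx L"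
    have c': "t n \<in> carrier A" for n
      using t by (simp add: approx_def)
    have L': "(\<lambda>n. \<rho> (t n) e) \<longlonglongrightarrow> L"
      using t by (simp add: approx_def)
    have "(\<lambda>n. gns_dist A \<omega> (s n) (t n)) \<longlonglongrightarrow> 0"
      unfolding gns_dist_eq[OF c c'] using tendsto_norm[OF tendsto_diff[OF L L']] by simp
    with t show "t \<in> gns_class A \<omega> s"
      unfolding gns_class_def cauchy_class_def using gns_cauchy_iff by blast
  qed
qed

definition gns_coord :: "(nat \<Rightarrow> 'a) set \<Rightarrow> 'i ell2" where
  "gns_coord = descend (\<lambda>s. lim (\<lambda>n. \<rho> (s n) e))"

lemma gns_coord_approx: "s \<in> approx L \<Longrightarrow> gns_coord (approx L) = L"
  unfolding gns_coord_def by (rule descend_eqI) (auto simp: approx_def limI)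

abbreviation "H \<equiv> gns_space A \<omega>"

lemma carrier_gns: "carrier H = {approx L | L. approx L \<noteq> {}}"
proof -
  have "carrier H = gns_class A \<omega> ` cauchy_seqs (carrier A) (gns_dist A \<omega>)"
    by (simp add: gns_space_def completion_set_def gns_class_def)
  also have "\<dots> = {approx L | L. approx L \<noteq> {}}"
  proof (intro Set.set_eqI iffI)
    fix x assume "x \<in> gns_class A \<omega> ` cauchy_seqs (carrier A) (gns_dist A \<omega>)"
    then obtain s L where s: "x = gns_class A \<omega> s" "s \<in> approx L"
      using gns_cauchy_iff by (metis imageE)
    then show "x \<in> {approx L | L. approx L \<noteq> {}}"
      using gns_class_eq[OF s(2)] by auto
  next
    fix x assume "x \<in> {approx L | L. approx L \<noteq> {}}"
    then obtain s L where s: "x = approx L" "s \<in> approx L" by auto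
    then have "s \<in> cauchy_seqs (carrier A) (gns_dist A \<omega>)"
      using gns_cauchy_iff by blast
    then show "x \<in> gns_class A \<omega> ` cauchy_seqs (carrier A) (gns_dist A \<omega>)"
      using s(1) gns_class_eq[OF s(2)] by (intro image_eqI) auto
  qed
  finally show ?thesis .
qed

lemma approx_zero: "(\<lambda>n. \<zero>) \<in> approx 0"
proof -
  have "\<rho> \<zero> = 0" using rep_norm[OF zero_closed] by (simp add: nrm_zero)
  then show ?thesis by (simp add: approx_def)
qed

lemma approx_add: "s \<in> approx L \<Longrightarrow> t \<in> approx M \<Longrightarrow> (\<lambda>n. s n \<oplus> t n) \<in> approx (L + M)"
  by (auto simp: approx_def rep_add blinfun.add_left intro!: tendsto_intros)

lemma approx_smult: "s \<in> approx L \<Longrightarrow> (\<lambda>n. \<alpha> \<odot> s n) \<in> approx (cscale \<alpha> L)"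
  by (auto simp: approx_def rep_smult smult_closed intro!: tendsto_intros)

lemma approx_mult: "a \<in> carrier A \<Longrightarrow> s \<in> approx L \<Longrightarrow> (\<lambda>n. a \<otimes> s n) \<in> approx (\<rho> a L)"
  by (auto simp: approx_def rep_mult mult_closed intro!: tendsto_intros blinfun.tendsto)

lemma gns_add: "s \<in> approx L \<Longrightarrow> t \<in> approx M \<Longrightarrow> approx L \<oplus>\<^bsub>H\<^esub> approx M = approx (L + M)"
  unfolding gns_space_def by (simp, rule descend2_eqI; (assumption | rule gns_class_eq approx_add)+)

lemma gns_smult: "s \<in> approx L \<Longrightarrow> \<alpha> \<odot>\<^bsub>H\<^esub> approx L = approx (cscale \<alpha> L)"
  unfolding gns_space_def by (simp, rule descend_eqI; (assumption | rule gns_class_eq approx_smult)+)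

lemma gns_rep_approx: "a \<in> carrier A \<Longrightarrow> s \<in> approx L \<Longrightarrow> gns_rep A \<omega> a (approx L) = approx (\<rho> a L)"
  unfolding gns_rep_def by (rule descend_eqI; (assumption | rule gns_class_eq approx_mult)+)

lemma gns_ip: "s \<in> approx L \<Longrightarrow> t \<in> approx M \<Longrightarrow> ip H (approx L) (approx M) = cinner L M"
proof -
  have "lim (\<lambda>n. \<omega> (adj A (s n) \<otimes> t n)) = cinner L M" if "s \<in> approx L" "t \<in> approx M" for s t
    using that by (intro limI) (auto simp: approx_def state_adj_mult intro!: tendsto_intros)
  moreover assume "s \<in> approx L" "t \<in> approx M"
  ultimately show ?thesis
    unfolding gns_space_def by (simp, intro descend2_eqI) auto
qed

lemma gns_memE:
  assumes "x \<in> carrier H" obtains L s where "x = approx L" "s \<in> approx L"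
  using assms by (auto simp: carrier_gns)

lemma approx_mem: "s \<in> approx L \<Longrightarrow> approx L \<in> carrier H"
  by (auto simp: carrier_gns)

lemma hilbert_model_gns: "hilbert_model H gns_coord"
proof
  show "inj_on gns_coord (carrier H)"
    by (rule inj_onI) (metis gns_memE gns_coord_approx)
  have z: "\<zero>\<^bsub>H\<^esub> = approx 0"
    using gns_class_eq[OF approx_zero] by (simp add: gns_space_def)
  show "\<zero>\<^bsub>H\<^esub> \<in> carrier H" "gns_coord \<zero>\<^bsub>H\<^esub> = 0"
    unfolding z by (rule approx_mem[OF approx_zero], rule gns_coord_approx[OF approx_zero])
  fix x \<alpha> assume "x \<in> carrier H"
  then obtain L s where s: "x = approx L" "s \<in> approx L" by (rule gns_memE)
  show "\<alpha> \<odot>\<^bsub>H\<^esub> x \<in> carrier H"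
    unfolding s(1) gns_smult[OF s(2)] by (rule approx_mem[OF approx_smult[OF s(2)]])
  show "gns_coord (\<alpha> \<odot>\<^bsub>H\<^esub> x) = cscale \<alpha> (gns_coord x)"
    unfolding s(1) gns_smult[OF s(2)] gns_coord_approx[OF s(2)]
    by (rule gns_coord_approx[OF approx_smult[OF s(2)]])
  fix y assume "y \<in> carrier H"
  then obtain M t where t: "y = approx M" "t \<in> approx M" by (rule gns_memE)
  show "x \<oplus>\<^bsub>H\<^esub> y \<in> carrier H"
    unfolding s(1) t(1) gns_add[OF s(2) t(2)] by (rule approx_mem[OF approx_add[OF s(2) t(2)]])
  show "gns_coord (x \<oplus>\<^bsub>H\<^esub> y) = gns_coord x + gns_coord y"
    unfolding s(1) t(1) gns_add[OF s(2) t(2)] gns_coord_approx[OF s(2)] gns_coord_approx[OF t(2)]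
    by (rule gns_coord_approx[OF approx_add[OF s(2) t(2)]])
  show "ip H x y = cinner (gns_coord x) (gns_coord y)"
    unfolding s(1) t(1) gns_coord_approx[OF s(2)] gns_coord_approx[OF t(2)] by (rule gns_ip[OF s(2) t(2)])
qed

lemma
  assumes a: "a \<in> carrier A" and x: "x \<in> carrier H"
  shows gns_rep_mem: "gns_rep A \<omega> a x \<in> carrier H"
    and gns_coord_rep: "gns_coord (gns_rep A \<omega> a x) = \<rho> a (gns_coord x)"
proof -
  obtain L s where s: "x = approx L" "s \<in> approx L" using x by (rule gns_memE)
  show "gns_rep A \<omega> a x \<in> carrier H"
    unfolding s(1) gns_rep_approx[OF a s(2)] by (rule approx_mem[OF approx_mult[OF a s(2)]])
  show "gns_coord (gns_rep A \<omega> a x) = \<rho> a (gns_coord x)"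
    unfolding s(1) gns_rep_approx[OF a s(2)] gns_coord_approx[OF s(2)]
    by (rule gns_coord_approx[OF approx_mult[OF a s(2)]])
qed

lemma
  assumes "x \<in> carrier A"
  shows gns_vector_mem: "gns_vector A \<omega> x \<in> carrier H"
    and gns_coord_vector: "gns_coord (gns_vector A \<omega> x) = \<rho> x e"
proof -
  have s: "(\<lambda>n. x) \<in> approx (\<rho> x e)" using assms by (simp add: approx_def)
  show "gns_vector A \<omega> x \<in> carrier H" "gns_coord (gns_vector A \<omega> x) = \<rho> x e"
    unfolding gns_vector_def gns_class_eq[OF s] by (rule approx_mem[OF s], rule gns_coord_approx[OF s])
qed

text \<open>In other words, the range is the closure of the cyclic subspace generated by e.\<close>

lemma range_gns_coord: "gns_coord ` carrier H = {L. approx L \<noteq> {}}"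
proof (intro Set.set_eqI iffI)
  fix L assume "L \<in> gns_coord ` carrier H"
  then obtain x where x: "x \<in> carrier H" "L = gns_coord x" by blast
  from x(1) obtain M s where s: "x = approx M" "s \<in> approx M" by (rule gns_memE)
  then show "L \<in> {L. approx L \<noteq> {}}"
    using x(2) gns_coord_approx[OF s(2)] by auto
next
  fix L assume "L \<in> {L. approx L \<noteq> {}}"
  then obtain s where s: "s \<in> approx L" by blast
  show "L \<in> gns_coord ` carrier H"
    using approx_mem[OF s] gns_coord_approx[OF s] by (intro image_eqI[where x = "approx L"]) simp_all
qed

end

section \<open>Representations of Weyl algebras\<close>

text \<open>Product, adjoint, norm, relabelling and representation of symbols are all sums of this
  shape, the product being a nested one. When f sends zero coefficients to zero, the key set may be
  enlarged, which makes sums over different key sets comparable.\<close>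

definition lin_ext :: "('g \<Rightarrow> 'b \<Rightarrow> 'c) \<Rightarrow> ('g \<Rightarrow>\<^sub>0 'b::zero) \<Rightarrow> 'c::comm_monoid_add" where
  "lin_ext f a = (\<Sum>g\<in>Poly_Mapping.keys a. f g (Poly_Mapping.lookup a g))"

lemma lin_ext_superset:
  assumes "finite K" "Poly_Mapping.keys a \<subseteq> K" "\<And>g. f g 0 = 0"
  shows "lin_ext f a = (\<Sum>g\<in>K. f g (Poly_Mapping.lookup a g))"
  unfolding lin_ext_def by (rule sum.mono_neutral_left) (use assms in \<open>auto simp: in_keys_iff\<close>)

lemma lin_ext_add:
  fixes f :: "'g \<Rightarrow> complex \<Rightarrow> 'c::ab_group_add"
  assumes "\<And>g x y. f g (x + y) = f g x + f g y"
  shows "lin_ext f (a + b) = lin_ext f a + lin_ext f b"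
proof -
  let ?K = "Poly_Mapping.keys a \<union> Poly_Mapping.keys b"
  have "f g 0 = 0" for g using assms[of g 0 0] by simp
  moreover have "Poly_Mapping.keys (a + b) \<subseteq> ?K" by (rule keys_add)
  ultimately show ?thesis
    by (simp add: lin_ext_superset[of ?K] lookup_add assms sum.distrib)
qed

lemma lin_ext_0 [simp]: "lin_ext f 0 = 0"
  by (simp add: lin_ext_def)

lemma lin_ext_sum:
  fixes f :: "'g \<Rightarrow> complex \<Rightarrow> 'c::ab_group_add"
  assumes "\<And>g x y. f g (x + y) = f g x + f g y"
  shows "lin_ext f (sum h A) = (\<Sum>j\<in>A. lin_ext f (h j))"
  by (induction A rule: infinite_finite_induct) (simp_all add: lin_ext_add[OF assms])

lemma lin_ext_single: "f g 0 = 0 \<Longrightarrow> lin_ext f (Poly_Mapping.single g x) = f g x"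
  by (cases "x = 0") (simp_all add: lin_ext_def)

lemma lookup_smult: "Poly_Mapping.lookup (Poly_Mapping.map ((*) \<alpha>) a) g = \<alpha> * Poly_Mapping.lookup a g"
  for \<alpha> :: complex
  by (simp add: map.rep_eq when_def)

lemma keys_smult: "Poly_Mapping.keys (Poly_Mapping.map ((*) \<alpha>) a) \<subseteq> Poly_Mapping.keys a"
  for \<alpha> :: complex
  by (auto simp: in_keys_iff lookup_smult)

lemma lin_ext_smult:
  fixes \<alpha> :: complex
  assumes "\<And>g. f g 0 = 0"
  shows "lin_ext f (Poly_Mapping.map ((*) \<alpha>) a) = lin_ext (\<lambda>g x. f g (\<alpha> * x)) a"
  by (subst lin_ext_superset[where K = "Poly_Mapping.keys a"])
    (simp_all add: keys_smult assms lookup_smult lin_ext_def)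

lemma smult_sum:
  fixes \<alpha> :: complex
  shows "Poly_Mapping.map ((*) \<alpha>) (sum h A) = (\<Sum>j\<in>A. Poly_Mapping.map ((*) \<alpha>) (h j))"
  by (rule poly_mapping_eqI) (simp add: lookup_smult lookup_sum sum_distrib_left)

lemma smult_single:
  fixes \<alpha> :: complex
  shows "Poly_Mapping.map ((*) \<alpha>) (Poly_Mapping.single g x) = Poly_Mapping.single g (\<alpha> * x)"
  by (rule poly_mapping_eqI) (simp add: lookup_smult lookup_single when_def)

lemma lin_ext_cong:
  "(\<And>g. g \<in> Poly_Mapping.keys a \<Longrightarrow> f g (Poly_Mapping.lookup a g) = f' g (Poly_Mapping.lookup a g)) \<Longrightarrow>
    lin_ext f a = lin_ext f' a"
  unfolding lin_ext_def by (rule sum.cong) simp_all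

lemma lin_ext_id: "lin_ext Poly_Mapping.single a = a" for a :: "'g \<Rightarrow>\<^sub>0 complex"
proof (rule poly_mapping_eqI)
  fix g
  have "Poly_Mapping.lookup (lin_ext Poly_Mapping.single a) g =
      (\<Sum>h\<in>Poly_Mapping.keys a. if h = g then Poly_Mapping.lookup a h else 0)"
    unfolding lin_ext_def lookup_sum by (rule sum.cong) (simp_all add: lookup_single when_def)
  then show "Poly_Mapping.lookup (lin_ext Poly_Mapping.single a) g = Poly_Mapping.lookup a g"
    by (simp add: in_keys_iff)
qed

lemma keys_lin_ext:
  assumes "\<And>g. g \<in> Poly_Mapping.keys a \<Longrightarrow> Poly_Mapping.keys (f g (Poly_Mapping.lookup a g)) \<subseteq> S"
  shows "Poly_Mapping.keys (lin_ext f a) \<subseteq> S"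
  unfolding lin_ext_def using keys_sum[of "\<lambda>g. f g (Poly_Mapping.lookup a g)" "Poly_Mapping.keys a"] assms
  by blast

lemma norm_circle_exp [simp]: "cmod (circle_exp t) = 1"
  by transfer simp

lemma circle_exp_add: "circle_exp (s + t) = circle_exp s * circle_exp t"
  by transfer (simp add: cis_mult distrib_left)

lemma circle_exp_0 [simp]: "circle_exp 0 = 1"
  by transfer simp

lemma circle_exp_minus: "circle_exp (- t) = cnj (circle_exp t)"
  by transfer (simp add: cis_cnj)

subsection \<open>The symbol algebra\<close>

lemma symbol_algebra_simps:
  "carrier (symbol_algebra G \<sigma>) = {a. Poly_Mapping.keys a \<subseteq> carrier G}"
  "monoid.mult (symbol_algebra G \<sigma>) = (\<lambda>a b. lin_ext (\<lambda>g x. lin_ext (\<lambda>h y.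
      Poly_Mapping.single (g \<otimes>\<^bsub>G\<^esub> h) (x * y * circle_exp (\<sigma> g h))) b) a)"
  "ring.zero (symbol_algebra G \<sigma>) = 0"
  "ring.add (symbol_algebra G \<sigma>) = (+)"
  "module.smult (symbol_algebra G \<sigma>) = (\<lambda>\<alpha>. Poly_Mapping.map ((*) \<alpha>))"
  "adj (symbol_algebra G \<sigma>) = lin_ext (\<lambda>g x. Poly_Mapping.single (inv\<^bsub>G\<^esub> g) (cnj x))"
  "nrm (symbol_algebra G \<sigma>) = lin_ext (\<lambda>g x. cmod x)"
  by (simp_all add: symbol_algebra_def lin_ext_def fun_eq_iff)

lemma l1_norm_add: "lin_ext (\<lambda>g. cmod) (a + b) \<le> lin_ext (\<lambda>g. cmod) a + lin_ext (\<lambda>g. cmod) b"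
proof -
  let ?K = "Poly_Mapping.keys a \<union> Poly_Mapping.keys b"
  have "Poly_Mapping.keys (a + b) \<subseteq> ?K" by (rule keys_add)
  then show ?thesis
    by (simp add: lin_ext_superset[of ?K] lookup_add sum_mono norm_triangle_ineq flip: sum.distrib)
qed

lemma l1_norm_sum: "lin_ext (\<lambda>g. cmod) (sum h A) \<le> (\<Sum>j\<in>A. lin_ext (\<lambda>g. cmod) (h j))"
proof (induction A rule: infinite_finite_induct)
  case (insert x F)
  then show ?case using l1_norm_add[of "h x" "sum h F"] by simp
qed simp_all

lemma l1_norm_single: "lin_ext (\<lambda>g. cmod) (Poly_Mapping.single g x) = cmod x"
  by (simp add: lin_ext_single)

text \<open>A bound on single symbols extends to their combinations by the triangle inequality. It
  is used with constant 1 for the adjoint and for relabelling, and twice in a row for the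
  product.\<close>

lemma l1_norm_lin_ext:
  assumes "\<And>g. g \<in> Poly_Mapping.keys a \<Longrightarrow>
    lin_ext (\<lambda>g. cmod) (f g (Poly_Mapping.lookup a g)) \<le> c * cmod (Poly_Mapping.lookup a g)"
  shows "lin_ext (\<lambda>g. cmod) (lin_ext f a) \<le> c * lin_ext (\<lambda>g. cmod) a"
proof -
  have "lin_ext (\<lambda>g. cmod) (lin_ext f a) \<le>
      (\<Sum>g\<in>Poly_Mapping.keys a. lin_ext (\<lambda>g. cmod) (f g (Poly_Mapping.lookup a g)))"
    unfolding lin_ext_def[of f] by (rule l1_norm_sum)
  also have "\<dots> \<le> (\<Sum>g\<in>Poly_Mapping.keys a. c * cmod (Poly_Mapping.lookup a g))"
    by (rule sum_mono) (rule assms)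
  finally show ?thesis by (simp add: lin_ext_def sum_distrib_left)
qed

lemma lin_ext_fun_add:
  "lin_ext (\<lambda>g x. f g x + f' g x) a = lin_ext f a + lin_ext f' a"
  by (simp add: lin_ext_def sum.distrib)

text \<open>For an arbitrary phase function \<sigma> the product is a twisted convolution: its
  bilinearity is formal, and its norm estimate rests on phases having modulus one. Associativity
  would require a cocycle identity, which is why it is absent from
  \<open>normed_star_algebra\<close>.\<close>

lemma (in group) normed_star_algebra_symbol: "normed_star_algebra (symbol_algebra G \<sigma>)"
proof (rule normed_star_algebra.intro)
  let ?A = "symbol_algebra G \<sigma>"
  let ?m = "\<lambda>g x h y. Poly_Mapping.single (g \<otimes> h) (x * y * circle_exp (\<sigma> g h))"
  let ?t = "\<lambda>b g x. lin_ext (?m g x) b"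
  note [simp] = symbol_algebra_simps
  have m_add: "?m g x h (y + y') = ?m g x h y + ?m g x h y'" for g x h y y'
    by (simp add: single_add[symmetric] algebra_simps)
  have t_add: "?t b g (x + x') = ?t b g x + ?t b g x'" for b g x x'
    by (simp add: lin_ext_fun_add[symmetric] single_add[symmetric] algebra_simps)
  have t_0: "?t b g 0 = 0" for b g by (simp add: lin_ext_def)
  have smult_mem: "Poly_Mapping.keys (Poly_Mapping.map ((*) \<alpha>) a) \<subseteq> carrier G"
    if "Poly_Mapping.keys a \<subseteq> carrier G" for a and \<alpha> :: complex
    by (rule order_trans[OF keys_smult that])
  show "abelian_group ?A"
  proof (rule abelian_groupI)
    show "x \<oplus>\<^bsub>?A\<^esub> y \<in> carrier ?A" if "x \<in> carrier ?A" "y \<in> carrier ?A" for x y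
      using that keys_add[of x y] by auto
    show "\<exists>y\<in>carrier ?A. y \<oplus>\<^bsub>?A\<^esub> x = \<zero>\<^bsub>?A\<^esub>" if "x \<in> carrier ?A" for x
      by (rule bexI[of _ "- x"]) (use that in auto)
  qed (auto simp: add_ac)
  fix x y z \<alpha> \<beta>
  assume x: "x \<in> carrier ?A"
  then have kx: "Poly_Mapping.keys x \<subseteq> carrier G" by simp
  show "\<alpha> \<odot>\<^bsub>?A\<^esub> x \<in> carrier ?A" using smult_mem[OF kx] by simp
  show "(\<alpha> + \<beta>) \<odot>\<^bsub>?A\<^esub> x = \<alpha> \<odot>\<^bsub>?A\<^esub> x \<oplus>\<^bsub>?A\<^esub> \<beta> \<odot>\<^bsub>?A\<^esub> x"
    "\<alpha> \<odot>\<^bsub>?A\<^esub> (\<beta> \<odot>\<^bsub>?A\<^esub> x) = (\<alpha> * \<beta>) \<odot>\<^bsub>?A\<^esub> x" "1 \<odot>\<^bsub>?A\<^esub> x = x"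
    by (auto intro!: poly_mapping_eqI simp: lookup_smult lookup_add algebra_simps)
  show "adj ?A x \<in> carrier ?A"
  proof -
    have "Poly_Mapping.keys (lin_ext (\<lambda>g y. Poly_Mapping.single (inv g) (cnj y)) x) \<subseteq> carrier G"
      by (rule keys_lin_ext) (use kx in \<open>auto split: if_splits\<close>)
    then show ?thesis by simp
  qed
  have adj_add: "adj ?A (x \<oplus>\<^bsub>?A\<^esub> y) = adj ?A x \<oplus>\<^bsub>?A\<^esub> adj ?A y" for x y
    by (simp add: lin_ext_add single_add)
  show "adj ?A (\<alpha> \<odot>\<^bsub>?A\<^esub> x) = cnj \<alpha> \<odot>\<^bsub>?A\<^esub> adj ?A x"
    by (simp add: lin_ext_smult) (simp add: lin_ext_def smult_sum smult_single)
  show "adj ?A (adj ?A x) = x"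
  proof -
    have "adj ?A (adj ?A x) = lin_ext (\<lambda>g y. Poly_Mapping.single (inv (inv g)) y) x"
      unfolding lin_ext_def[of _ x] symbol_algebra_simps
      by (subst lin_ext_sum) (simp_all add: single_add lin_ext_single)
    also have "\<dots> = lin_ext Poly_Mapping.single x"
      by (rule lin_ext_cong) (use kx in auto)
    finally show ?thesis by (simp add: lin_ext_id)
  qed
  show "0 \<le> nrm ?A x" by (simp add: lin_ext_def sum_nonneg)
  show "nrm ?A (\<alpha> \<odot>\<^bsub>?A\<^esub> x) = cmod \<alpha> * nrm ?A x"
    by (simp add: lin_ext_smult) (simp add: lin_ext_def norm_mult sum_distrib_left)
  show "nrm ?A (adj ?A x) \<le> nrm ?A x"
    using l1_norm_lin_ext[of x "\<lambda>g x. Poly_Mapping.single (inv g) (cnj x)" 1]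
    by (simp add: l1_norm_single)
  assume y: "y \<in> carrier ?A"
  then have ky: "Poly_Mapping.keys y \<subseteq> carrier G" by simp
  show "\<alpha> \<odot>\<^bsub>?A\<^esub> (x \<oplus>\<^bsub>?A\<^esub> y) = \<alpha> \<odot>\<^bsub>?A\<^esub> x \<oplus>\<^bsub>?A\<^esub> \<alpha> \<odot>\<^bsub>?A\<^esub> y"
    by (auto intro!: poly_mapping_eqI simp: lookup_smult lookup_add algebra_simps)
  show "adj ?A (x \<oplus>\<^bsub>?A\<^esub> y) = adj ?A x \<oplus>\<^bsub>?A\<^esub> adj ?A y" by (rule adj_add)
  show "x \<otimes>\<^bsub>?A\<^esub> y \<in> carrier ?A"
  proof -
    have "Poly_Mapping.keys (lin_ext (?t y) x) \<subseteq> carrier G"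
    proof (rule keys_lin_ext, rule keys_lin_ext)
      fix g h assume "g \<in> Poly_Mapping.keys x" "h \<in> Poly_Mapping.keys y"
      then have "g \<otimes> h \<in> carrier G" using kx ky by blast
      then show "Poly_Mapping.keys (?m g (Poly_Mapping.lookup x g) h (Poly_Mapping.lookup y h)) \<subseteq> carrier G"
        by auto
    qed
    then show ?thesis by simp
  qed
  show "(\<alpha> \<odot>\<^bsub>?A\<^esub> x) \<otimes>\<^bsub>?A\<^esub> y = \<alpha> \<odot>\<^bsub>?A\<^esub> (x \<otimes>\<^bsub>?A\<^esub> y)"
    by (simp add: lin_ext_smult[of "?t y", OF t_0])
      (simp add: lin_ext_def smult_sum smult_single mult.assoc)
  show "x \<otimes>\<^bsub>?A\<^esub> (\<alpha> \<odot>\<^bsub>?A\<^esub> y) = \<alpha> \<odot>\<^bsub>?A\<^esub> (x \<otimes>\<^bsub>?A\<^esub> y)"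
    by (simp add: lin_ext_smult) (simp add: lin_ext_def smult_sum smult_single algebra_simps)
  show "nrm ?A (x \<oplus>\<^bsub>?A\<^esub> y) \<le> nrm ?A x + nrm ?A y"
    by (simp add: l1_norm_add)
  show "nrm ?A (x \<otimes>\<^bsub>?A\<^esub> y) \<le> nrm ?A x * nrm ?A y"
  proof -
    have "lin_ext (\<lambda>g. cmod) (?t y g c) \<le> lin_ext (\<lambda>g. cmod) y * cmod c" for g c
      using l1_norm_lin_ext[of y "?m g c" "cmod c"]
      by (simp add: l1_norm_single norm_mult mult.commute)
    from l1_norm_lin_ext[of x "?t y", OF this] show ?thesis
      by (simp add: mult.commute)
  qed
  assume z: "z \<in> carrier ?A"
  show "(x \<oplus>\<^bsub>?A\<^esub> y) \<otimes>\<^bsub>?A\<^esub> z = x \<otimes>\<^bsub>?A\<^esub> z \<oplus>\<^bsub>?A\<^esub> y \<otimes>\<^bsub>?A\<^esub> z"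
    using lin_ext_add[of "?t z", OF t_add] by simp
  show "z \<otimes>\<^bsub>?A\<^esub> (x \<oplus>\<^bsub>?A\<^esub> y) = z \<otimes>\<^bsub>?A\<^esub> x \<oplus>\<^bsub>?A\<^esub> z \<otimes>\<^bsub>?A\<^esub> y"
  proof -
    have "lin_ext (?m g c) (x + y) = lin_ext (?m g c) x + lin_ext (?m g c) y" for g c
      by (rule lin_ext_add) (rule m_add)
    then show ?thesis by (simp add: lin_ext_fun_add)
  qed
qed

text \<open>Relabelled symbols may coincide and cancel, so the l1 norm can drop: the map is a
  contraction and in general not an isometry. Preservation of \<sigma> enters in the
  product.\<close>

lemma contractive_star_hom_symbol:
  assumes G: "group G" and G': "group G'"
    and \<zeta>: "\<zeta> \<in> hom G G'"
    and \<sigma>: "\<And>g h. g \<in> carrier G \<Longrightarrow> h \<in> carrier G \<Longrightarrow> \<sigma>' (\<zeta> g) (\<zeta> h) = \<sigma> g h"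
  shows "contractive_star_hom (symbol_algebra G \<sigma>) (symbol_algebra G' \<sigma>')
    (lin_ext (\<lambda>g. Poly_Mapping.single (\<zeta> g)))"
proof (intro contractive_star_hom.intro contractive_star_hom_axioms.intro
    group.normed_star_algebra_symbol G G')
  interpret group_hom G G' \<zeta>
    using G G' \<zeta> by (simp add: group_hom_def group_hom_axioms_def)
  let ?A = "symbol_algebra G \<sigma>" and ?B = "symbol_algebra G' \<sigma>'"
  let ?F = "lin_ext (\<lambda>g. Poly_Mapping.single (\<zeta> g)) :: _ \<Rightarrow> _ \<Rightarrow>\<^sub>0 complex"
  note [simp] = symbol_algebra_simps
  have F_add: "?F (a + b) = ?F a + ?F b" for a b
    by (rule lin_ext_add) (rule single_add)
  have F_sum: "?F (sum h A) = (\<Sum>j\<in>A. ?F (h j))" for h :: "'x \<Rightarrow> _" and A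
    by (rule lin_ext_sum) (rule single_add)
  have F_single: "?F (Poly_Mapping.single g x) = Poly_Mapping.single (\<zeta> g) x" for g x
    by (simp add: lin_ext_single)
  fix x y \<alpha> assume "x \<in> carrier ?A"
  then have kx: "Poly_Mapping.keys x \<subseteq> carrier G" by simp
  show "?F x \<in> carrier ?B"
  proof -
    have "Poly_Mapping.keys (?F x) \<subseteq> carrier G'"
      by (rule keys_lin_ext) (use kx in \<open>auto split: if_splits\<close>)
    then show ?thesis by simp
  qed
  show "?F (\<alpha> \<odot>\<^bsub>?A\<^esub> x) = \<alpha> \<odot>\<^bsub>?B\<^esub> ?F x"
    by (simp add: lin_ext_smult) (simp add: lin_ext_def smult_sum smult_single)
  show "?F (adj ?A x) = adj ?B (?F x)"
  proof -
    have "?F (adj ?A x) = (\<Sum>g\<in>Poly_Mapping.keys x. Poly_Mapping.single (\<zeta> (inv\<^bsub>G\<^esub> g)) (cnj (Poly_Mapping.lookup x g)))"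
      unfolding symbol_algebra_simps lin_ext_def[of _ x] F_sum F_single ..
    also have "\<dots> = (\<Sum>g\<in>Poly_Mapping.keys x. Poly_Mapping.single (inv\<^bsub>G'\<^esub> \<zeta> g) (cnj (Poly_Mapping.lookup x g)))"
      by (rule sum.cong) (use kx in \<open>auto simp: subset_iff\<close>)
    also have "\<dots> = adj ?B (?F x)"
      unfolding symbol_algebra_simps lin_ext_def[of _ x]
      by (subst lin_ext_sum) (simp_all add: single_add lin_ext_single)
    finally show ?thesis .
  qed
  show "nrm ?B (?F x) \<le> nrm ?A x"
    using l1_norm_lin_ext[of x "\<lambda>g. Poly_Mapping.single (\<zeta> g)" 1] by (simp add: l1_norm_single)
  assume "y \<in> carrier ?A"
  then have ky: "Poly_Mapping.keys y \<subseteq> carrier G" by simp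
  show "?F (x \<oplus>\<^bsub>?A\<^esub> y) = ?F x \<oplus>\<^bsub>?B\<^esub> ?F y"
    by (simp add: F_add)
  show "?F (x \<otimes>\<^bsub>?A\<^esub> y) = ?F x \<otimes>\<^bsub>?B\<^esub> ?F y"
  proof -
    let ?X = "Poly_Mapping.lookup x" and ?Y = "Poly_Mapping.lookup y"
    let ?t = "\<lambda>b g' c. lin_ext (\<lambda>h' d. Poly_Mapping.single (g' \<otimes>\<^bsub>G'\<^esub> h') (c * d * circle_exp (\<sigma>' g' h'))) b"
    have "?F (x \<otimes>\<^bsub>?A\<^esub> y) = (\<Sum>g\<in>Poly_Mapping.keys x. \<Sum>h\<in>Poly_Mapping.keys y.
        Poly_Mapping.single (\<zeta> (g \<otimes>\<^bsub>G\<^esub> h)) (?X g * ?Y h * circle_exp (\<sigma> g h)))"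
      unfolding symbol_algebra_simps lin_ext_def[of _ x] lin_ext_def[of _ y] F_sum F_single ..
    also have "\<dots> = (\<Sum>g\<in>Poly_Mapping.keys x. \<Sum>h\<in>Poly_Mapping.keys y.
        Poly_Mapping.single (\<zeta> g \<otimes>\<^bsub>G'\<^esub> \<zeta> h) (?X g * ?Y h * circle_exp (\<sigma>' (\<zeta> g) (\<zeta> h))))"
      by (intro sum.cong) (use kx ky in \<open>auto simp: subset_iff \<sigma>\<close>)
    also have "\<dots> = (\<Sum>g\<in>Poly_Mapping.keys x. ?t (?F y) (\<zeta> g) (?X g))"
    proof (rule sum.cong[OF refl])
      fix g
      show "(\<Sum>h\<in>Poly_Mapping.keys y. Poly_Mapping.single (\<zeta> g \<otimes>\<^bsub>G'\<^esub> \<zeta> h)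
          (?X g * ?Y h * circle_exp (\<sigma>' (\<zeta> g) (\<zeta> h)))) = ?t (?F y) (\<zeta> g) (?X g)"
        unfolding lin_ext_def[of _ y]
        by (subst lin_ext_sum) (simp_all add: lin_ext_single algebra_simps flip: single_add)
    qed
    also have "\<dots> = lin_ext (?t (?F y)) (?F x)"
    proof -
      have "lin_ext (?t (?F y)) (?F x) =
          (\<Sum>g\<in>Poly_Mapping.keys x. lin_ext (?t (?F y)) (Poly_Mapping.single (\<zeta> g) (?X g)))"
        unfolding lin_ext_def[of "\<lambda>g. Poly_Mapping.single (\<zeta> g)" x]
        by (rule lin_ext_sum) (simp add: lin_ext_fun_add[symmetric] single_add[symmetric] algebra_simps)
      moreover have "lin_ext (?t (?F y)) (Poly_Mapping.single g' c) = ?t (?F y) g' c" for g' c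
        by (rule lin_ext_single) (simp add: lin_ext_def)
      ultimately show ?thesis by simp
    qed
    finally show ?thesis by simp
  qed
qed

subsection \<open>Extending a projective representation to the Weyl algebra\<close>

locale projective_rep = group G for G :: "('g, 'm) monoid_scheme" (structure) +
  fixes \<sigma> :: "'g \<Rightarrow> 'g \<Rightarrow> circle" and R :: "'g \<Rightarrow> 'i ell2 \<Rightarrow>\<^sub>L 'i ell2"
  assumes R_mult: "g \<in> carrier G \<Longrightarrow> h \<in> carrier G \<Longrightarrow>
      R g (R h v) = cscale (circle_exp (\<sigma> g h)) (R (g \<otimes> h) v)"
    and R_inv: "g \<in> carrier G \<Longrightarrow> R (inv g) v \<bullet> w = v \<bullet> R g w"
    and R_cscale: "g \<in> carrier G \<Longrightarrow> R g (cscale \<alpha> v) = cscale \<alpha> (R g v)"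
    and R_norm: "g \<in> carrier G \<Longrightarrow> norm (R g) \<le> 1"
begin

definition symbol_rep :: "('g \<Rightarrow>\<^sub>0 complex) \<Rightarrow> 'i ell2 \<Rightarrow>\<^sub>L 'i ell2" where
  "symbol_rep = lin_ext (\<lambda>g x. cscale_blinfun x o\<^sub>L R g)"

lemma symbol_rep_add: "symbol_rep (a + b) = symbol_rep a + symbol_rep b"
  unfolding symbol_rep_def
  by (rule lin_ext_add) (rule blinfun_eqI, simp add: cscale_add_left blinfun.add_left)

lemma symbol_rep_sum: "symbol_rep (sum h A) = (\<Sum>j\<in>A. symbol_rep (h j))"
proof (induction A rule: infinite_finite_induct)
  case (insert x F)
  then show ?case by (simp add: symbol_rep_add)
qed (simp_all add: symbol_rep_def)

lemma symbol_rep_single: "symbol_rep (Poly_Mapping.single g x) = cscale_blinfun x o\<^sub>L R g"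
  unfolding symbol_rep_def by (rule lin_ext_single) (rule blinfun_eqI, simp)

lemma symbol_rep_apply:
  "symbol_rep a v = (\<Sum>g\<in>Poly_Mapping.keys a. cscale (Poly_Mapping.lookup a g) (R g v))"
  unfolding symbol_rep_def lin_ext_def by (simp add: blinfun.sum_left)

lemma cscale_sum: "cscale \<alpha> (sum h A) = (\<Sum>j\<in>A. cscale \<alpha> (h j))"
  by (rule linear_sum) (rule bounded_linear.linear[OF bounded_linear_cscale])

lemma star_rep_symbol: "star_rep (symbol_algebra G \<sigma>) symbol_rep"
proof (intro star_rep.intro star_rep_axioms.intro normed_star_algebra_symbol)
  let ?A = "symbol_algebra G \<sigma>"
  fix x y \<alpha> and v w :: "'i ell2" assume x: "x \<in> carrier ?A"
  then have kx: "Poly_Mapping.keys x \<subseteq> carrier G" by (simp add: symbol_algebra_simps)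
  let ?X = "Poly_Mapping.lookup x"
  show "symbol_rep (\<alpha> \<odot>\<^bsub>?A\<^esub> x) = cscale_blinfun \<alpha> o\<^sub>L symbol_rep x"
  proof (rule blinfun_eqI)
    fix v
    have "symbol_rep (\<alpha> \<odot>\<^bsub>?A\<^esub> x) = lin_ext (\<lambda>g c. cscale_blinfun (\<alpha> * c) o\<^sub>L R g) x"
      unfolding symbol_rep_def symbol_algebra_simps
      by (rule lin_ext_smult) (rule blinfun_eqI, simp)
    then show "symbol_rep (\<alpha> \<odot>\<^bsub>?A\<^esub> x) v = (cscale_blinfun \<alpha> o\<^sub>L symbol_rep x) v"
      by (simp add: symbol_rep_apply cscale_sum) (simp add: lin_ext_def blinfun.sum_left)
  qed
  show "symbol_rep (adj ?A x) v \<bullet> w = v \<bullet> symbol_rep x w"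
  proof -
    have "symbol_rep (adj ?A x) v = (\<Sum>g\<in>Poly_Mapping.keys x. cscale (cnj (?X g)) (R (inv g) v))"
      unfolding symbol_algebra_simps lin_ext_def symbol_rep_sum symbol_rep_single
      by (simp add: blinfun.sum_left)
    then have "symbol_rep (adj ?A x) v \<bullet> w =
        (\<Sum>g\<in>Poly_Mapping.keys x. cscale (cnj (?X g)) (R (inv g) v) \<bullet> w)"
      by (simp add: inner_sum_left)
    also have "\<dots> = (\<Sum>g\<in>Poly_Mapping.keys x. v \<bullet> cscale (?X g) (R g w))"
      by (rule sum.cong) (use kx in \<open>auto simp: inner_cscale_left R_inv simp flip: R_cscale\<close>)
    also have "\<dots> = v \<bullet> symbol_rep x w"
      by (simp add: symbol_rep_apply inner_sum_right)
    finally show ?thesis .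
  qed
  show "symbol_rep x (cscale \<alpha> v) = cscale \<alpha> (symbol_rep x v)"
    unfolding symbol_rep_apply cscale_sum
    by (rule sum.cong) (use kx in \<open>auto simp: R_cscale mult.commute\<close>)
  show "norm (symbol_rep x) \<le> nrm ?A x"
  proof (rule norm_blinfun_bound)
    show "0 \<le> nrm ?A x" by (rule normed_star_algebra.nrm_nonneg[OF normed_star_algebra_symbol x])
    fix v
    have "norm (symbol_rep x v) \<le> (\<Sum>g\<in>Poly_Mapping.keys x. norm (cscale (?X g) (R g v)))"
      unfolding symbol_rep_apply by (rule norm_sum)
    also have "\<dots> \<le> (\<Sum>g\<in>Poly_Mapping.keys x. cmod (?X g) * norm v)"
    proof (rule sum_mono)
      fix g assume "g \<in> Poly_Mapping.keys x"
      then have "norm (R g) \<le> 1" using R_norm kx by blast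
      then have "norm (R g v) \<le> norm v"
        using norm_blinfun[of "R g" v] mult_right_mono[of "norm (R g)" 1 "norm v"] by simp
      then show "norm (cscale (?X g) (R g v)) \<le> cmod (?X g) * norm v"
        by (simp add: mult_left_mono)
    qed
    also have "\<dots> = nrm ?A x * norm v"
      by (simp add: symbol_algebra_simps lin_ext_def sum_distrib_right)
    finally show "norm (symbol_rep x v) \<le> nrm ?A x * norm v" .
  qed
  assume "y \<in> carrier ?A"
  then have ky: "Poly_Mapping.keys y \<subseteq> carrier G" by (simp add: symbol_algebra_simps)
  let ?Y = "Poly_Mapping.lookup y"
  show "symbol_rep (x \<oplus>\<^bsub>?A\<^esub> y) = symbol_rep x + symbol_rep y"
    by (simp add: symbol_algebra_simps symbol_rep_add)
  show "symbol_rep (x \<otimes>\<^bsub>?A\<^esub> y) = symbol_rep x o\<^sub>L symbol_rep y"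
  proof (rule blinfun_eqI)
    fix v
    have "symbol_rep (x \<otimes>\<^bsub>?A\<^esub> y) v = (\<Sum>g\<in>Poly_Mapping.keys x. \<Sum>h\<in>Poly_Mapping.keys y.
        cscale (?X g * ?Y h * circle_exp (\<sigma> g h)) (R (g \<otimes> h) v))"
      unfolding symbol_algebra_simps lin_ext_def symbol_rep_sum symbol_rep_single
      by (simp add: blinfun.sum_left)
    also have "\<dots> = (\<Sum>g\<in>Poly_Mapping.keys x. \<Sum>h\<in>Poly_Mapping.keys y.
        cscale (?X g) (R g (cscale (?Y h) (R h v))))"
    proof (intro sum.cong refl)
      fix g h assume "g \<in> Poly_Mapping.keys x" "h \<in> Poly_Mapping.keys y"
      then have g: "g \<in> carrier G" and h: "h \<in> carrier G" using kx ky by auto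
      show "cscale (?X g * ?Y h * circle_exp (\<sigma> g h)) (R (g \<otimes> h) v) =
          cscale (?X g) (R g (cscale (?Y h) (R h v)))"
        by (simp add: R_cscale[OF g] R_mult[OF g h] mult.assoc)
    qed
    also have "\<dots> = symbol_rep x (symbol_rep y v)"
      by (simp add: symbol_rep_apply blinfun.sum_right cscale_sum) (rule sum.swap)
    finally show "symbol_rep (x \<otimes>\<^bsub>?A\<^esub> y) v = (symbol_rep x o\<^sub>L symbol_rep y) v" by simp
  qed
qed

text \<open>The chain of extensions: symbols, their l1 completion, the same algebra under the
  largest C*-seminorm, and its completion. \<open>weyl_rep\<close> is the continuous extension of R
  through all of them.\<close>

sublocale sym: star_rep "symbol_algebra G \<sigma>" symbol_rep
  by (rule star_rep_symbol)

sublocale ban: star_rep "weyl_banach G \<sigma>" sym.extend_rep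
  unfolding weyl_banach_def by (rule sym.star_rep_completion)

sublocale cst: star_rep "cstar_normed (weyl_banach G \<sigma>)" sym.extend_rep
  by (rule ban.star_rep_cstar)

definition weyl_rep :: "'g weyl_elem \<Rightarrow> 'i ell2 \<Rightarrow>\<^sub>L 'i ell2" where
  "weyl_rep = cst.extend_rep"

sublocale weyl: star_rep "weyl_algebra G \<sigma>" weyl_rep
  unfolding weyl_algebra_def enveloping_cstar_def weyl_rep_def by (rule cst.star_rep_completion)

lemma
  assumes "a \<in> carrier (symbol_algebra G \<sigma>)"
  shows banach_embed_mem: "alg_embed (symbol_algebra G \<sigma>) a \<in> carrier (weyl_banach G \<sigma>)"
    and weyl_embed_mem: "alg_embed (cstar_normed (weyl_banach G \<sigma>)) (alg_embed (symbol_algebra G \<sigma>) a)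
      \<in> carrier (weyl_algebra G \<sigma>)"
    and weyl_rep_embed: "weyl_rep (alg_embed (cstar_normed (weyl_banach G \<sigma>))
      (alg_embed (symbol_algebra G \<sigma>) a)) = symbol_rep a"
proof -
  show 1: "alg_embed (symbol_algebra G \<sigma>) a \<in> carrier (weyl_banach G \<sigma>)"
    using sym.const_seqs[OF assms] by (auto simp: weyl_banach_def sym.carrier_completion alg_embed_def)
  then have 2: "alg_embed (symbol_algebra G \<sigma>) a \<in> carrier (cstar_normed (weyl_banach G \<sigma>))"
    by (simp add: ban.cstar_normed_simps)
  show "alg_embed (cstar_normed (weyl_banach G \<sigma>)) (alg_embed (symbol_algebra G \<sigma>) a)
      \<in> carrier (weyl_algebra G \<sigma>)"
    using cst.const_seqs[OF 2]
    by (auto simp: weyl_algebra_def enveloping_cstar_def cst.carrier_completion alg_embed_def)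
  show "weyl_rep (alg_embed (cstar_normed (weyl_banach G \<sigma>)) (alg_embed (symbol_algebra G \<sigma>) a)) = symbol_rep a"
    unfolding weyl_rep_def cst.extend_rep_embed[OF 2] by (rule sym.extend_rep_embed[OF assms])
qed

lemma
  assumes "g \<in> carrier G"
  shows weyl_gen_mem: "weyl_gen G \<sigma> g \<in> carrier (weyl_algebra G \<sigma>)"
    and weyl_rep_gen: "weyl_rep (weyl_gen G \<sigma> g) = R g"
proof -
  have s: "Poly_Mapping.single g 1 \<in> carrier (symbol_algebra G \<sigma>)"
    using assms by (simp add: symbol_algebra_simps)
  show "weyl_gen G \<sigma> g \<in> carrier (weyl_algebra G \<sigma>)"
    unfolding weyl_gen_def by (rule weyl_embed_mem[OF s])
  show "weyl_rep (weyl_gen G \<sigma> g) = R g"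
    unfolding weyl_gen_def weyl_rep_embed[OF s] symbol_rep_single by (rule blinfun_eqI) simp
qed

text \<open>The functional is defined by the same two limits as the representation, so agreement on
  symbols suffices; the representing vector stays the same throughout.\<close>

lemma weyl_functional_vector_state:
  assumes w: "\<And>g. g \<in> carrier G \<Longrightarrow> w g = cinner e (R g e)"
    and x: "x \<in> carrier (weyl_algebra G \<sigma>)"
  shows "weyl_functional w x = cinner e (weyl_rep x e)"
  unfolding weyl_functional_def weyl_rep_def
proof (rule cst.extend_fun_vector_state)
  show "x \<in> carrier (alg_completion (cstar_normed (weyl_banach G \<sigma>)))"
    using x by (simp add: weyl_algebra_def enveloping_cstar_def)
  fix y assume y: "y \<in> carrier (cstar_normed (weyl_banach G \<sigma>))"
  show "extend_fun (\<lambda>a. \<Sum>g\<in>Poly_Mapping.keys a. Poly_Mapping.lookup a g * w g) y =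
      cinner e (sym.extend_rep y e)"
  proof (rule sym.extend_fun_vector_state)
    show "y \<in> carrier (alg_completion (symbol_algebra G \<sigma>))"
      using y unfolding ban.cstar_normed_simps by (simp add: weyl_banach_def)
    fix a assume "a \<in> carrier (symbol_algebra G \<sigma>)"
    then have a: "Poly_Mapping.keys a \<subseteq> carrier G" by (simp add: symbol_algebra_simps)
    have sum: "cinner e (\<Sum>g\<in>A. h g) = (\<Sum>g\<in>A. cinner e (h g))" for h :: "'g \<Rightarrow> 'i ell2" and A
      by (induction A rule: infinite_finite_induct) (simp_all add: cinner_def complex_eq_iff inner_add_right)
    have "cinner e (symbol_rep a e) = (\<Sum>g\<in>Poly_Mapping.keys a. Poly_Mapping.lookup a g * cinner e (R g e))"
      unfolding symbol_rep_apply sum cinner_cscale_right ..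
    also have "\<dots> = (\<Sum>g\<in>Poly_Mapping.keys a. Poly_Mapping.lookup a g * w g)"
      by (rule sum.cong) (use a w in auto)
    finally show "(\<Sum>g\<in>Poly_Mapping.keys a. Poly_Mapping.lookup a g * w g) = cinner e (symbol_rep a e)" ..
  qed
qed

lemma weyl_rep_coord_zero:
  assumes R: "\<And>g v. g \<in> carrier G \<Longrightarrow> coord (R g v) i = 0" and x: "x \<in> carrier (weyl_algebra G \<sigma>)"
  shows "coord (weyl_rep x v) i = 0"
proof -
  have 0: "coord (symbol_rep a v) i = 0" if "a \<in> carrier (symbol_algebra G \<sigma>)" for a
    unfolding symbol_rep_apply coord_sum
    by (rule sum.neutral) (use that R in \<open>auto simp: symbol_algebra_simps\<close>)
  have 1: "coord (sym.extend_rep y v) i = 0" if "y \<in> carrier (weyl_banach G \<sigma>)" for y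
    using sym.extend_rep_coord_zero[OF 0] that by (simp add: weyl_banach_def)
  show ?thesis
    unfolding weyl_rep_def
    by (rule cst.extend_rep_coord_zero)
      (use 1 x in \<open>auto simp: ban.cstar_normed_simps weyl_algebra_def enveloping_cstar_def\<close>)
qed

end

text \<open>A relation between generators passes to symbols by linearity and to the Weyl algebras by
  two completions. The change of norm in between is harmless because C*-seminorms pull back along
  the morphism.\<close>

lemma weyl_map_intertwiner:
  fixes T :: "'i ell2 \<Rightarrow>\<^sub>L 'j ell2"
  assumes R: "projective_rep G \<sigma> R" and R': "projective_rep G' \<sigma>' R'"
    and \<zeta>: "\<zeta> \<in> hom G G'"
    and \<sigma>: "\<And>g h. g \<in> carrier G \<Longrightarrow> h \<in> carrier G \<Longrightarrow> \<sigma>' (\<zeta> g) (\<zeta> h) = \<sigma> g h"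
    and T: "\<And>g v. g \<in> carrier G \<Longrightarrow> T (R g v) = R' (\<zeta> g) (T v)"
    and T_cscale: "\<And>\<alpha> v. T (cscale \<alpha> v) = cscale \<alpha> (T v)"
    and x: "x \<in> carrier (weyl_algebra G \<sigma>)"
  shows "weyl_map G' \<sigma>' \<zeta> x \<in> carrier (weyl_algebra G' \<sigma>')"
    and "T (projective_rep.weyl_rep R x v) =
      projective_rep.weyl_rep R' (weyl_map G' \<sigma>' \<zeta> x) (T v)"
    and "g \<in> carrier G \<Longrightarrow> weyl_map G' \<sigma>' \<zeta> (weyl_gen G \<sigma> g) = weyl_gen G' \<sigma>' (\<zeta> g)"
proof -
  interpret R: projective_rep G \<sigma> R by fact
  interpret R': projective_rep G' \<sigma>' R' by fact
  let ?F = "lin_ext (\<lambda>g. Poly_Mapping.single (\<zeta> g)) :: _ \<Rightarrow> _ \<Rightarrow>\<^sub>0 complex"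
  interpret F0: contractive_star_hom "symbol_algebra G \<sigma>" "symbol_algebra G' \<sigma>'" ?F
    by (rule contractive_star_hom_symbol) (use R.is_group R'.is_group \<zeta> \<sigma> in auto)
  let ?F1 = "extend_map (symbol_algebra G' \<sigma>') ?F"
  interpret F1: contractive_star_hom "weyl_banach G \<sigma>" "weyl_banach G' \<sigma>'" ?F1
    unfolding weyl_banach_def by (rule F0.contractive_star_hom_completion)
  interpret F1c: contractive_star_hom "cstar_normed (weyl_banach G \<sigma>)" "cstar_normed (weyl_banach G' \<sigma>')" ?F1
    by (rule F1.contractive_star_hom_cstar)
  have wm: "weyl_map G' \<sigma>' \<zeta> = extend_map (cstar_normed (weyl_banach G' \<sigma>')) ?F1"
    by (simp add: weyl_map_def lin_ext_def[abs_def])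
  interpret F2: contractive_star_hom "weyl_algebra G \<sigma>" "weyl_algebra G' \<sigma>'" "weyl_map G' \<sigma>' \<zeta>"
    unfolding weyl_algebra_def enveloping_cstar_def wm by (rule F1c.contractive_star_hom_completion)
  show "weyl_map G' \<sigma>' \<zeta> x \<in> carrier (weyl_algebra G' \<sigma>')" by (rule F2.hom_closed[OF x])
  have 0: "T o\<^sub>L R.symbol_rep a = R'.symbol_rep (?F a) o\<^sub>L T" if "a \<in> carrier (symbol_algebra G \<sigma>)" for a
  proof (rule blinfun_eqI)
    fix v
    have "R'.symbol_rep (?F a) (T v) =
        (\<Sum>g\<in>Poly_Mapping.keys a. cscale (Poly_Mapping.lookup a g) (R' (\<zeta> g) (T v)))"
      unfolding lin_ext_def R'.symbol_rep_sum R'.symbol_rep_single by (simp add: blinfun.sum_left)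
    also have "\<dots> = (\<Sum>g\<in>Poly_Mapping.keys a. cscale (Poly_Mapping.lookup a g) (T (R g v)))"
      by (rule sum.cong) (use that T in \<open>auto simp: symbol_algebra_simps subset_iff\<close>)
    finally show "(T o\<^sub>L R.symbol_rep a) v = (R'.symbol_rep (?F a) o\<^sub>L T) v"
      by (simp add: R.symbol_rep_apply blinfun.sum_right T_cscale)
  qed
  have 1: "T o\<^sub>L R.sym.extend_rep y = R'.sym.extend_rep (?F1 y) o\<^sub>L T"
    if "y \<in> carrier (cstar_normed (weyl_banach G \<sigma>))" for y
    by (rule intertwiner_completion[OF F0.contractive_star_hom_axioms R.sym.star_rep_axioms R'.sym.star_rep_axioms 0])
      (use that[unfolded R.ban.cstar_normed_simps] in \<open>simp_all add: weyl_banach_def\<close>)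
  have "T o\<^sub>L R.weyl_rep x = R'.weyl_rep (weyl_map G' \<sigma>' \<zeta> x) o\<^sub>L T"
    unfolding R.weyl_rep_def R'.weyl_rep_def wm
    by (rule intertwiner_completion[OF F1c.contractive_star_hom_axioms R.cst.star_rep_axioms R'.cst.star_rep_axioms 1])
      (use x in \<open>simp_all add: weyl_algebra_def enveloping_cstar_def\<close>)
  then show "T (R.weyl_rep x v) = R'.weyl_rep (weyl_map G' \<sigma>' \<zeta> x) (T v)"
    by (metis blinfun_apply_blinfun_compose)
  assume g: "g \<in> carrier G"
  have s: "Poly_Mapping.single g 1 \<in> carrier (symbol_algebra G \<sigma>)"
    using g by (simp add: symbol_algebra_simps)
  have s1: "alg_embed (symbol_algebra G \<sigma>) (Poly_Mapping.single g 1) \<in> carrier (cstar_normed (weyl_banach G \<sigma>))"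
    using R.banach_embed_mem[OF s] by (simp add: R.ban.cstar_normed_simps)
  show "weyl_map G' \<sigma>' \<zeta> (weyl_gen G \<sigma> g) = weyl_gen G' \<sigma>' (\<zeta> g)"
    unfolding wm weyl_gen_def F1c.extend_map_embed[OF s1] F0.extend_map_embed[OF s]
    by (simp add: lin_ext_single)
qed

section \<open>Operators diagonal in an orthonormal basis\<close>

lemma cinner_ket_vec: "cinner (ket_vec j) x = coord x j"
proof -
  have r: "ket_vec j \<bullet> x = Re (coord x j)" for x
  proof -
    have "ket_vec j \<bullet> x = (\<Sum>\<^sub>\<infinity>i\<in>{j}. Re (coord x i))"
      unfolding inner_ell2_def by (rule infsum_cong_neutral) (auto simp: coord_ket_vec)
    then show ?thesis by simp
  qed
  show ?thesis by (simp add: cinner_def complex_eq_iff inner_cscale_left r)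
qed

context hilbert_model
begin

lemma coord_lincomb:
  assumes "finite A" "\<And>j. j \<in> A \<Longrightarrow> e j \<in> carrier H" "\<And>j. j \<in> A \<Longrightarrow> J (e j) = ket_vec j"
  shows "coord (J (lincomb H e \<alpha> A)) i = (if i \<in> A then \<alpha> i else 0)"
proof -
  have "coord (J (lincomb H e \<alpha> A)) i = (\<Sum>j\<in>A. if i = j then \<alpha> j else 0)"
    using assms by (simp add: J_lincomb coord_sum coord_ket_vec if_distrib cong: if_cong)
  with assms(1) show ?thesis by simp
qed

text \<open>The description by \<open>THE\<close> determines a value because the coefficients of a
  combination are recovered as the coordinates of its image under J.\<close>

lemma diag_operator_lincomb:
  assumes e: "\<And>j. j \<in> B \<Longrightarrow> e j \<in> carrier H" "\<And>j. j \<in> B \<Longrightarrow> J (e j) = ket_vec j"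
    and A: "finite A" "A \<subseteq> B"
  shows "diag_operator H e B ev (lincomb H e \<alpha> A) = lincomb H e (\<lambda>j. \<alpha> j * ev j) A"
  unfolding diag_operator_def
proof (rule the_equality)
  show "\<exists>\<alpha>' F. finite F \<and> F \<subseteq> B \<and> lincomb H e \<alpha> A = lincomb H e \<alpha>' F \<and>
      lincomb H e (\<lambda>j. \<alpha> j * ev j) A = lincomb H e (\<lambda>j. \<alpha>' j * ev j) F"
    using A by blast
  fix y
  assume "\<exists>\<alpha>' F. finite F \<and> F \<subseteq> B \<and> lincomb H e \<alpha> A = lincomb H e \<alpha>' F \<and>
      y = lincomb H e (\<lambda>j. \<alpha>' j * ev j) F"
  then obtain \<beta> F where F: "finite F" "F \<subseteq> B" and eq: "lincomb H e \<alpha> A = lincomb H e \<beta> F"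
    and y: "y = lincomb H e (\<lambda>j. \<beta> j * ev j) F"
    by blast
  have c: "coord (J (lincomb H e \<gamma> C)) i = (if i \<in> C then \<gamma> i else 0)" if "finite C" "C \<subseteq> B" for \<gamma> C i
    by (rule coord_lincomb) (use that e in auto)
  \<comment> \<open>Two expansions of the same vector may have different index sets where
    coefficients vanish, so the coefficients are compared after extension by zero.\<close>
  have ab: "(if i \<in> A then \<alpha> i else 0) = (if i \<in> F then \<beta> i else 0)" for i
    using c[OF A, of \<alpha> i] c[OF F, of \<beta> i] eq by simp
  have "J y = J (lincomb H e (\<lambda>j. \<alpha> j * ev j) A)"
  proof (rule ell2_eqI)
    fix i
    show "coord (J y) i = coord (J (lincomb H e (\<lambda>j. \<alpha> j * ev j) A)) i"
      using ab[of i] unfolding y c[OF A] c[OF F] by (auto split: if_splits)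
  qed
  then show "y = lincomb H e (\<lambda>j. \<alpha> j * ev j) A"
    unfolding y using A F e by (intro J_eqI lincomb_mem) auto
qed

lemma lincomb_reindex:
  assumes "finite A" "inj_on \<theta> A" "\<And>j. j \<in> A \<Longrightarrow> e (\<theta> j) \<in> carrier H"
    "\<And>j. j \<in> A \<Longrightarrow> \<beta> (\<theta> j) = \<alpha> j"
  shows "lincomb H (\<lambda>j. e (\<theta> j)) \<alpha> A = lincomb H e \<beta> (\<theta> ` A)"
proof (rule J_eqI)
  show "J (lincomb H (\<lambda>j. e (\<theta> j)) \<alpha> A) = J (lincomb H e \<beta> (\<theta> ` A))"
    using assms by (subst (1 2) J_lincomb) (auto simp: sum.reindex)
qed (use assms in \<open>auto intro!: lincomb_mem\<close>)

end

subsection \<open>Phase and shift operators\<close>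

text \<open>\<open>p\<close> is the projection of the symplectic group to the lattice \<open>F\<close>, and \<open>\<tau> g\<close> the character of
  \<open>F\<close> given by the phase part of \<open>g\<close>. The section \<open>s\<close> embeds the shifts.\<close>

locale phase_shift = G: group G + F: comm_group F
  for G :: "('g, 'm) monoid_scheme" and F :: "('i, 'n) monoid_scheme" +
  fixes p :: "'g \<Rightarrow> 'i" and \<tau> :: "'g \<Rightarrow> 'i \<Rightarrow> circle" and \<sigma> :: "'g \<Rightarrow> 'g \<Rightarrow> circle" and s :: "'i \<Rightarrow> 'g"
    and w :: "'g \<Rightarrow> complex"
  assumes p_hom: "p \<in> hom G F"
    and \<tau>_left: "g \<in> carrier G \<Longrightarrow> h \<in> carrier G \<Longrightarrow> y \<in> carrier F \<Longrightarrow> \<tau> (g \<otimes>\<^bsub>G\<^esub> h) y = \<tau> g y + \<tau> h y"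
    and \<tau>_right: "g \<in> carrier G \<Longrightarrow> x \<in> carrier F \<Longrightarrow> y \<in> carrier F \<Longrightarrow> \<tau> g (x \<otimes>\<^bsub>F\<^esub> y) = \<tau> g x + \<tau> g y"
    and \<sigma>_eq: "g \<in> carrier G \<Longrightarrow> h \<in> carrier G \<Longrightarrow> \<sigma> g h = \<tau> g (p h) - \<tau> h (p g)"
    and s_mem: "y \<in> carrier F \<Longrightarrow> s y \<in> carrier G"
    and p_s: "y \<in> carrier F \<Longrightarrow> p (s y) = y"
    and \<tau>_s: "y \<in> carrier F \<Longrightarrow> x \<in> carrier F \<Longrightarrow> \<tau> (s y) x = 0"
    and w_eq: "g \<in> carrier G \<Longrightarrow> w g = (if p g = \<one>\<^bsub>F\<^esub> then 1 else 0)"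
begin

lemma p_mem: "g \<in> carrier G \<Longrightarrow> p g \<in> carrier F"
  and p_mult: "g \<in> carrier G \<Longrightarrow> h \<in> carrier G \<Longrightarrow> p (g \<otimes>\<^bsub>G\<^esub> h) = p g \<otimes>\<^bsub>F\<^esub> p h"
  using p_hom by (auto simp: hom_def)

lemma p_inv: "g \<in> carrier G \<Longrightarrow> p (inv\<^bsub>G\<^esub> g) = inv\<^bsub>F\<^esub> p g"
  using group_hom.hom_inv[of G F p g] p_hom by (simp add: group_hom_def group_hom_axioms_def)

lemma \<tau>_one: "g \<in> carrier G \<Longrightarrow> \<tau> g \<one>\<^bsub>F\<^esub> = 0"
  using \<tau>_right[of g "\<one>\<^bsub>F\<^esub>" "\<one>\<^bsub>F\<^esub>"] by simp

lemma \<tau>_inv_right: "g \<in> carrier G \<Longrightarrow> y \<in> carrier F \<Longrightarrow> \<tau> g (inv\<^bsub>F\<^esub> y) = - \<tau> g y"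
  using \<tau>_right[of g "inv\<^bsub>F\<^esub> y" y] \<tau>_one[of g] by (simp add: eq_neg_iff_add_eq_0)

lemma \<tau>_inv_left: "g \<in> carrier G \<Longrightarrow> y \<in> carrier F \<Longrightarrow> \<tau> (inv\<^bsub>G\<^esub> g) y = - \<tau> g y"
  using \<tau>_left[of "inv\<^bsub>G\<^esub> g" g y] \<tau>_left[of "\<one>\<^bsub>G\<^esub>" "\<one>\<^bsub>G\<^esub>" y] by (simp add: eq_neg_iff_add_eq_0)

text \<open>In additive notation the exponent is \<tau>(p g + 2 y). By the Weyl relation, g times
  the shift by y produces \<tau>(y) and an element with lattice part p g + y and the phase part of
  g. Moving that phase part past the shift to the vacuum, which it fixes, produces \<tau>(p g +
  y).\<close>

definition phase :: "'g \<Rightarrow> 'i \<Rightarrow> complex" where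
  "phase g y = circle_exp (\<tau> g (p g) + \<tau> g y + \<tau> g y)"

text \<open>In additive notation the coordinate i is the target p g + y of a basis vector; hence the
  source is y = i - p g, and the phase is taken at the source.\<close>

definition R :: "'g \<Rightarrow> 'i ell2 \<Rightarrow>\<^sub>L 'i ell2" where
  "R g = weighted_comp (\<lambda>i. phase g (inv\<^bsub>F\<^esub> (p g) \<otimes>\<^bsub>F\<^esub> i)) (\<lambda>i. inv\<^bsub>F\<^esub> (p g) \<otimes>\<^bsub>F\<^esub> i) (carrier F)"

lemma cmod_phase [simp]: "cmod (phase g y) = 1"
  by (simp add: phase_def)

lemma inj_shift: "y \<in> carrier F \<Longrightarrow> inj_on (\<lambda>i. y \<otimes>\<^bsub>F\<^esub> i) (carrier F)"
  by (rule inj_onI) simp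

lemma coord_R:
  assumes "g \<in> carrier G"
  shows "coord (R g v) i = (if i \<in> carrier F
    then phase g (inv\<^bsub>F\<^esub> (p g) \<otimes>\<^bsub>F\<^esub> i) * coord v (inv\<^bsub>F\<^esub> (p g) \<otimes>\<^bsub>F\<^esub> i) else 0)"
  unfolding R_def by (rule coord_weighted_comp) (use assms p_mem in \<open>auto intro!: inj_shift\<close>)

text \<open>The exponent on the left contains \<tau> g (p h) twice; that of the product contains it
  once, together with \<tau> h (p g). The defect is exactly \<sigma> g h.\<close>

lemma phase_mult:
  assumes "g \<in> carrier G" "h \<in> carrier G" "y \<in> carrier F"
  shows "phase g (p h \<otimes>\<^bsub>F\<^esub> y) * phase h y = circle_exp (\<sigma> g h) * phase (g \<otimes>\<^bsub>G\<^esub> h) y"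
  unfolding phase_def circle_exp_add[symmetric]
  by (rule arg_cong[where f = circle_exp])
    (simp add: assms \<sigma>_eq \<tau>_left \<tau>_right p_mem p_mult algebra_simps)

sublocale projective_rep G \<sigma> R
proof
  fix g assume g: "g \<in> carrier G"
  show "norm (R g) \<le> 1"
    unfolding R_def by (rule norm_weighted_comp) (use g p_mem in \<open>auto intro!: inj_shift\<close>)
  fix v w :: "'i ell2" and \<alpha>
  show "R g (cscale \<alpha> v) = cscale \<alpha> (R g v)"
    by (rule ell2_eqI) (simp add: coord_R g)
  show "R (inv\<^bsub>G\<^esub> g) v \<bullet> w = v \<bullet> R g w"
    unfolding R_def
  proof (rule weighted_comp_adjoint)
    let ?f = "\<lambda>i. inv\<^bsub>F\<^esub> p (inv\<^bsub>G\<^esub> g) \<otimes>\<^bsub>F\<^esub> i"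
    have f: "?f i = p g \<otimes>\<^bsub>F\<^esub> i" for i using g p_mem by (simp add: p_inv)
    show "bij_betw ?f (carrier F) (carrier F)"
      unfolding f by (rule bij_betw_byWitness[where f' = "\<lambda>i. inv\<^bsub>F\<^esub> p g \<otimes>\<^bsub>F\<^esub> i"])
        (use g p_mem in \<open>auto simp flip: F.m_assoc\<close>)
    fix i assume i: "i \<in> carrier F"
    show gf: "inv\<^bsub>F\<^esub> p g \<otimes>\<^bsub>F\<^esub> ?f i = i"
      unfolding f using g p_mem i by (simp flip: F.m_assoc)
    \<comment> \<open>Additively, the exponent of the inverse at i + p g is \<tau> g (p g) - 2
      \<tau> g (p g) - 2 \<tau> g i, the negative of the exponent of g at i.\<close>
    show "phase g (inv\<^bsub>F\<^esub> p g \<otimes>\<^bsub>F\<^esub> ?f i) = cnj (phase (inv\<^bsub>G\<^esub> g) (?f i))"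
      unfolding gf unfolding f phase_def circle_exp_minus[symmetric]
      by (rule arg_cong[where f = circle_exp])
        (use g i p_mem in \<open>simp add: \<tau>_inv_left \<tau>_inv_right \<tau>_right p_inv algebra_simps\<close>)
  qed simp
  fix h assume h: "h \<in> carrier G"
  show "R g (R h v) = cscale (circle_exp (\<sigma> g h)) (R (g \<otimes>\<^bsub>G\<^esub> h) v)"
  proof (rule ell2_eqI)
    fix i
    show "coord (R g (R h v)) i = coord (cscale (circle_exp (\<sigma> g h)) (R (g \<otimes>\<^bsub>G\<^esub> h) v)) i"
    proof (cases "i \<in> carrier F")
      case True
      \<comment> \<open>The source of i under the product of g and h; applying h first leads through
        the intermediate point p h + ?y, written additively.\<close>
      let ?y = "inv\<^bsub>F\<^esub> p (g \<otimes>\<^bsub>G\<^esub> h) \<otimes>\<^bsub>F\<^esub> i"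
      have y: "?y \<in> carrier F" using g h True p_mem by simp
      have 1: "inv\<^bsub>F\<^esub> p g \<otimes>\<^bsub>F\<^esub> i = p h \<otimes>\<^bsub>F\<^esub> ?y"
        using g h True p_mem[OF g] p_mem[OF h]
        by (simp add: p_mult F.inv_mult F.m_assoc[symmetric] F.m_comm[of "p h"] F.m_comm[of "inv\<^bsub>F\<^esub> p g"])
      have 2: "inv\<^bsub>F\<^esub> p h \<otimes>\<^bsub>F\<^esub> (p h \<otimes>\<^bsub>F\<^esub> ?y) = ?y"
        using h y p_mem by (simp flip: F.m_assoc)
      show ?thesis
        using g h True y p_mem phase_mult[OF g h y]
        by (simp add: coord_R 1 2 mult.assoc[symmetric])
    qed (simp add: coord_R g h)
  qed
qed

definition vac :: "'i ell2" where "vac = ket_vec \<one>\<^bsub>F\<^esub>"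

text \<open>The character of \<open>s y\<close> is trivial, so no phase appears and the shifts of
  the vacuum are the standard basis vectors.\<close>

lemma R_s_vac: assumes "y \<in> carrier F" shows "R (s y) vac = ket_vec y"
proof (rule ell2_eqI)
  fix i
  have "inv\<^bsub>F\<^esub> y \<otimes>\<^bsub>F\<^esub> i = \<one>\<^bsub>F\<^esub> \<longleftrightarrow> i = y" if "i \<in> carrier F"
  proof
    assume 1: "inv\<^bsub>F\<^esub> y \<otimes>\<^bsub>F\<^esub> i = \<one>\<^bsub>F\<^esub>"
    have "i = y \<otimes>\<^bsub>F\<^esub> (inv\<^bsub>F\<^esub> y \<otimes>\<^bsub>F\<^esub> i)"
      using that assms by (simp flip: F.m_assoc)
    then show "i = y" using assms by (simp add: 1)
  qed (use assms in simp)
  then show "coord (R (s y) vac) i = coord (ket_vec y) i"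
    using assms by (auto simp: coord_R s_mem p_s vac_def coord_ket_vec phase_def \<tau>_s)
qed

abbreviation "W \<equiv> weyl_algebra G \<sigma>"
abbreviation "\<omega> \<equiv> weyl_functional w"

sublocale gns: vector_state W weyl_rep vac \<omega>
proof
  fix x assume x: "x \<in> carrier W"
  show "\<omega> x = cinner vac (weyl_rep x vac)"
  proof (rule weyl_functional_vector_state[OF _ x])
    fix g assume g: "g \<in> carrier G"
    \<comment> \<open>Pairing with the vacuum reads off the coordinate at the neutral element, whose
      source is the inverse of p g. That source is the vacuum index exactly when p g is neutral, and
      then the phase is 1 because \<tau> g vanishes there.\<close>
    have "inv\<^bsub>F\<^esub> p g = \<one>\<^bsub>F\<^esub> \<longleftrightarrow> p g = \<one>\<^bsub>F\<^esub>"
      using p_mem[OF g] F.inv_eq_1_iff by blast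
    then show "w g = cinner vac (R g vac)"
      using g p_mem[OF g] by (auto simp: w_eq vac_def cinner_ket_vec coord_R coord_ket_vec phase_def \<tau>_one)
  qed
qed

sublocale model: hilbert_model "gns_space W \<omega>" gns.gns_coord
  by (rule gns.hilbert_model_gns)

definition lattice_vec :: "'i \<Rightarrow> (nat \<Rightarrow> 'g weyl_elem) set" where
  "lattice_vec y = gns_vector W \<omega> (weyl_gen G \<sigma> (s y))"

lemma lattice_vec_mem: "y \<in> carrier F \<Longrightarrow> lattice_vec y \<in> carrier (gns_space W \<omega>)"
  and gns_coord_lattice_vec: "y \<in> carrier F \<Longrightarrow> gns.gns_coord (lattice_vec y) = ket_vec y"
  unfolding lattice_vec_def
  by (simp_all add: gns.gns_vector_mem gns.gns_coord_vector weyl_gen_mem weyl_rep_gen s_mem R_s_vac)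

text \<open>One inclusion is closedness of the support condition. The other is cyclicity of the
  vacuum: finite combinations of the symbols \<open>s j\<close> already reach a dense set of
  functions supported on the carrier.\<close>

lemma gns_range: "gns.gns_coord ` carrier (gns_space W \<omega>) = {L. \<forall>i. i \<notin> carrier F \<longrightarrow> coord L i = 0}"
  unfolding gns.range_gns_coord
proof (intro Set.set_eqI iffI)
  fix L assume "L \<in> {L. gns.approx L \<noteq> {}}"
  then obtain t where t: "\<And>n. t n \<in> carrier W" "(\<lambda>n. weyl_rep (t n) vac) \<longlonglongrightarrow> L"
    by (auto simp: gns.approx_def)
  have "coord L i = 0" if i: "i \<notin> carrier F" for i
  proof -
    have "coord (weyl_rep (t n) vac) i = 0" for n
      by (rule weyl_rep_coord_zero[OF _ t(1)]) (simp add: coord_R i)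
    moreover have "(\<lambda>n. coord (weyl_rep (t n) vac) i) \<longlonglongrightarrow> coord L i"
      by (rule bounded_linear.tendsto[OF bounded_linear_coord t(2)])
    ultimately show ?thesis using LIMSEQ_unique[OF _ tendsto_const] by simp
  qed
  then show "L \<in> {L. \<forall>i. i \<notin> carrier F \<longrightarrow> coord L i = 0}" by blast
next
  fix L assume "L \<in> {L. \<forall>i. i \<notin> carrier F \<longrightarrow> coord L i = 0}"
  then have L: "\<And>i. i \<notin> carrier F \<Longrightarrow> coord L i = 0" by blast
  have "\<forall>n. \<exists>x. x \<in> carrier W \<and> norm (L - weyl_rep x vac) < inverse (real (Suc n))"
  proof
    fix n
    obtain A where A: "finite A" "A \<subseteq> carrier F"
        "norm (L - (\<Sum>j\<in>A. cscale (coord L j) (ket_vec j))) < inverse (real (Suc n))"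
      using ell2_truncation[OF L, of "carrier F" "inverse (real (Suc n))"] by auto
    let ?a = "\<Sum>j\<in>A. Poly_Mapping.single (s j) (coord L j)"
    have a: "?a \<in> carrier (symbol_algebra G \<sigma>)"
    proof -
      have "Poly_Mapping.keys ?a \<subseteq> (\<Union>j\<in>A. Poly_Mapping.keys (Poly_Mapping.single (s j) (coord L j)))"
        by (rule keys_sum)
      also have "\<dots> \<subseteq> carrier G"
        using A(2) s_mem by (auto split: if_splits)
      finally show ?thesis by (simp add: symbol_algebra_simps)
    qed
    have "symbol_rep ?a vac = (\<Sum>j\<in>A. cscale (coord L j) (R (s j) vac))"
      by (simp add: symbol_rep_sum symbol_rep_single blinfun.sum_left)
    also have "\<dots> = (\<Sum>j\<in>A. cscale (coord L j) (ket_vec j))"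
      by (rule sum.cong) (use A(2) R_s_vac in auto)
    finally have "norm (L - symbol_rep ?a vac) < inverse (real (Suc n))"
      using A(3) by (simp only:)
    then show "\<exists>x. x \<in> carrier W \<and> norm (L - weyl_rep x vac) < inverse (real (Suc n))"
      unfolding weyl_rep_embed[OF a, symmetric] using weyl_embed_mem[OF a] by blast
  qed
  then obtain t where t: "\<forall>n. t n \<in> carrier W \<and> norm (L - weyl_rep (t n) vac) < inverse (real (Suc n))"
    unfolding choice_iff by blast
  have "(\<lambda>n. L - weyl_rep (t n) vac) \<longlonglongrightarrow> 0"
    by (rule Lim_null_comparison[OF _ LIMSEQ_inverse_real_of_nat])
      (use t in \<open>auto intro!: always_eventually less_imp_le\<close>)
  from tendsto_diff[OF tendsto_const[of L] this] have "t \<in> gns.approx L"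
    using t by (simp add: gns.approx_def)
  then show "L \<in> {L. gns.approx L \<noteq> {}}" by blast
qed

end

subsection \<open>Implementing an isomorphism of Weyl algebras\<close>

text \<open>\<theta> is the map that \<zeta> induces on the lattices, and the characters are
  required to correspond under it. Preservation of \<sigma> is then derived, in
  \<open>\<sigma>_\<zeta>\<close>.\<close>

locale weyl_duality = src: phase_shift G F p \<tau> \<sigma> s w + dst: phase_shift G' F' p' \<tau>' \<sigma>' s' w'
  for G :: "('g, 'm) monoid_scheme" and F :: "('i, 'n) monoid_scheme" and p \<tau> \<sigma> s w
    and G' :: "('h, 'k) monoid_scheme" and F' :: "('i, 'l) monoid_scheme" and p' \<tau>' \<sigma>' s' w' +
  fixes \<zeta> :: "'g \<Rightarrow> 'h" and \<theta> :: "'i \<Rightarrow> 'i"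
  assumes \<zeta>_hom: "\<zeta> \<in> hom G G'"
    and \<theta>_bij: "bij_betw \<theta> (carrier F) (carrier F')"
    and \<theta>_mult: "x \<in> carrier F \<Longrightarrow> y \<in> carrier F \<Longrightarrow> \<theta> (x \<otimes>\<^bsub>F\<^esub> y) = \<theta> x \<otimes>\<^bsub>F'\<^esub> \<theta> y"
    and p_\<zeta>: "g \<in> carrier G \<Longrightarrow> p' (\<zeta> g) = \<theta> (p g)"
    and \<tau>_\<zeta>: "g \<in> carrier G \<Longrightarrow> y \<in> carrier F \<Longrightarrow> \<tau>' (\<zeta> g) (\<theta> y) = \<tau> g y"
begin

definition \<theta>i :: "'i \<Rightarrow> 'i" where "\<theta>i = inv_into (carrier F) \<theta>"

lemma \<theta>_mem: "y \<in> carrier F \<Longrightarrow> \<theta> y \<in> carrier F'"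
  using \<theta>_bij by (auto simp: bij_betw_def)

lemma \<theta>i_mem: "y \<in> carrier F' \<Longrightarrow> \<theta>i y \<in> carrier F"
  unfolding \<theta>i_def using \<theta>_bij by (metis bij_betw_def inv_into_into)

lemma \<theta>_\<theta>i: "y \<in> carrier F' \<Longrightarrow> \<theta> (\<theta>i y) = y"
  unfolding \<theta>i_def using \<theta>_bij by (rule bij_betw_inv_into_right)

lemma \<theta>i_\<theta>: "y \<in> carrier F \<Longrightarrow> \<theta>i (\<theta> y) = y"
  unfolding \<theta>i_def using \<theta>_bij by (rule bij_betw_inv_into_left)

lemma \<zeta>_mem: "g \<in> carrier G \<Longrightarrow> \<zeta> g \<in> carrier G'"
  using \<zeta>_hom by (auto simp: hom_def)

lemma \<sigma>_\<zeta>: "g \<in> carrier G \<Longrightarrow> h \<in> carrier G \<Longrightarrow> \<sigma>' (\<zeta> g) (\<zeta> h) = \<sigma> g h"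
  by (simp add: src.\<sigma>_eq dst.\<sigma>_eq \<zeta>_mem p_\<zeta> \<tau>_\<zeta> src.p_mem)

text \<open>The inverse \<theta>i appears because weighted compositions act on arguments: T sends
  the basis vector at y to the one at \<theta> y.\<close>

definition T :: "'i ell2 \<Rightarrow>\<^sub>L 'i ell2" where "T = weighted_comp (\<lambda>i. 1) \<theta>i (carrier F')"

definition Ti :: "'i ell2 \<Rightarrow>\<^sub>L 'i ell2" where "Ti = weighted_comp (\<lambda>i. 1) \<theta> (carrier F)"

lemma inj_\<theta>i: "inj_on \<theta>i (carrier F')"
  unfolding \<theta>i_def using \<theta>_bij by (metis bij_betw_def bij_betw_inv_into)

lemma inj_\<theta>: "inj_on \<theta> (carrier F)"
  using \<theta>_bij by (simp add: bij_betw_def)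

lemma coord_T: "coord (T v) i = (if i \<in> carrier F' then coord v (\<theta>i i) else 0)"
  unfolding T_def by (subst coord_weighted_comp) (simp_all add: inj_\<theta>i)

lemma coord_Ti: "coord (Ti v) i = (if i \<in> carrier F then coord v (\<theta> i) else 0)"
  unfolding Ti_def by (subst coord_weighted_comp) (simp_all add: inj_\<theta>)

lemma T_adjoint: "T x \<bullet> y = x \<bullet> Ti y"
  unfolding T_def Ti_def
  by (rule weighted_comp_adjoint)
    (use \<theta>_bij in \<open>auto simp: \<theta>i_def bij_betw_inv_into bij_betw_inv_into_right\<close>)

lemma T_cscale: "T (cscale \<alpha> v) = cscale \<alpha> (T v)"
  by (rule ell2_eqI) (simp add: coord_T)

lemma T_ket: "y \<in> carrier F \<Longrightarrow> T (ket_vec y) = ket_vec (\<theta> y)"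
  by (rule ell2_eqI) (auto simp: coord_T coord_ket_vec \<theta>i_\<theta> \<theta>_\<theta>i \<theta>_mem)

lemma T_R: assumes g: "g \<in> carrier G" shows "T (src.R g v) = dst.R (\<zeta> g) (T v)"
proof (rule ell2_eqI)
  fix i
  show "coord (T (src.R g v)) i = coord (dst.R (\<zeta> g) (T v)) i"
  proof (cases "i \<in> carrier F'")
    case True
    have pg: "p g \<in> carrier F" by (rule src.p_mem[OF g])
    let ?y = "inv\<^bsub>F\<^esub> p g \<otimes>\<^bsub>F\<^esub> \<theta>i i"
    have y: "?y \<in> carrier F" using pg \<theta>i_mem[OF True] by simp
    have "\<theta> (inv\<^bsub>F\<^esub> p g) = inv\<^bsub>F'\<^esub> \<theta> (p g)"
    proof -
      have "\<theta> \<in> hom F F'"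
        using \<theta>_mem \<theta>_mult by (auto simp: hom_def)
      then have "group_hom F F' \<theta>"
        by (intro group_hom.intro group_hom_axioms.intro src.F.is_group dst.F.is_group)
      from group_hom.hom_inv[OF this pg] show ?thesis .
    qed
    \<comment> \<open>The source of i under the shift in the second lattice is the \<theta>-image of
      the source of \<theta>i i in the first, so both phases are evaluated at corresponding
      points.\<close>
    then have \<theta>y: "inv\<^bsub>F'\<^esub> p' (\<zeta> g) \<otimes>\<^bsub>F'\<^esub> i = \<theta> ?y"
      using pg True by (simp add: p_\<zeta> g \<theta>_mult \<theta>i_mem \<theta>_\<theta>i)
    have "dst.phase (\<zeta> g) (\<theta> ?y) = src.phase g ?y"
      unfolding src.phase_def dst.phase_def p_\<zeta>[OF g] using y pg by (simp add: \<tau>_\<zeta> g)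
    then show ?thesis
      using True y by (simp add: coord_T src.coord_R dst.coord_R g \<zeta>_mem \<theta>i_mem \<theta>y \<theta>_mem \<theta>i_\<theta>)
  qed (simp add: coord_T dst.coord_R \<zeta>_mem g)
qed

section \<open>The unitary between the two GNS spaces\<close>

abbreviation "H \<equiv> gns_space src.W src.\<omega>"
abbreviation "H' \<equiv> gns_space dst.W dst.\<omega>"
abbreviation "J \<equiv> src.gns.gns_coord"
abbreviation "J' \<equiv> dst.gns.gns_coord"

lemma coord_J: "x \<in> carrier H \<Longrightarrow> i \<notin> carrier F \<Longrightarrow> coord (J x) i = 0"
  using src.gns_range by blast

text \<open>On functions supported on the carrier the adjoint of T is a left inverse; this is what
  makes T preserve inner products there.\<close>

lemma Ti_T: "(\<And>i. i \<notin> carrier F \<Longrightarrow> coord v i = 0) \<Longrightarrow> Ti (T v) = v"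
  by (rule ell2_eqI) (simp add: coord_T coord_Ti \<theta>_mem \<theta>i_\<theta>)

sublocale map: hilbert_model_map H J H' J' T
proof
  show "T ` J ` carrier H = J' ` carrier H'"
    unfolding src.gns_range dst.gns_range
  proof
    show "T ` {L. \<forall>i. i \<notin> carrier F \<longrightarrow> coord L i = 0} \<subseteq> {L. \<forall>i. i \<notin> carrier F' \<longrightarrow> coord L i = 0}"
      by (auto simp: coord_T)
    show "{L. \<forall>i. i \<notin> carrier F' \<longrightarrow> coord L i = 0} \<subseteq> T ` {L. \<forall>i. i \<notin> carrier F \<longrightarrow> coord L i = 0}"
    proof
      fix L assume "L \<in> {L. \<forall>i. i \<notin> carrier F' \<longrightarrow> coord L i = 0}"
      then have "L = T (Ti L)"
        by (intro ell2_eqI) (simp add: coord_T coord_Ti \<theta>i_mem \<theta>_\<theta>i)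
      then show "L \<in> T ` {L. \<forall>i. i \<notin> carrier F \<longrightarrow> coord L i = 0}"
        by (rule image_eqI) (simp add: coord_Ti)
    qed
  qed
  show "T (cscale \<alpha> v) = cscale \<alpha> (T v)" for \<alpha> v by (rule T_cscale)
  show "cinner (T (J x)) (T (J y)) = cinner (J x) (J y)" if "x \<in> carrier H" "y \<in> carrier H" for x y
    using Ti_T[OF coord_J[OF that(2)]]
    by (simp add: cinner_def T_adjoint flip: T_cscale)
qed

lemma U_lattice_vec: assumes "y \<in> carrier F" shows "map.U (src.lattice_vec y) = dst.lattice_vec (\<theta> y)"
  by (rule dst.model.J_eqI)
    (simp_all add: assms map.U_mem map.J_U src.lattice_vec_mem dst.lattice_vec_mem \<theta>_mem
      src.gns_coord_lattice_vec dst.gns_coord_lattice_vec T_ket)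

lemma U_unique:
  assumes "bounded_operator H H' V" "\<And>y. y \<in> carrier F \<Longrightarrow> V (src.lattice_vec y) = dst.lattice_vec (\<theta> y)"
    and "x \<in> carrier H"
  shows "V x = map.U x"
  by (rule map.bounded_operator_unique[where B = "carrier F" and e = src.lattice_vec])
    (use assms coord_J in \<open>auto simp: src.lattice_vec_mem src.gns_coord_lattice_vec U_lattice_vec\<close>)

text \<open>After passing to coordinates this is the intertwining property of T for the extended
  representations.\<close>

lemma U_rep:
  assumes a: "a \<in> carrier src.W" and x: "x \<in> carrier H"
  shows "map.U (gns_rep src.W src.\<omega> a x) = gns_rep dst.W dst.\<omega> (weyl_map G' \<sigma>' \<zeta> a) (map.U x)"
proof (rule dst.model.J_eqI)
  note wm = weyl_map_intertwiner[OF src.projective_rep_axioms dst.projective_rep_axioms \<zeta>_hom \<sigma>_\<zeta>,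
      where T = T, OF _ _ T_R T_cscale a]
  have mem: "weyl_map G' \<sigma>' \<zeta> a \<in> carrier dst.W" by (rule wm(1))
  show "map.U (gns_rep src.W src.\<omega> a x) \<in> carrier H'"
    "gns_rep dst.W dst.\<omega> (weyl_map G' \<sigma>' \<zeta> a) (map.U x) \<in> carrier H'"
    by (intro map.U_mem src.gns.gns_rep_mem dst.gns.gns_rep_mem mem a x)+
  show "J' (map.U (gns_rep src.W src.\<omega> a x)) = J' (gns_rep dst.W dst.\<omega> (weyl_map G' \<sigma>' \<zeta> a) (map.U x))"
    using wm(2)[of "J x"]
    by (simp add: map.J_U map.U_mem src.gns.gns_rep_mem src.gns.gns_coord_rep dst.gns.gns_coord_rep mem a x)
qed

lemma U_conjugation:
  assumes "a \<in> carrier src.W" "y \<in> carrier H'"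
  shows "map.U (gns_rep src.W src.\<omega> a (inv_into (carrier H) map.U y)) =
    gns_rep dst.W dst.\<omega> (weyl_map G' \<sigma>' \<zeta> a) y"
proof -
  have y: "y \<in> map.U ` carrier H"
    using map.hilbert_iso_U assms(2) by (simp add: hilbert_iso_def bij_betw_def)
  show ?thesis
    using U_rep[OF assms(1) inv_into_into[OF y]] by (simp only: f_inv_into_f[OF y])
qed

lemma U_gen:
  assumes g: "g \<in> carrier G" and x: "x \<in> carrier H"
  shows "map.U (gns_rep src.W src.\<omega> (weyl_gen G \<sigma> g) x) =
    gns_rep dst.W dst.\<omega> (weyl_gen G' \<sigma>' (\<zeta> g)) (map.U x)"
proof -
  note wm = weyl_map_intertwiner(3)[OF src.projective_rep_axioms dst.projective_rep_axioms \<zeta>_hom \<sigma>_\<zeta>,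
      where T = T, OF _ _ T_R T_cscale src.weyl_gen_mem[OF g] g]
  show ?thesis using U_rep[OF src.weyl_gen_mem[OF g] x] wm by simp
qed

lemma U_lattice_lincomb:
  assumes "finite A" "A \<subseteq> carrier F" "\<And>j. j \<in> A \<Longrightarrow> \<beta> (\<theta> j) = \<alpha> j"
  shows "map.U (lincomb H src.lattice_vec \<alpha> A) = lincomb H' dst.lattice_vec \<beta> (\<theta> ` A)"
proof -
  have "map.U (lincomb H src.lattice_vec \<alpha> A) = lincomb H' (\<lambda>j. map.U (src.lattice_vec j)) \<alpha> A"
    by (rule map.U_lincomb) (use assms in \<open>auto simp: src.lattice_vec_mem\<close>)
  also have "\<dots> = lincomb H' (\<lambda>j. dst.lattice_vec (\<theta> j)) \<alpha> A"
    unfolding lincomb_def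
    by (rule dst.model.finsum_cong')
      (use assms in \<open>auto simp: U_lattice_vec subset_iff dst.lattice_vec_mem \<theta>_mem dst.model.smult_mem\<close>)
  also have "\<dots> = lincomb H' dst.lattice_vec \<beta> (\<theta> ` A)"
    by (rule dst.model.lincomb_reindex)
      (use assms in \<open>auto simp: dst.lattice_vec_mem \<theta>_mem intro: inj_on_subset[OF inj_\<theta>]\<close>)
  finally show ?thesis .
qed

lemma U_lin_span:
  "map.U ` lin_span H src.lattice_vec (carrier F) = lin_span H' dst.lattice_vec (carrier F')"
proof (intro Set.set_eqI iffI)
  fix y assume "y \<in> map.U ` lin_span H src.lattice_vec (carrier F)"
  then obtain \<alpha> A where A: "finite A" "A \<subseteq> carrier F" and y: "y = map.U (lincomb H src.lattice_vec \<alpha> A)"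
    by (auto simp: lin_span_def)
  have "y = lincomb H' dst.lattice_vec (\<lambda>j. \<alpha> (\<theta>i j)) (\<theta> ` A)"
    unfolding y by (rule U_lattice_lincomb) (use A in \<open>auto simp: \<theta>i_\<theta> subset_iff\<close>)
  moreover have "finite (\<theta> ` A)" "\<theta> ` A \<subseteq> carrier F'"
    using A \<theta>_mem by auto
  ultimately show "y \<in> lin_span H' dst.lattice_vec (carrier F')"
    unfolding lin_span_def by blast
next
  fix y assume "y \<in> lin_span H' dst.lattice_vec (carrier F')"
  then obtain \<beta> B where B: "finite B" "B \<subseteq> carrier F'" and y: "y = lincomb H' dst.lattice_vec \<beta> B"
    by (auto simp: lin_span_def)
  have im: "\<theta> ` \<theta>i ` B = B"
    using B(2) by (force simp: image_image \<theta>_\<theta>i subset_iff)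
  have "y = map.U (lincomb H src.lattice_vec (\<lambda>j. \<beta> (\<theta> j)) (\<theta>i ` B))"
    unfolding y using U_lattice_lincomb[of "\<theta>i ` B" \<beta> "\<lambda>j. \<beta> (\<theta> j)"] B \<theta>i_mem
    by (auto simp: im)
  moreover have "finite (\<theta>i ` B)" "\<theta>i ` B \<subseteq> carrier F"
    using B \<theta>i_mem by auto
  ultimately show "y \<in> map.U ` lin_span H src.lattice_vec (carrier F)"
    unfolding lin_span_def by blast
qed

text \<open>Both operators are diagonal in the lattice vectors, which U relabels by \<theta>, so
  only eigenvalues at corresponding indices have to be compared.\<close>

lemma U_diag_operator:
  assumes ev: "\<And>y. y \<in> carrier F \<Longrightarrow> ev' (\<theta> y) = ev y"
    and x: "x \<in> lin_span H src.lattice_vec (carrier F)"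
  shows "map.U (diag_operator H src.lattice_vec (carrier F) ev x) =
    diag_operator H' dst.lattice_vec (carrier F') ev' (map.U x)"
proof -
  obtain \<alpha> A where A: "finite A" "A \<subseteq> carrier F" and x: "x = lincomb H src.lattice_vec \<alpha> A"
    using x by (auto simp: lin_span_def)
  have A': "finite (\<theta> ` A)" "\<theta> ` A \<subseteq> carrier F'"
    using A \<theta>_mem by auto
  have "map.U (diag_operator H src.lattice_vec (carrier F) ev x) =
      map.U (lincomb H src.lattice_vec (\<lambda>j. \<alpha> j * ev j) A)"
    unfolding x
    by (subst src.model.diag_operator_lincomb)
      (use A in \<open>auto simp: src.lattice_vec_mem src.gns_coord_lattice_vec\<close>)
  also have "\<dots> = lincomb H' dst.lattice_vec (\<lambda>j. \<alpha> (\<theta>i j) * ev' j) (\<theta> ` A)"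
    by (rule U_lattice_lincomb) (use A ev in \<open>auto simp: \<theta>i_\<theta> subset_iff\<close>)
  also have "\<dots> = diag_operator H' dst.lattice_vec (carrier F') ev' (lincomb H' dst.lattice_vec (\<lambda>j. \<alpha> (\<theta>i j)) (\<theta> ` A))"
    by (subst dst.model.diag_operator_lincomb)
      (use A' in \<open>auto simp: dst.lattice_vec_mem dst.gns_coord_lattice_vec\<close>)
  also have "lincomb H' dst.lattice_vec (\<lambda>j. \<alpha> (\<theta>i j)) (\<theta> ` A) = map.U x"
    unfolding x by (rule U_lattice_lincomb[symmetric]) (use A in \<open>auto simp: \<theta>i_\<theta> subset_iff\<close>)
  finally show ?thesis .
qed

end

section \<open>The topological sector\<close>

lemma comm_group_DirProd: "comm_group G \<Longrightarrow> comm_group H \<Longrightarrow> comm_group (G \<times>\<times> H)"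
  by (rule group.group_comm_groupI[OF DirProd_group])
    (auto simp: comm_group.axioms(2) comm_groupE(4))

lemma comm_group_free_pair: "comm_group (free_pair M k)"
  unfolding free_pair_def by (intro comm_group_DirProd comm_group_coh_free)

lemma group_top_free: "group (top_free M k)"
  unfolding top_free_def
  by (intro DirProd_group comm_group.axioms(2) comm_group_coh_Rquot comm_group_free_pair)

lemma (in group) additive_int_pow_sign:
  fixes f :: "'a \<Rightarrow> 'c::ab_group_add"
  assumes f: "\<And>x y. x \<in> carrier G \<Longrightarrow> y \<in> carrier G \<Longrightarrow> f (x \<otimes> y) = f x + f y"
    and x: "x \<in> carrier G" and \<epsilon>: "\<epsilon> = 1 \<or> \<epsilon> = (-1 :: int)"
  shows "f (x [^] \<epsilon>) = zact \<epsilon> (f x)"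
proof -
  have "f (inv x) = - f x"
    using f[of "inv x" x] f[of \<one> \<one>] x by (simp add: eq_neg_iff_add_eq_0)
  moreover have "x [^] (-1 :: int) = inv x"
    using int_pow_neg[OF x, of 1] x by simp
  ultimately show ?thesis
    using \<epsilon> x zact_minus[of 1 "f x"] by auto
qed

definition free_proj :: "'a top_elem \<Rightarrow> 'a free_class \<times> 'a free_class" where
  "free_proj = (\<lambda>(u, u\<^sub>1, z, z\<^sub>1). (z, z\<^sub>1))"

definition free_section :: "('a, 'n::finite) spacetime \<Rightarrow> nat \<Rightarrow> 'a free_class \<times> 'a free_class \<Rightarrow> 'a top_elem" where
  "free_section M k = (\<lambda>(z, z\<^sub>1). (fst \<one>\<^bsub>rquot_pair M k\<^esub>, snd \<one>\<^bsub>rquot_pair M k\<^esub>, z, z\<^sub>1))"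

text \<open>The part of \<open>sigma_free\<close> that pairs the phases of the first argument with
  the lattice part of the second; its antisymmetrisation is all of
  \<open>sigma_free\<close>.\<close>

definition free_char ::
  "('a, 'n::finite) spacetime \<Rightarrow> 'a set \<Rightarrow> 'a chain set \<Rightarrow> nat \<Rightarrow> 'a top_elem \<Rightarrow> 'a free_class \<times> 'a free_class \<Rightarrow> circle" where
  "free_char M S \<sigma> k = (\<lambda>(u, u\<^sub>1, _) (z, z\<^sub>1). let m = CARD('n) in
     pairing (points M) S \<sigma> (int m - int k - 1) (int k) u\<^sub>1 z -
     zact ((-1) ^ (k * (m - k))) (pairing (points M) S \<sigma> (int k - 1) (int m - int k) u z\<^sub>1))"

definition free_weight :: "('a, 'n::finite) spacetime \<Rightarrow> nat \<Rightarrow> 'a top_elem \<Rightarrow> complex" where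
  "free_weight M k = (\<lambda>(u, u\<^sub>1, z, z\<^sub>1). if (z, z\<^sub>1) = \<one>\<^bsub>free_pair M k\<^esub> then 1 else 0)"

definition free_dual :: "('a, 'n::finite) spacetime \<Rightarrow> nat \<Rightarrow> 'a free_class \<times> 'a free_class \<Rightarrow> 'a free_class \<times> 'a free_class" where
  "free_dual M k = (\<lambda>(z, z\<^sub>1). (z\<^sub>1, z [^]\<^bsub>coh_free (int k) (points M)\<^esub> duality_sign M k))"

lemma hypersurface_class_fundamental:
  fixes M :: "('a, 'n::{finite,linorder}) spacetime"
  assumes "fundamental_class M S \<sigma>"
  shows "hypersurface_class (points M) S \<sigma> (CARD('n) - 1)"
  using assms unfolding fundamental_class_def Let_def by unfold_locales blast

lemma phase_shift_free:
  fixes M :: "('a, 'n::{finite,linorder}) spacetime"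
  assumes \<sigma>: "fundamental_class M S \<sigma>"
  shows "phase_shift (top_free M k) (free_pair M k) free_proj (free_char M S \<sigma> k) (sigma_free M S \<sigma> k)
    (free_section M k) (free_weight M k)"
proof -
  interpret hypersurface_class "points M" S \<sigma> "CARD('n) - 1"
    by (rule hypersurface_class_fundamental[OF \<sigma>])
  let ?m = "CARD('n)"
  have m: "0 < ?m" by simp
  \<comment> \<open>Both pairings land in the top degree m - 1 of the hypersurface. The truncated
    subtraction is exact because m is positive.\<close>
  have deg: "int ?m - int k - 1 + int k = int (?m - 1)" "int k - 1 + (int ?m - int k) = int (?m - 1)"
    using m by (simp_all add: of_nat_diff)
  note L = pairing_mult_left[OF _ _ _ deg(1)] pairing_mult_left[OF _ _ _ deg(2)]
  note R = pairing_mult_right[OF _ _ _ deg(1)] pairing_mult_right[OF _ _ _ deg(2)]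
  note carr = top_free_def free_pair_def
  interpret Q1: comm_group "coh_Rquot (int k - 1) (points M)" by (rule comm_group_coh_Rquot)
  interpret Q2: comm_group "coh_Rquot (int ?m - int k - 1) (points M)" by (rule comm_group_coh_Rquot)
  have char_left: "free_char M S \<sigma> k (g \<otimes>\<^bsub>top_free M k\<^esub> h) y = free_char M S \<sigma> k g y + free_char M S \<sigma> k h y"
    if "g \<in> carrier (top_free M k)" "h \<in> carrier (top_free M k)" "y \<in> carrier (free_pair M k)" for g h y
    using that by (auto simp: free_char_def Let_def carr L zact_add_right)
  have one: "fst \<one>\<^bsub>rquot_pair M k\<^esub> \<in> carrier (coh_Rquot (int k - 1) (points M))"
      "snd \<one>\<^bsub>rquot_pair M k\<^esub> \<in> carrier (coh_Rquot (int ?m - int k - 1) (points M))"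
    by (simp_all add: rquot_pair_def)
  show ?thesis
  proof (intro phase_shift.intro phase_shift_axioms.intro group_top_free comm_group_free_pair char_left)
    show "free_proj \<in> hom (top_free M k) (free_pair M k)"
      by (auto simp: hom_def free_proj_def carr)
    show "free_char M S \<sigma> k g (x \<otimes>\<^bsub>free_pair M k\<^esub> y) = free_char M S \<sigma> k g x + free_char M S \<sigma> k g y"
      if "g \<in> carrier (top_free M k)" "x \<in> carrier (free_pair M k)" "y \<in> carrier (free_pair M k)" for g x y
      using that by (auto simp: free_char_def Let_def carr R zact_add_right)
    show "sigma_free M S \<sigma> k g h = free_char M S \<sigma> k g (free_proj h) - free_char M S \<sigma> k h (free_proj g)" for g h
      by (auto simp: sigma_free_def free_char_def free_proj_def Let_def split: prod.splits)
    fix y assume y: "y \<in> carrier (free_pair M k)"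
    show s: "free_section M k y \<in> carrier (top_free M k)"
      using y one by (auto simp: free_section_def carr)
    show "free_proj (free_section M k y) = y"
      by (simp add: free_proj_def free_section_def split: prod.splits)
    show "free_char M S \<sigma> k (free_section M k y) x = 0" if "x \<in> carrier (free_pair M k)" for x
    proof -
      \<comment> \<open>The character depends on the phase part only, which for a section is that of
        the neutral element; additivity at the neutral element forces the value 0.\<close>
      let ?e = "free_section M k \<one>\<^bsub>free_pair M k\<^esub>"
      have "?e = \<one>\<^bsub>top_free M k\<^esub>"
        by (simp add: free_section_def carr rquot_pair_def)
      moreover have "\<one>\<^bsub>top_free M k\<^esub> \<otimes>\<^bsub>top_free M k\<^esub> \<one>\<^bsub>top_free M k\<^esub> = \<one>\<^bsub>top_free M k\<^esub>"
        "\<one>\<^bsub>top_free M k\<^esub> \<in> carrier (top_free M k)"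
        using group_top_free[of M k] by (simp_all add: group.is_monoid)
      ultimately have "free_char M S \<sigma> k ?e x = 0"
        using char_left[of "\<one>\<^bsub>top_free M k\<^esub>" "\<one>\<^bsub>top_free M k\<^esub>" x] that by simp
      moreover have "free_char M S \<sigma> k (free_section M k y) x = free_char M S \<sigma> k ?e x"
        by (simp add: free_char_def free_section_def split: prod.splits)
      ultimately show ?thesis by simp
    qed
  next
    show "free_weight M k g = (if free_proj g = \<one>\<^bsub>free_pair M k\<^esub> then 1 else 0)" for g
      by (simp add: free_weight_def free_proj_def split: prod.splits)
  qed
qed

lemma weyl_duality_free:
  fixes M :: "('a, 'n::{finite,linorder}) spacetime"
  assumes \<sigma>: "fundamental_class M S \<sigma>" and k: "k \<le> CARD('n)"
  defines "k' \<equiv> CARD('n) - k"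
  shows "weyl_duality (top_free M k) (free_pair M k) free_proj (free_char M S \<sigma> k) (sigma_free M S \<sigma> k)
      (free_section M k) (free_weight M k)
    (top_free M k') (free_pair M k') free_proj (free_char M S \<sigma> k') (sigma_free M S \<sigma> k')
      (free_section M k') (free_weight M k')
    (zeta_free M k) (free_dual M k)"
proof (intro weyl_duality.intro weyl_duality_axioms.intro phase_shift_free[OF \<sigma>])
  let ?m = "CARD('n)" and ?\<epsilon> = "duality_sign M k"
  interpret hypersurface_class "points M" S \<sigma> "CARD('n) - 1"
    by (rule hypersurface_class_fundamental[OF \<sigma>])
  have m: "0 < ?m" by simp
  have deg: "int ?m - int k - 1 + int k = int (?m - 1)" "int k - 1 + (int ?m - int k) = int (?m - 1)"
    using m by (simp_all add: of_nat_diff)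
  have k': "int k' = int ?m - int k" "?m - k' = k"
    using k by (simp_all add: k'_def of_nat_diff)
  have \<epsilon>: "?\<epsilon> = 1 \<or> ?\<epsilon> = -1"
    by (simp add: duality_sign_def minus_one_power_iff)
  interpret Q: comm_group "coh_Rquot (int k - 1) (points M)" by (rule comm_group_coh_Rquot)
  interpret Z: comm_group "coh_free (int k) (points M)" by (rule comm_group_coh_free)
  note carr = top_free_def free_pair_def k'
  show "zeta_free M k \<in> hom (top_free M k) (top_free M k')"
    by (auto simp: hom_def zeta_free_def carr Q.int_pow_distrib Z.int_pow_distrib)
  \<comment> \<open>As \<epsilon> is a sign, taking the power \<epsilon> twice is the identity. The
    inverse of the duality map therefore exchanges the entries back and applies \<epsilon>
    again.\<close>
  have sq: "(z [^]\<^bsub>coh_free (int k) (points M)\<^esub> ?\<epsilon>) [^]\<^bsub>coh_free (int k) (points M)\<^esub> ?\<epsilon> = z"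
    if "z \<in> carrier (coh_free (int k) (points M))" for z
    using \<epsilon> that by (auto simp: Z.int_pow_pow)
  show "bij_betw (free_dual M k) (carrier (free_pair M k)) (carrier (free_pair M k'))"
    by (rule bij_betw_byWitness[where f' = "\<lambda>(z\<^sub>1, z). (z [^]\<^bsub>coh_free (int k) (points M)\<^esub> ?\<epsilon>, z\<^sub>1)"])
      (auto simp: free_dual_def carr sq)
  show "free_dual M k (x \<otimes>\<^bsub>free_pair M k\<^esub> y) = free_dual M k x \<otimes>\<^bsub>free_pair M k'\<^esub> free_dual M k y"
    if "x \<in> carrier (free_pair M k)" "y \<in> carrier (free_pair M k)" for x y
    using that by (auto simp: free_dual_def carr Z.int_pow_distrib)
  show "free_proj (zeta_free M k g) = free_dual M k (free_proj g)" for g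
    by (simp add: free_proj_def zeta_free_def free_dual_def split: prod.splits)
  fix g y assume g: "g \<in> carrier (top_free M k)" and y: "y \<in> carrier (free_pair M k)"
  obtain u u1 a where g_eq: "g = (u, u1, a)" by (cases g) auto
  obtain z z1 where y_eq: "y = (z, z1)" by (cases y) auto
  have c: "u \<in> carrier (coh_Rquot (int k - 1) (points M))" "u1 \<in> carrier (coh_Rquot (int ?m - int k - 1) (points M))"
    "z \<in> carrier (coh_free (int k) (points M))" "z1 \<in> carrier (coh_free (int ?m - int k) (points M))"
    using g y by (auto simp: g_eq y_eq carr)
  let ?A = "pairing (points M) S \<sigma> (int ?m - int k - 1) (int k)"
  let ?B = "pairing (points M) S \<sigma> (int k - 1) (int ?m - int k)"
  let ?s = "(-1) ^ (k * (?m - k)) :: int"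
  have B: "?B (u [^]\<^bsub>coh_Rquot (int k - 1) (points M)\<^esub> ?\<epsilon>) z1 = zact ?\<epsilon> (?B u z1)"
    by (rule Q.additive_int_pow_sign[OF _ c(1) \<epsilon>]) (rule pairing_mult_left[OF _ _ c(4) deg(2)])
  have A: "?A u1 (z [^]\<^bsub>coh_free (int k) (points M)\<^esub> ?\<epsilon>) = zact ?\<epsilon> (?A u1 z)"
    by (rule Z.additive_int_pow_sign[OF _ c(3) \<epsilon>]) (rule pairing_mult_right[OF c(2) _ _ deg(1)])
  \<comment> \<open>These relations explain the value of \<epsilon>: in degree m - k the two
    pairings exchange places and each acquires \<epsilon>; with \<epsilon> = - s and s s = 1 the
    expression returns to the one in degree k.\<close>
  have s: "?\<epsilon> = - ?s" "?s * ?s = 1"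
    by (simp_all add: duality_sign_def flip: power_mult_distrib)
  have "free_char M S \<sigma> k' (zeta_free M k g) (free_dual M k y) =
      ?B (u [^]\<^bsub>coh_Rquot (int k - 1) (points M)\<^esub> ?\<epsilon>) z1 -
      zact ?s (?A u1 (z [^]\<^bsub>coh_free (int k) (points M)\<^esub> ?\<epsilon>))"
    by (simp add: free_char_def zeta_free_def free_dual_def g_eq y_eq Let_def k' k'_def[symmetric]
        mult.commute[of k'] split: prod.splits)
  also have "\<dots> = ?A u1 z - zact ?s (?B u z1)"
    unfolding A B zact_zact unfolding s(1) mult_minus_right s(2) zact_minus by simp
  finally show "free_char M S \<sigma> k' (zeta_free M k g) (free_dual M k y) = free_char M S \<sigma> k g y"
    by (simp add: free_char_def g_eq y_eq Let_def)
qed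

section \<open>Translation to the operators of the topological sector\<close>

lemma H_free_eq: "H_free M S \<sigma> k = gns_space (weyl_algebra (top_free M k) (sigma_free M S \<sigma> k))
    (weyl_functional (free_weight M k))"
  by (simp add: H_free_def weyl_free_def omega_free_def free_weight_def)

lemma pi_free_eq: "pi_free M S \<sigma> k = gns_rep (weyl_algebra (top_free M k) (sigma_free M S \<sigma> k))
    (weyl_functional (free_weight M k))"
  by (simp add: pi_free_def weyl_free_def omega_free_def free_weight_def)

lemma ket_eq:
  fixes M :: "('a, 'n::{finite,linorder}) spacetime"
  assumes "fundamental_class M S \<sigma>"
  shows "ket M S \<sigma> k = phase_shift.lattice_vec (top_free M k) (sigma_free M S \<sigma> k) (free_section M k) (free_weight M k)"
  unfolding fun_eq_iff phase_shift.lattice_vec_def[OF phase_shift_free[OF assms]]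
  by (simp add: ket_def weyl_free_def omega_free_def W_free_def free_section_def free_weight_def)

theorem mainTheorem8:
  fixes M :: "('a, 'n::{finite,linorder}) spacetime"
    and S :: "'a set" and \<sigma> :: "'a chain set" and m k :: nat and \<epsilon> :: int
  assumes "is_spacetime M" and "globally_hyperbolic M"
    and "compact_spacelike_cauchy_surface M S" and "fundamental_class M S \<sigma>"
    and "m = CARD('n)" and "k \<le> m" and "\<epsilon> = (-1) ^ (k * (m - k) + 1)"
  shows "\<exists>U.
    hilbert_iso (H_free M S \<sigma> k) (H_free M S \<sigma> (m - k)) U \<and>
    (\<forall>(z, z\<^sub>1)\<in>carrier (free_pair M k).
       U (ket M S \<sigma> k (z, z\<^sub>1)) = ket M S \<sigma> (m - k) (z\<^sub>1, z [^]\<^bsub>coh_free (int k) (points M)\<^esub> \<epsilon>)) \<and>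
    (\<forall>V. bounded_operator (H_free M S \<sigma> k) (H_free M S \<sigma> (m - k)) V \<and>
       (\<forall>(z, z\<^sub>1)\<in>carrier (free_pair M k).
         V (ket M S \<sigma> k (z, z\<^sub>1)) = ket M S \<sigma> (m - k) (z\<^sub>1, z [^]\<^bsub>coh_free (int k) (points M)\<^esub> \<epsilon>))
       \<longrightarrow> (\<forall>x\<in>carrier (H_free M S \<sigma> k). V x = U x)) \<and>
    (\<forall>a\<in>carrier (weyl_free M S \<sigma> k). \<forall>y\<in>carrier (H_free M S \<sigma> (m - k)).
       U (pi_free M S \<sigma> k a (inv_into (carrier (H_free M S \<sigma> k)) U y)) =
       pi_free M S \<sigma> (m - k)
         (weyl_map (top_free M (m - k)) (sigma_free M S \<sigma> (m - k)) (zeta_free M k) a) y) \<and>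
    (\<forall>(u, u\<^sub>1)\<in>carrier (rquot_pair M k). \<forall>x\<in>carrier (H_free M S \<sigma> k).
       U (phase_op M S \<sigma> k (u, u\<^sub>1) x) =
       phase_op M S \<sigma> (m - k) (u\<^sub>1, u [^]\<^bsub>coh_Rquot (int k - 1) (points M)\<^esub> \<epsilon>) (U x)) \<and>
    (\<forall>(z, z\<^sub>1)\<in>carrier (free_pair M k). \<forall>x\<in>carrier (H_free M S \<sigma> k).
       U (shift_op M S \<sigma> k (z, z\<^sub>1) x) =
       shift_op M S \<sigma> (m - k) (z\<^sub>1, z [^]\<^bsub>coh_free (int k) (points M)\<^esub> \<epsilon>) (U x)) \<and>
    U ` D_free M S \<sigma> k = D_free M S \<sigma> (m - k) \<and>
    (\<forall>(r, r\<^sub>1)\<in>carrier (real_pair M k). \<forall>x\<in>D_free M S \<sigma> k.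
       U (flux_op M S \<sigma> k (r, r\<^sub>1) x) =
       flux_op M S \<sigma> (m - k) (r\<^sub>1, r [^]\<^bsub>coh_R (int k - 1) (points M)\<^esub> \<epsilon>) (U x)) \<and>
    (m = 2 * k \<longrightarrow>
       hilbert_iso (H_free M S \<sigma> k) (H_free M S \<sigma> k) U \<and>
       (\<forall>r\<in>carrier (coh_R (int k - 1) (points M)). \<forall>r\<^sub>1\<in>carrier (coh_R (int k - 1) (points M)).
          \<forall>x\<in>D_free M S \<sigma> k.
          flux_op M S \<sigma> k
            (r\<^sub>1, r [^]\<^bsub>coh_R (int k - 1) (points M)\<^esub> ((-1) ^ (k\<^sup>2 + 1) :: int)) (U x) =
          U (flux_op M S \<sigma> k (r, r\<^sub>1) x)))"
proof -
  note fund = assms(4)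
  have m: "m = CARD('n)" "k \<le> CARD('n)" using assms(5,6) by simp_all
  have \<epsilon>: "\<epsilon> = duality_sign M k" by (simp add: duality_sign_def assms(5,7))
  let ?k' = "CARD('n) - k"
  interpret D: weyl_duality "top_free M k" "free_pair M k" free_proj "free_char M S \<sigma> k" "sigma_free M S \<sigma> k"
      "free_section M k" "free_weight M k"
    "top_free M ?k'" "free_pair M ?k'" free_proj "free_char M S \<sigma> ?k'" "sigma_free M S \<sigma> ?k'"
      "free_section M ?k'" "free_weight M ?k'" "zeta_free M k" "free_dual M k"
    by (rule weyl_duality_free[OF fund m(2)])
  have k': "int ?k' = int CARD('n) - int k" "CARD('n) - ?k' = k"
    using m(2) by (simp_all add: of_nat_diff)
  have eqs: "D.H = H_free M S \<sigma> k" "D.H' = H_free M S \<sigma> ?k'"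
    "gns_rep D.src.W D.src.\<omega> = pi_free M S \<sigma> k" "gns_rep D.dst.W D.dst.\<omega> = pi_free M S \<sigma> ?k'"
    "D.src.lattice_vec = ket M S \<sigma> k" "D.dst.lattice_vec = ket M S \<sigma> ?k'"
    by (simp_all only: H_free_eq pi_free_eq ket_eq[OF fund])
  define U where "U = D.map.U"
  have iso: "hilbert_iso (H_free M S \<sigma> k) (H_free M S \<sigma> ?k') U"
    using D.map.hilbert_iso_U[folded U_def] by (simp only: eqs)
  have kets: "U (ket M S \<sigma> k (z, z\<^sub>1)) = ket M S \<sigma> ?k' (z\<^sub>1, z [^]\<^bsub>coh_free (int k) (points M)\<^esub> \<epsilon>)"
    if "(z, z\<^sub>1) \<in> carrier (free_pair M k)" for z z\<^sub>1
    using D.U_lattice_vec[OF that, folded U_def] by (simp add: eqs free_dual_def \<epsilon>)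
  have unique: "V x = U x"
    if V: "bounded_operator (H_free M S \<sigma> k) (H_free M S \<sigma> ?k') V"
      "\<forall>(z, z\<^sub>1)\<in>carrier (free_pair M k).
         V (ket M S \<sigma> k (z, z\<^sub>1)) = ket M S \<sigma> ?k' (z\<^sub>1, z [^]\<^bsub>coh_free (int k) (points M)\<^esub> \<epsilon>)"
      and x: "x \<in> carrier (H_free M S \<sigma> k)" for V x
  proof (rule D.U_unique[folded U_def, unfolded eqs, OF V(1) _ x])
    fix y assume "y \<in> carrier (free_pair M k)"
    with V(2) show "V (ket M S \<sigma> k y) = ket M S \<sigma> ?k' (free_dual M k y)"
      by (cases y) (auto simp: free_dual_def \<epsilon>)
  qed
  have conj: "U (pi_free M S \<sigma> k a (inv_into (carrier (H_free M S \<sigma> k)) U y)) =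
      pi_free M S \<sigma> ?k' (weyl_map (top_free M ?k') (sigma_free M S \<sigma> ?k') (zeta_free M k) a) y"
    if "a \<in> carrier (weyl_free M S \<sigma> k)" "y \<in> carrier (H_free M S \<sigma> ?k')" for a y
    using D.U_conjugation[of a y, folded U_def] that by (simp only: eqs weyl_free_def)
  have gen: "U (pi_free M S \<sigma> k (W_free M S \<sigma> k g) x) = pi_free M S \<sigma> ?k' (W_free M S \<sigma> ?k' (zeta_free M k g)) (U x)"
    if "g \<in> carrier (top_free M k)" "x \<in> carrier (H_free M S \<sigma> k)" for g x
    using D.U_gen[of g x, folded U_def] that by (simp only: eqs W_free_def)
  interpret Q: comm_group "coh_Rquot (int k - 1) (points M)" by (rule comm_group_coh_Rquot)
  interpret Z: comm_group "coh_free (int k) (points M)" by (rule comm_group_coh_free)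
  interpret Q1: comm_group "coh_Rquot (int CARD('n) - int k - 1) (points M)" by (rule comm_group_coh_Rquot)
  interpret Z1: comm_group "coh_free (int CARD('n) - int k) (points M)" by (rule comm_group_coh_free)
  have phase: "U (phase_op M S \<sigma> k (u, u\<^sub>1) x) =
      phase_op M S \<sigma> ?k' (u\<^sub>1, u [^]\<^bsub>coh_Rquot (int k - 1) (points M)\<^esub> \<epsilon>) (U x)"
    if "(u, u\<^sub>1) \<in> carrier (rquot_pair M k)" "x \<in> carrier (H_free M S \<sigma> k)" for u u\<^sub>1 x
  proof -
    \<comment> \<open>A phase operator is the generator with neutral lattice part, which duality
      keeps neutral because every power of the neutral element is neutral.\<close>
    let ?g = "(u, u\<^sub>1, \<one>\<^bsub>free_pair M k\<^esub>)"
    have "?g \<in> carrier (top_free M k)"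
      using that(1) by (simp add: top_free_def rquot_pair_def free_pair_def)
    from gen[OF this that(2)] show ?thesis
      by (simp add: phase_op_def zeta_free_def free_pair_def k' \<epsilon>)
  qed
  have shift: "U (shift_op M S \<sigma> k (z, z\<^sub>1) x) =
      shift_op M S \<sigma> ?k' (z\<^sub>1, z [^]\<^bsub>coh_free (int k) (points M)\<^esub> \<epsilon>) (U x)"
    if "(z, z\<^sub>1) \<in> carrier (free_pair M k)" "x \<in> carrier (H_free M S \<sigma> k)" for z z\<^sub>1 x
  proof -
    let ?g = "(fst \<one>\<^bsub>rquot_pair M k\<^esub>, snd \<one>\<^bsub>rquot_pair M k\<^esub>, z, z\<^sub>1)"
    have "?g \<in> carrier (top_free M k)"
      using that(1) by (simp add: top_free_def rquot_pair_def free_pair_def)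
    from gen[OF this that(2)] show ?thesis
      by (simp add: shift_op_def zeta_free_def rquot_pair_def k' \<epsilon>)
  qed
  have dom: "U ` D_free M S \<sigma> k = D_free M S \<sigma> ?k'"
    using D.U_lin_span[folded U_def] by (simp only: eqs D_free_def)
  have flux: "U (flux_op M S \<sigma> k (r, r\<^sub>1) x) =
      flux_op M S \<sigma> ?k' (r\<^sub>1, r [^]\<^bsub>coh_R (int k - 1) (points M)\<^esub> \<epsilon>) (U x)"
    if r: "(r, r\<^sub>1) \<in> carrier (real_pair M k)" and x: "x \<in> D_free M S \<sigma> k" for r r\<^sub>1 x
  proof -
    interpret hypersurface_class "points M" S \<sigma> "CARD('n) - 1"
      by (rule hypersurface_class_fundamental[OF fund])
    interpret C: comm_group "coh_R (int k - 1) (points M)" by (rule comm_group_coh_R)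
    have pos: "0 < CARD('n)" by simp
    have deg: "int CARD('n) - int k - 1 + int k = int (CARD('n) - 1)"
      "int k - 1 + (int CARD('n) - int k) = int (CARD('n) - 1)"
      using pos by (simp_all add: of_nat_diff)
    have sgn: "\<epsilon> = 1 \<or> \<epsilon> = -1"
      by (simp add: assms(7) minus_one_power_iff)
    let ?A = "real_pairing (points M) S \<sigma> (int CARD('n) - int k - 1) (int k)"
    let ?B = "real_pairing (points M) S \<sigma> (int k - 1) (int CARD('n) - int k)"
    let ?s = "(-1) ^ (k * ?k') :: real"
    have \<epsilon>s: "real_of_int \<epsilon> = - ?s" "?s * ?s = 1"
      by (simp_all add: assms(5,7) flip: power_mult_distrib)
    have c: "r \<in> carrier (coh_R (int k - 1) (points M))" "r\<^sub>1 \<in> carrier (coh_R (int CARD('n) - int k - 1) (points M))"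
      using r by (simp_all add: real_pair_def)
    \<comment> \<open>The exchange of pairings seen for the characters, now with real values: here s
      \<epsilon> = -1 restores the first term and \<epsilon> = - s the second.\<close>
    have ev: "?B (r [^]\<^bsub>coh_R (int k - 1) (points M)\<^esub> \<epsilon>) z\<^sub>1 - ?s * ?A r\<^sub>1 (z [^]\<^bsub>coh_free (int k) (points M)\<^esub> \<epsilon>) =
        ?A r\<^sub>1 z - ?s * ?B r z\<^sub>1"
      if "(z, z\<^sub>1) \<in> carrier (free_pair M k)" for z z\<^sub>1
    proof -
      have z: "z \<in> carrier (coh_free (int k) (points M))" "z\<^sub>1 \<in> carrier (coh_free (int CARD('n) - int k) (points M))"
        using that by (simp_all add: free_pair_def)
      have "?B (r [^]\<^bsub>coh_R (int k - 1) (points M)\<^esub> \<epsilon>) z\<^sub>1 = zact \<epsilon> (?B r z\<^sub>1)"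
        by (rule C.additive_int_pow_sign[OF _ c(1) sgn]) (rule real_pairing_mult_left[OF _ _ z(2) deg(2)])
      moreover have "?A r\<^sub>1 (z [^]\<^bsub>coh_free (int k) (points M)\<^esub> \<epsilon>) = zact \<epsilon> (?A r\<^sub>1 z)"
        by (rule Z.additive_int_pow_sign[OF _ z(1) sgn]) (rule real_pairing_mult_right[OF c(2) _ _ deg(1)])
      moreover have "?s * (?s * a) = a" for a using \<epsilon>s(2) by (simp flip: mult.assoc)
      ultimately show ?thesis by (simp add: \<epsilon>s(1))
    qed
    let ?ev = "\<lambda>(z, z\<^sub>1). complex_of_real (2 * (?A r\<^sub>1 z - ?s * ?B r z\<^sub>1))"
    let ?ev' = "\<lambda>(z, z\<^sub>1). complex_of_real (2 * (?B (r [^]\<^bsub>coh_R (int k - 1) (points M)\<^esub> \<epsilon>) z - ?s * ?A r\<^sub>1 z\<^sub>1))"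
    have 1: "flux_op M S \<sigma> k (r, r\<^sub>1) = diag_operator (H_free M S \<sigma> k) (ket M S \<sigma> k) (carrier (free_pair M k)) ?ev"
      by (simp add: flux_op_def Let_def)
    have 2: "flux_op M S \<sigma> ?k' (r\<^sub>1, r [^]\<^bsub>coh_R (int k - 1) (points M)\<^esub> \<epsilon>) =
        diag_operator (H_free M S \<sigma> ?k') (ket M S \<sigma> ?k') (carrier (free_pair M ?k')) ?ev'"
      by (simp add: flux_op_def Let_def k' mult.commute[of ?k'])
    show ?thesis
      unfolding 1 2
    proof (rule D.U_diag_operator[folded U_def, unfolded eqs])
      show "x \<in> lin_span (H_free M S \<sigma> k) (ket M S \<sigma> k) (carrier (free_pair M k))"
        using x by (simp add: D_free_def)
      fix y assume y: "y \<in> carrier (free_pair M k)"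
      obtain z z\<^sub>1 where yz: "y = (z, z\<^sub>1)" by (cases y)
      show "?ev' (free_dual M k y) = ?ev y"
        by (simp only: yz free_dual_def \<epsilon>[symmetric] prod.case ev[OF y[unfolded yz]])
    qed
  qed
  show ?thesis
    unfolding m(1)
  proof (intro exI[of _ U] conjI)
    show "CARD('n) = 2 * k \<longrightarrow> hilbert_iso (H_free M S \<sigma> k) (H_free M S \<sigma> k) U \<and>
       (\<forall>r\<in>carrier (coh_R (int k - 1) (points M)). \<forall>r\<^sub>1\<in>carrier (coh_R (int k - 1) (points M)).
          \<forall>x\<in>D_free M S \<sigma> k.
          flux_op M S \<sigma> k
            (r\<^sub>1, r [^]\<^bsub>coh_R (int k - 1) (points M)\<^esub> ((-1) ^ (k\<^sup>2 + 1) :: int)) (U x) =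
          U (flux_op M S \<sigma> k (r, r\<^sub>1) x))"
    proof
      assume mk: "CARD('n) = 2 * k"
      \<comment> \<open>In the middle degree k (m - k) is the square of k, and the two degrees of
        real classes coincide.\<close>
      have kk: "?k' = k" "(-1) ^ (k\<^sup>2 + 1) = \<epsilon>" "int CARD('n) - int k - 1 = int k - 1"
        using mk by (simp_all add: assms(5,7) power2_eq_square)
      show "hilbert_iso (H_free M S \<sigma> k) (H_free M S \<sigma> k) U \<and>
       (\<forall>r\<in>carrier (coh_R (int k - 1) (points M)). \<forall>r\<^sub>1\<in>carrier (coh_R (int k - 1) (points M)).
          \<forall>x\<in>D_free M S \<sigma> k.
          flux_op M S \<sigma> k
            (r\<^sub>1, r [^]\<^bsub>coh_R (int k - 1) (points M)\<^esub> ((-1) ^ (k\<^sup>2 + 1) :: int)) (U x) =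
          U (flux_op M S \<sigma> k (r, r\<^sub>1) x))"
      proof (intro conjI ballI)
        show "hilbert_iso (H_free M S \<sigma> k) (H_free M S \<sigma> k) U"
          using iso unfolding kk(1) .
        fix r r\<^sub>1 x
        assume r: "r \<in> carrier (coh_R (int k - 1) (points M))" "r\<^sub>1 \<in> carrier (coh_R (int k - 1) (points M))"
          and x: "x \<in> D_free M S \<sigma> k"
        have "(r, r\<^sub>1) \<in> carrier (real_pair M k)" using r by (simp add: real_pair_def kk(3))
        from flux[OF this x] show "flux_op M S \<sigma> k
            (r\<^sub>1, r [^]\<^bsub>coh_R (int k - 1) (points M)\<^esub> ((-1) ^ (k\<^sup>2 + 1) :: int)) (U x) =
          U (flux_op M S \<sigma> k (r, r\<^sub>1) x)"
          unfolding kk(1,2) by (rule sym)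
      qed
    qed
  qed (use iso kets unique conj phase shift dom flux in auto)
qed

end
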